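(* Let $N\ge2$, $\gamma\in(0,2)$, $\theta_0\in[0,1]$, $M>1$, $\lambda>0$, and let $C_1,C_2,C_3>0$ be constants. Let $c(z)dz$ be a positive Radon measure on $\mathbf{R}^N\setminus\{0\}$ such that $$\int_{\mathbf{R}^N}\min(|z|^2,1)\,c(z)dz\le C_1,\qquad \frac{C_2}{|z|^{N+\gamma}}\le |c(z)|\le \frac{C_3}{|z|^{N+\gamma}}\quad\text{for all } 0<|z|\le 1 .$$ Let $g$ be periodic in $x\in\mathbf{T}^N$ with $|g(x)-g(y)|\le M|x-y|^{\theta_0}$ for all $x,y\in\mathbf{R}^N$. Let $F:\mathbf{R}^N\times\mathbf{R}^N\times\mathbf{S}^N\to\mathbf{R}$ be continuous and degenerate elliptic ($F(x,p,X)\ge F(x,p,Y)$ if $X\le Y$), with $F(\cdot,p,X)$ periodic in $x\in\mathbf{T}^N$ for all $p\in\mathbf{R}^N$, $X\in\mathbf{S}^N$. Let $0<k\le N$ be an integer; write $p=(p',p'')\in\mathbf{R}^k\times\mathbf{R}^{N-k}$ and, for $X\in\mathbf{S}^N$, let $X'\in\mathbf{S}^k$ be its upper-left $k\times k$ block, $X=\begin{pmatrix} X' & X_{12} \\ {} X_{21} & X_{22} \end{pmatrix}$. Assume: (partial uniform ellipticity) there exists $\lambda_1>0$ such that $$F(x,p,X)\ge F(x,p,Y)+\lambda_1\mathrm{Tr}(Y'-X')$$ for all $x\in\mathbf{T}^N$, $p\in\mathbf{R}^N$, and all $X,Y\in\mathbf{S}^N$ with $X'\le Y'$; (continuity) there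 are $q'\ge1$ and functions $w',\eta':[0,\infty)\to[0,\infty)$ with $\lim_{\sigma\downarrow0}w'(\sigma)=\lim_{\sigma\downarrow0}\eta'(\sigma)=0$ such that $$|F(x,p,X)-F(y,p,X)|\le w'(|x-y|)|p'|^{q'}+\eta'(|x-y|)\|X'\|$$ for all $x,y\in\mathbf{T}^N$, $p\in\mathbf{R}^N$, $X\in\mathbf{S}^N$; and there exist constants $L>0$, $\rho_1,\rho_2>0$ such that $$\lim_{s\downarrow0}w'(s)s^{-\rho_1}\le L,\qquad\lim_{s\downarrow0}\eta'(s)s^{-\rho_2}\le L,$$ with $\rho_1+\gamma>q'$ and $\rho_2+\gamma>2$. Let $v$ be a periodic viscosity solution of $$\lambda v(x)+F(x,\nabla v(x),\nabla^2v(x))-\int_{\mathbf{R}^N}\big[v(x+z)-v(x)-\mathbf{1}_{|z|\le1}\langle\nabla v(x),z\rangle\big]c(z)dz-g(x)=0,\qquad x\in\mathbf{T}^N,$$ satisfying $\sup|v|<M$. Then for any $\theta\in(0,\theta_0)$ there exists a constant $C_\theta>0$ such that $$|v(x)-v(y)|\le\frac{C_\theta}{\lambda}|x-y|^\theta\qquad\text{for all }x,y\in\mathbf{T}^N.$$ The constant $C_\theta$ does not depend on $\lambda\in(0,1)$.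
   Context: $\mathbf{T}^N=\mathbf{R}^N/\mathbf{Z}^N$; functions on $\mathbf{T}^N$ are identified with $\mathbf{Z}^N$-periodic functions on $\mathbf{R}^N$. $\mathbf{S}^N$ is the set of real symmetric $N\times N$ matrices with its usual order; $I$ is the identity matrix. The constant $M$ is a uniform constant, i.e. it does not depend on $\lambda$. For $u$ upper semicontinuous (resp. lower semicontinuous), $J^{2,+}u(\hat x)$ (resp. $J^{2,-}u(\hat x)$) is the second-order superjet (resp. subjet): the set of $(p,X)\in\mathbf{R}^N\times\mathbf{S}^N$ with $u(\hat x+z)\le$ (resp. $\ge$) $u(\hat x)+\langle p,z\rangle+\frac12\langle Xz,z\rangle+o(|z|^2)$ as $z\to0$. Hence for every $\delta>0$ there is $\varepsilon>0$ such that (A) $u(\hat x+z)\le u(\hat x)+\langle p,z\rangle+\frac12\langle Xz,z\rangle+\delta|z|^2$ for $|z|\le\varepsilon$ (resp. (B) $u(\hat x+z)\ge u(\hat x)+\langle p,z\rangle+\frac12\langle Xz,z\rangle-\delta|z|^2$ for $|z|\le\varepsilon$). Definition of viscosity solution. An upper semicontinuous $u$ is a viscosity subsolution of the equation if for any $\hat x$, any $(p,X)\in J^{2,+}u(\hat x)$, any pair of positive numbers $(\varepsilon,\delta)$ satisfying (A), and any $0<\varepsilon'\le\varepsilon$, $$\lambda u(\hat x)+F(\hat x,p,X)-\int_{|z|<\varepsilon'}\tfrac12\langle(X+2\delta I)z,z\rangle c(z)dz-\int_{|z|\ge\varepsilon'}[u(\hat x+z)-u(\hat x)-\mathbf{1}_{|z|\le1}\langle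 z,p\rangle]c(z)dz-g(\hat x)\le0.$$ A lower semicontinuous $u$ is a viscosity supersolution if for any $\hat x$, any $(p,X)\in J^{2,-}u(\hat x)$, any pair $(\varepsilon,\delta)$ satisfying (B), and any $0<\varepsilon'\le\varepsilon$, $$\lambda u(\hat x)+F(\hat x,p,X)-\int_{|z|<\varepsilon'}\tfrac12\langle(X-2\delta I)z,z\rangle c(z)dz-\int_{|z|\ge\varepsilon'}[u(\hat x+z)-u(\hat x)-\mathbf{1}_{|z|\le1}\langle z,p\rangle]c(z)dz-g(\hat x)\ge0.$$ A viscosity solution is a function that is both a viscosity subsolution and a viscosity supersolution. *)

theory Defs
  imports "HOL-Analysis.Analysis" "HOL-Library.Landau_Symbols"
begin

text \<open>Functions on the torus are functions on \<open>real ^ 'n\<close> that are invariant under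
  integer translations; all estimates use the Euclidean distance of \<open>real ^ 'n\<close>.\<close>

definition Z_periodic :: "(real ^ 'n \<Rightarrow> 'b) \<Rightarrow> bool" where
  "Z_periodic f \<longleftrightarrow> (\<forall>x h. (\<forall>i. h $ i \<in> \<int>) \<longrightarrow> f (x + h) = f x)"

definition Sym :: "(real ^ 'n ^ 'n) set" where
  "Sym = {X. transpose X = X}"

definition sym_le :: "real ^ 'n ^ 'n \<Rightarrow> real ^ 'n ^ 'n \<Rightarrow> bool" where
  "sym_le X Y \<longleftrightarrow> (\<forall>\<xi>. (X *v \<xi>) \<bullet> \<xi> \<le> (Y *v \<xi>) \<bullet> \<xi>)"


text \<open>The index type is linearly ordered, so that it makes sense to speak of the first \<open>k\<close>
  coordinates. The vector \<open>p'\<close> and the block \<open>X'\<close> are kept in the ambient dimension and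
  padded by zeros; this changes neither norm, trace nor the order of symmetric matrices.\<close>

definition first_idx :: "nat \<Rightarrow> ('n::{finite,wellorder}) set" where
  "first_idx k = {i. card {j. j < i} < k}"

definition head_vec :: "nat \<Rightarrow> real ^ 'n::{finite,wellorder} \<Rightarrow> real ^ 'n::_" where
  "head_vec k p = (\<chi> i. if i \<in> first_idx k then p $ i else 0)"

definition head_block ::
  "nat \<Rightarrow> real ^ 'n::{finite,wellorder} ^ 'n::_ \<Rightarrow> real ^ 'n::_ ^ 'n::_" where
  "head_block k X =
     (\<chi> i j. if i \<in> first_idx k \<and> j \<in> first_idx k then X $ i $ j else 0)"


definition usc :: "(real ^ 'n \<Rightarrow> real) \<Rightarrow> bool" where
  "usc u \<longleftrightarrow> (\<forall>a. open {x. u x < a})"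

definition lsc :: "(real ^ 'n \<Rightarrow> real) \<Rightarrow> bool" where
  "lsc u \<longleftrightarrow> (\<forall>a. open {x. a < u x})"

definition superjet :: "(real ^ 'n \<Rightarrow> real) \<Rightarrow> real ^ 'n \<Rightarrow> ((real ^ 'n) \<times> (real ^ 'n ^ 'n)) set"
  where "superjet u x = {(p, X). X \<in> Sym \<and>
    (\<exists>r. r \<in> o[at 0](\<lambda>z. (norm z)\<^sup>2) \<and>
      (\<forall>\<^sub>F z in at 0. u (x + z) \<le> u x + p \<bullet> z + (1/2) * ((X *v z) \<bullet> z) + r z))}"

definition subjet :: "(real ^ 'n \<Rightarrow> real) \<Rightarrow> real ^ 'n \<Rightarrow> ((real ^ 'n) \<times> (real ^ 'n ^ 'n)) set"
  where "subjet u x = {(p, X). X \<in> Sym \<and>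
    (\<exists>r. r \<in> o[at 0](\<lambda>z. (norm z)\<^sup>2) \<and>
      (\<forall>\<^sub>F z in at 0. u (x + z) \<ge> u x + p \<bullet> z + (1/2) * ((X *v z) \<bullet> z) + r z))}"

definition upper_approx ::
  "(real ^ 'n \<Rightarrow> real) \<Rightarrow> real ^ 'n \<Rightarrow> real ^ 'n \<Rightarrow> real ^ 'n ^ 'n \<Rightarrow> real \<Rightarrow> real \<Rightarrow> bool" where
  "upper_approx u x p X \<epsilon> \<delta> \<longleftrightarrow> (\<forall>z. norm z \<le> \<epsilon> \<longrightarrow>
     u (x + z) \<le> u x + p \<bullet> z + (1/2) * ((X *v z) \<bullet> z) + \<delta> * (norm z)\<^sup>2)"

definition lower_approx ::
  "(real ^ 'n \<Rightarrow> real) \<Rightarrow> real ^ 'n \<Rightarrow> real ^ 'n \<Rightarrow> real ^ 'n ^ 'n \<Rightarrow> real \<Rightarrow> real \<Rightarrow> bool" where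
  "lower_approx u x p X \<epsilon> \<delta> \<longleftrightarrow> (\<forall>z. norm z \<le> \<epsilon> \<longrightarrow>
     u (x + z) \<ge> u x + p \<bullet> z + (1/2) * ((X *v z) \<bullet> z) - \<delta> * (norm z)\<^sup>2)"

text \<open>The two parts of the integral term, for a measure with Lebesgue density \<open>c\<close>. The far
  part is a Bochner integral, which is 0 when the integrand is not integrable. For a Levy
  density \<open>c\<close> this cannot happen if \<open>u\<close> is continuous and periodic (hence bounded), as is every
  periodic viscosity solution. The near part converges for every symmetric matrix.\<close>

definition near_int :: "(real ^ 'n \<Rightarrow> real) \<Rightarrow> real \<Rightarrow> real ^ 'n ^ 'n \<Rightarrow> real" where
  "near_int c \<epsilon> X = (LINT z:{z. norm z < \<epsilon>}|lebesgue. (1/2) * ((X *v z) \<bullet> z) * c z)"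

definition far_int ::
  "(real ^ 'n \<Rightarrow> real) \<Rightarrow> (real ^ 'n \<Rightarrow> real) \<Rightarrow> real \<Rightarrow> real ^ 'n \<Rightarrow> real ^ 'n \<Rightarrow> real" where
  "far_int c u \<epsilon> x p = (LINT z:{z. norm z \<ge> \<epsilon>}|lebesgue.
     (u (x + z) - u x - indicator {z. norm z \<le> 1} z * (z \<bullet> p)) * c z)"

text \<open>Viscosity solutions of
  \<open>\<lambda> u + F(x, \<nabla>u, \<nabla>\<^sup>2u) - \<integral> [u(x+z) - u(x) - 1\<^bsub>|z|\<le>1\<^esub> \<langle>\<nabla>u(x), z\<rangle>] c(z) dz - g = 0\<close>.\<close>

definition viscosity_subsolution ::
  "real \<Rightarrow> (real ^ 'n \<Rightarrow> real ^ 'n \<Rightarrow> real ^ 'n ^ 'n \<Rightarrow> real) \<Rightarrow> (real ^ 'n \<Rightarrow> real) \<Rightarrow>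
   (real ^ 'n \<Rightarrow> real) \<Rightarrow> (real ^ 'n \<Rightarrow> real) \<Rightarrow> bool" where
  "viscosity_subsolution lam F c g u \<longleftrightarrow> usc u \<and>
     (\<forall>x p X \<epsilon> \<delta> \<epsilon>'. (p, X) \<in> superjet u x \<and> \<epsilon> > 0 \<and> \<delta> > 0 \<and> upper_approx u x p X \<epsilon> \<delta> \<and>
        0 < \<epsilon>' \<and> \<epsilon>' \<le> \<epsilon> \<longrightarrow>
        lam * u x + F x p X - near_int c \<epsilon>' (X + (2 * \<delta>) *\<^sub>R mat 1)
          - far_int c u \<epsilon>' x p - g x \<le> 0)"

definition viscosity_supersolution ::
  "real \<Rightarrow> (real ^ 'n \<Rightarrow> real ^ 'n \<Rightarrow> real ^ 'n ^ 'n \<Rightarrow> real) \<Rightarrow> (real ^ 'n \<Rightarrow> real) \<Rightarrow>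
   (real ^ 'n \<Rightarrow> real) \<Rightarrow> (real ^ 'n \<Rightarrow> real) \<Rightarrow> bool" where
  "viscosity_supersolution lam F c g u \<longleftrightarrow> lsc u \<and>
     (\<forall>x p X \<epsilon> \<delta> \<epsilon>'. (p, X) \<in> subjet u x \<and> \<epsilon> > 0 \<and> \<delta> > 0 \<and> lower_approx u x p X \<epsilon> \<delta> \<and>
        0 < \<epsilon>' \<and> \<epsilon>' \<le> \<epsilon> \<longrightarrow>
        lam * u x + F x p X - near_int c \<epsilon>' (X - (2 * \<delta>) *\<^sub>R mat 1)
          - far_int c u \<epsilon>' x p - g x \<ge> 0)"

definition viscosity_solution ::
  "real \<Rightarrow> (real ^ 'n \<Rightarrow> real ^ 'n \<Rightarrow> real ^ 'n ^ 'n \<Rightarrow> real) \<Rightarrow> (real ^ 'n \<Rightarrow> real) \<Rightarrow>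
   (real ^ 'n \<Rightarrow> real) \<Rightarrow> (real ^ 'n \<Rightarrow> real) \<Rightarrow> bool" where
  "viscosity_solution lam F c g u \<longleftrightarrow>
     viscosity_subsolution lam F c g u \<and> viscosity_supersolution lam F c g u"

text \<open>The measure \<open>c(z) dz\<close> is positive iff \<open>c \<ge> 0\<close> almost everywhere; that it is finite
  on compact subsets of the complement of 0 (Radon) follows from the integrability condition.
  The origin is a null set, so integrals over the whole space are unaffected by \<open>c 0\<close>.\<close>

definition levy_density ::
  "real \<Rightarrow> real \<Rightarrow> real \<Rightarrow> real \<Rightarrow> (real ^ 'n \<Rightarrow> real) \<Rightarrow> bool" where
  "levy_density \<gamma> C1 C2 C3 c \<longleftrightarrow>
     c \<in> borel_measurable lebesgue \<and> (AE z in lebesgue. 0 \<le> c z) \<and>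
     integrable lebesgue (\<lambda>z. min ((norm z)\<^sup>2) 1 * c z) \<and>
     (LINT z|lebesgue. min ((norm z)\<^sup>2) 1 * c z) \<le> C1 \<and>
     (\<forall>z. 0 < norm z \<and> norm z \<le> 1 \<longrightarrow>
        C2 / norm z powr (real CARD('n) + \<gamma>) \<le> \<bar>c z\<bar> \<and>
        \<bar>c z\<bar> \<le> C3 / norm z powr (real CARD('n) + \<gamma>))"

definition holder_bound ::
  "real \<Rightarrow> real \<Rightarrow> real \<Rightarrow> (real ^ 'n \<Rightarrow> real) \<Rightarrow> bool" where
  "holder_bound C lam \<theta> v \<longleftrightarrow> (\<forall>x y. \<bar>v x - v y\<bar> \<le> C / lam * norm (x - y) powr \<theta>)"

end

theory Submission imports Defs
begin

text \<open>Ishii-Lions argument. If \<open>v(x) - v(y) - K |x - y|\<^sup>\<theta>\<close> is positive somewhere for a large \<open>K\<close>, then at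
  a maximum point with \<open>r = |x - y|\<close> one has \<open>K r\<^sup>\<theta> \<le> 2M\<close>, so \<open>r\<close> is small. Strict concavity of \<open>|\<cdot>|\<^sup>\<theta>\<close> in
  the direction \<open>x - y\<close> makes the difference of the nonlocal terms at most
  \<open>- const K r\<^bsup>\<theta> - \<gamma>\<^esup>\<close>, while all other terms of the two viscosity inequalities are of lower order:
  the gradient term because \<open>\<rho>1 + \<gamma> > q\<close>, the Hessian term because \<open>\<rho>2 + \<gamma> > 2\<close>, the datum because \<open>\<theta> \<le> \<theta>0\<close>.

  The ordered pair of Hessians at the maximum point is the theorem on sums. It is obtained by replacing
  \<open>v\<close> by its sup- and inf-convolutions, which are twice differentiable almost everywhere by Alexandrov's
  theorem, and by tilting the doubled function by a generic small linear form (Jensen's lemma), so that the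
  maximum point avoids the exceptional null set. Alexandrov's theorem follows from Rademacher's theorem
  for the proximal map, the exceptional set being controlled by Sard's theorem.\<close>

section \<open>Differentiability of Lipschitz functions\<close>

text \<open>Both claims then follow, with \<open>C = K * lam\<close> for a given \<open>lam\<close>
  and \<open>C = K\<close> for all \<open>lam\<close> < 1. The obstacle is that a nonlocal equation
  sees \<open>v\<close> globally and is tested where the convolutions are attained, not at the
  maximum point (x, y). What helps is that increments of \<open>v\<close> from the attaining point,
  in every direction and of every length, are dominated by those of the convolution from x; so the
  integrands are estimated through the doubled function. The convolution parameter is not sent to 0.
  It is fixed so that the attaining points are closer to x and y than a fraction of a distance
  \<open>m\<close> below which \<open>v\<close> oscillates by less than half of the assumed excess.
  Only then are the tilt and the penalisation made small, measured against the uniform continuity of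
  \<open>F\<close> on a compact set that depends on these choices.\<close>

text \<open>The inverse \<open>G\<close> of \<open>F\<close> carries Lebesgue measure to a measure
  that gives [a, b] the mass F(b) - F(a). Since \<open>F\<close> maps null sets to null sets, this
  measure is absolutely continuous, and its Radon-Nikodym density serves as the derivative of
  \<open>F\<close>.\<close>

lemma expanding_distr_density:
  fixes F :: "real \<Rightarrow> real"
  assumes L: "L-lipschitz_on UNIV F" and inc: "\<And>x y. x \<le> y \<Longrightarrow> y - x \<le> F y - F x"
  shows "\<exists>g. \<forall>a b. a \<le> b \<longrightarrow> (g has_integral (F b - F a)) {a..b}"
proof -
  have cont: "continuous_on UNIV F"
    using L lipschitz_on_continuous_on by blast
  have smono: "strict_mono F"
  proof (rule strict_monoI)
    fix x y :: real assume "x < y"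
    then show "F x < F y" using inc[of x y] by linarith
  qed
  then have inj: "inj F" by (rule strict_mono_imp_inj_on)
  have surj: "surj F"
  proof (unfold surj_def, intro allI)
    fix y
    define r where "r = \<bar>y - F 0\<bar>"
    have "F (- r) \<le> y" "y \<le> F r"
      using inc[of "-r" 0] inc[of 0 r] by (auto simp: r_def)
    then show "\<exists>x. y = F x"
      using IVT'[of F "-r" y r] continuous_on_subset[OF cont, of "{-r..r}"] by (auto simp: r_def)
  qed
  define G where "G = inv F"
  have GF: "G (F x) = x" for x using inj by (simp add: G_def)
  have FG: "F (G x) = x" for x using surj by (simp add: G_def surj_f_inv_f)
  have Gle: "a \<le> G x \<longleftrightarrow> F a \<le> x" "G x \<le> a \<longleftrightarrow> x \<le> F a" for a x
    using strict_mono_less_eq[OF smono, of a "G x"] strict_mono_less_eq[OF smono, of "G x" a] FG by auto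
  have "mono G"
    by (intro monoI) (simp add: Gle FG)
  then have Gm[measurable]: "G \<in> borel_measurable borel" by (rule borel_measurable_mono)
  define \<mu> where "\<mu> = distr lborel borel G"
  have ivl: "emeasure \<mu> {a..b} = ennreal (F b - F a)" if "a \<le> b" for a b
  proof -
    have "G -` {a..b} \<inter> space lborel = {F a..F b}" by (auto simp: Gle)
    moreover have "F a \<le> F b" using inc[OF that] that by simp
    ultimately show ?thesis by (simp add: \<mu>_def emeasure_distr)
  qed
  have "absolutely_continuous lborel \<mu>"
    unfolding absolutely_continuous_def
  proof
    fix A :: "real set" assume "A \<in> null_sets lborel"
    then have A: "A \<in> sets borel" "negligible A"
      by (auto simp: negligible_iff_null_sets null_sets_completionI)
    have "negligible (F ` A)"
      using A(2) lipschitz_onD[OF L]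
      by (intro negligible_locally_Lipschitz_image[where f=F])
         (auto simp: dist_norm intro!: exI[of _ UNIV] exI[of _ L])
    moreover have "G -` A = F ` A" using GF FG by (auto simp: image_iff) (metis FG)
    moreover have "G -` A \<in> sets borel" using measurable_sets[OF Gm A(1)] by simp
    ultimately have "emeasure lborel (G -` A) = 0"
      by (simp add: negligible_iff_emeasure0)
    then show "A \<in> null_sets \<mu>"
      using A(1) by (auto simp: \<mu>_def null_sets_def emeasure_distr)
  qed
  then obtain g where g: "g \<in> borel_measurable lborel" "density lborel g = \<mu>"
    using sigma_finite_measure.Radon_Nikodym[OF lborel.sigma_finite_measure_axioms, of \<mu>]
    by (metis \<mu>_def sets_distr sets_lborel)
  have nn: "(\<integral>\<^sup>+x. g x * indicator {a..b} x \<partial>lborel) = ennreal (F b - F a)" if "a \<le> b" for a b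
    using ivl[OF that] emeasure_density[OF g(1), of "{a..b}"] by (simp add: g(2))
  \<comment> \<open>A finite mass on each interval makes the density finite almost everywhere, so
    \<open>enn2real\<close>, which sends infinity to 0, changes no integral.\<close>
  have fin: "AE x in lborel. x \<in> {a..b} \<longrightarrow> g x \<noteq> \<infinity>" if "a \<le> b" for a b
  proof -
    have "AE x in lborel. g x * indicator {a..b} x \<noteq> \<infinity>"
    proof (rule nn_integral_PInf_AE)
      show "(\<lambda>x. g x * indicator {a..b} x) \<in> borel_measurable lborel" using g(1) by measurable
    qed (simp add: nn[OF that])
    then show ?thesis by eventually_elim (auto simp: indicator_def)
  qed
  have "((\<lambda>x. enn2real (g x)) has_integral (F b - F a)) {a..b}" if "a \<le> b" for a b
  proof -
    have "((\<lambda>x. enn2real (g x) * indicator {a..b} x) has_integral (F b - F a)) UNIV"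
    proof (rule nn_integral_has_integral)
      show "(\<integral>\<^sup>+x. ennreal (enn2real (g x) * indicator {a..b} x) \<partial>lborel) = ennreal (F b - F a)"
        unfolding nn[OF that, symmetric]
        using fin[OF that]
        by (intro nn_integral_cong_AE, eventually_elim) (auto simp: indicator_def less_top)
    next
      show "(\<lambda>x. enn2real (g x) * indicator {a..b} x) \<in> borel_measurable borel" using g(1) by simp
      show "0 \<le> F b - F a" using inc[OF that] that by simp
    qed simp
    then have "((\<lambda>x. if x \<in> {a..b} then enn2real (g x) else 0) has_integral (F b - F a)) UNIV"
      by (rule has_integral_eq[rotated]) (auto simp: indicator_def)
    then show ?thesis by (simp only: has_integral_restrict_UNIV)
  qed
  then show ?thesis by blast
qed

text \<open>Adding a steep linear function turns \<open>f\<close> into an expanding function;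
  Lebesgue's differentiation theorem for its density then gives the derivative.\<close>

lemma lipschitz_right_derivative_ae:
  fixes f :: "real \<Rightarrow> real"
  assumes L: "L-lipschitz_on UNIV f"
  shows "negligible {x. \<not> (\<exists>l. ((\<lambda>h. (f (x + h) - f x) / h) \<longlongrightarrow> l) (at_right 0))}"
proof -
  \<comment> \<open>Slope \<open>L + 1\<close> and not \<open>L\<close>: \<open>F\<close> has to
    grow at rate at least 1.\<close>
  define F where "F = (\<lambda>x. f x + (L + 1) * x)"
  have L0: "L \<ge> 0" using L lipschitz_on_nonneg by blast
  have lip: "\<bar>f x - f y\<bar> \<le> L * \<bar>x - y\<bar>" for x y
    using lipschitz_onD[OF L, of x y] by (simp add: dist_real_def)
  have lipF: "(2 * L + 1)-lipschitz_on UNIV F"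
  proof (rule lipschitz_onI)
    fix x y
    have "\<bar>F x - F y\<bar> \<le> \<bar>f x - f y\<bar> + \<bar>(L + 1) * (x - y)\<bar>"
      by (simp add: F_def algebra_simps)
    also have "\<dots> \<le> L * \<bar>x - y\<bar> + (L + 1) * \<bar>x - y\<bar>"
      using lip[of x y] L0 by (simp add: abs_mult)
    finally show "dist (F x) (F y) \<le> (2 * L + 1) * dist x y"
      by (simp add: dist_real_def algebra_simps)
  qed (use L0 in auto)
  have incF: "y - x \<le> F y - F x" if "x \<le> y" for x y
    using lip[of x y] that by (simp add: F_def algebra_simps)
  obtain g where g: "\<And>a b. a \<le> b \<Longrightarrow> (g has_integral (F b - F a)) {a..b}"
    using expanding_distr_density[OF lipF incF] by auto
  have [simp]: "g integrable_on cbox a b" for a b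
    using g[of a b] by (cases "a \<le> b") (auto simp: integrable_on_def)
  \<comment> \<open>The averages are over intervals [x, x + h] with x as left endpoint, which is why
    right derivatives appear here and below.\<close>
  then obtain N where N: "negligible N"
    "\<And>x e. \<lbrakk>x \<notin> N; 0 < e\<rbrakk> \<Longrightarrow> \<exists>d>0. \<forall>h. 0 < h \<and> h < d \<longrightarrow>
       norm(integral (cbox x (x + h *\<^sub>R One)) g /\<^sub>R h ^ DIM(real) - g x) < e"
    by (rule integrable_ccontinuous_explicit[of g]) simp_all
  have "((\<lambda>h. (f (x + h) - f x) / h) \<longlongrightarrow> g x - (L + 1)) (at_right 0)" if xN: "x \<notin> N" for x
  proof (rule tendstoI)
    fix e :: real assume "0 < e"
    then obtain d where d: "d > 0" "\<forall>h. 0 < h \<and> h < d \<longrightarrow>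
       norm(integral (cbox x (x + h *\<^sub>R One)) g /\<^sub>R h ^ DIM(real) - g x) < e"
      using N(2)[OF xN] by blast
    have "dist ((f (x + h) - f x) / h) (g x - (L + 1)) < e" if h: "0 < h" "h < d" for h
    proof -
      have "integral {x..x+h} g = F (x + h) - F x"
        using g[of x "x + h"] h by (simp add: integral_unique)
      then have "\<bar>(F (x + h) - F x) / h - g x\<bar> < e"
        using d(2) h by (auto simp: divide_inverse mult.commute)
      moreover have "(F (x + h) - F x) / h = (f (x + h) - f x) / h + (L + 1)"
        using h by (simp add: F_def field_simps)
      ultimately show ?thesis by (simp add: dist_real_def algebra_simps)
    qed
    then show "\<forall>\<^sub>F h in at_right 0. dist ((f (x + h) - f x) / h) (g x - (L + 1)) < e"
      using d(1) unfolding eventually_at_right_field by (intro exI[of _ d]) auto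
  qed
  then have "{x. \<not> (\<exists>l. ((\<lambda>h. (f (x + h) - f x) / h) \<longlongrightarrow> l) (at_right 0))} \<subseteq> N"
    by auto
  then show ?thesis by (rule negligible_subset[OF N(1)])
qed

section \<open>Right directional derivatives of Lipschitz functions\<close>

abbreviation diffquot :: "('a::real_vector \<Rightarrow> real) \<Rightarrow> 'a \<Rightarrow> real \<Rightarrow> 'a \<Rightarrow> real" where
  "diffquot f v h x \<equiv> (f (x + h *\<^sub>R v) - f x) / h"

definition right_diff :: "('a::real_normed_vector \<Rightarrow> real) \<Rightarrow> 'a \<Rightarrow> 'a \<Rightarrow> bool" where
  "right_diff f v x \<longleftrightarrow> (\<exists>l. ((\<lambda>h. diffquot f v h x) \<longlongrightarrow> l) (at_right 0))"

abbreviation diffquot_osc_le :: "('a::real_vector \<Rightarrow> real) \<Rightarrow> 'a \<Rightarrow> nat \<Rightarrow> nat \<Rightarrow> 'a \<Rightarrow> bool" where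
  "diffquot_osc_le f v n m x \<equiv> \<forall>s t. 0 < s \<and> s < 1 / (real n + 1) \<and> 0 < t \<and> t < 1 / (real n + 1)
     \<longrightarrow> \<bar>diffquot f v s x - diffquot f v t x\<bar> \<le> 1 / (real m + 1)"

text \<open>Existence of the limit is rewritten with quantifiers over naturals only, around a
  condition that is closed in \<open>x\<close> for continuous \<open>f\<close>. This gives Borel
  measurability, which Tonelli requires.\<close>

lemma right_diff_iff_Cauchy:
  "right_diff f v x \<longleftrightarrow> (\<forall>m::nat. \<exists>n::nat. diffquot_osc_le f v n m x)" (is "_ \<longleftrightarrow> ?R")
proof
  assume "right_diff f v x"
  then obtain l where l: "((\<lambda>h. diffquot f v h x) \<longlongrightarrow> l) (at_right 0)"
    by (auto simp: right_diff_def)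
  show ?R
  proof
    fix m :: nat
    have "0 < 1 / (2 * (real m + 1))" by simp
    from tendstoD[OF l this] obtain b where b: "b > 0"
      "\<And>y. 0 < y \<Longrightarrow> y < b \<Longrightarrow> \<bar>diffquot f v y x - l\<bar> < 1 / (2 * (real m + 1))"
      by (auto simp: eventually_at_right_field dist_real_def)
    obtain n :: nat where n: "1 / (real n + 1) < b"
      using nat_approx_posE[OF b(1)] by (auto simp: add.commute)
    show "\<exists>n::nat. diffquot_osc_le f v n m x"
    proof (intro exI[of _ n] allI impI, elim conjE)
      fix s t assume st: "0 < s" "s < 1 / (real n + 1)" "0 < t" "t < 1 / (real n + 1)"
      have tri: "\<bar>a - b\<bar> \<le> d" if "\<bar>a - l\<bar> < e" "\<bar>b - l\<bar> < e" "e + e = d" for a b d e :: real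
        using that by linarith
      have 1: "\<bar>diffquot f v s x - l\<bar> < 1 / (2 * (real m + 1))"
        using b(2)[of s] st n by (auto simp: add.commute)
      have 2: "\<bar>diffquot f v t x - l\<bar> < 1 / (2 * (real m + 1))"
        using b(2)[of t] st n by (auto simp: add.commute)
      have "\<bar>diffquot f v s x - diffquot f v t x\<bar> \<le> 1 / (real m + 1)"
        by (rule tri[OF 1 2]) (simp add: field_simps)
      then show "\<bar>diffquot f v s x - diffquot f v t x\<bar> \<le> 1 / (real m + 1)" .
    qed
  qed
next
  assume R: ?R
  \<comment> \<open>The denominator \<open>real n + 2\<close> puts the step strictly inside the
    interval (0, 1/(n + 1)) on which the oscillation is controlled.\<close>
  define q where "q = (\<lambda>n::nat. diffquot f v (1 / (real n + 2)) x)"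
  have key: "\<exists>n::nat. \<forall>s t. 0 < s \<and> s < 1 / (real n + 1) \<and> 0 < t \<and> t < 1 / (real n + 1)
     \<longrightarrow> \<bar>diffquot f v s x - diffquot f v t x\<bar> < e" if e: "e > 0" for e :: real
  proof -
    obtain m :: nat where m: "1 / (real m + 1) < e"
      using nat_approx_posE[OF e] by (auto simp: add.commute)
    from R obtain n :: nat where n: "diffquot_osc_le f v n m x" by blast
    have "\<bar>diffquot f v s x - diffquot f v t x\<bar> < e"
      if "0 < s" "s < 1 / (real n + 1)" "0 < t" "t < 1 / (real n + 1)" for s t
      using n[rule_format, of s t] that m by linarith
    then show ?thesis by (intro exI[of _ n]) simp
  qed
  have sm: "1 / (real k + 2) < 1 / (real n + 1)" if "k \<ge> n" for k n :: nat
    using that by (intro divide_strict_left_mono) auto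
  have "Cauchy q"
  proof (rule metric_CauchyI)
    fix e :: real assume "0 < e"
    from key[OF this] obtain n :: nat where n: "\<forall>s t. 0 < s \<and> s < 1 / (real n + 1) \<and> 0 < t \<and> t < 1 / (real n + 1)
     \<longrightarrow> \<bar>diffquot f v s x - diffquot f v t x\<bar> < e" by blast
    have "dist (q i) (q j) < e" if "i \<ge> n" "j \<ge> n" for i j
      unfolding q_def dist_real_def
      using n[rule_format, of "1 / (real i + 2)" "1 / (real j + 2)"] sm[OF that(1)] sm[OF that(2)] by simp
    then show "\<exists>M. \<forall>m\<ge>M. \<forall>n\<ge>M. dist (q m) (q n) < e" by blast
  qed
  then obtain l where l: "q \<longlonglongrightarrow> l" using Cauchy_convergent convergent_def by blast
  have "((\<lambda>h. diffquot f v h x) \<longlongrightarrow> l) (at_right 0)"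
  proof (rule tendstoI)
    fix e :: real assume e: "0 < e"
    then have e2: "0 < e / 2" by simp
    from key[OF e2] obtain n :: nat where n: "\<forall>s t. 0 < s \<and> s < 1 / (real n + 1) \<and> 0 < t \<and> t < 1 / (real n + 1)
     \<longrightarrow> \<bar>diffquot f v s x - diffquot f v t x\<bar> < e / 2" by blast
    from LIMSEQ_D[OF l e2] obtain k where k: "\<And>i. i \<ge> k \<Longrightarrow> \<bar>q i - l\<bar> < e / 2" by auto
    define i where "i = max n k"
    have "\<bar>diffquot f v h x - l\<bar> < e" if "0 < h" "h < 1 / (real n + 1)" for h
    proof -
      have "\<bar>diffquot f v h x - q i\<bar> < e / 2"
        using n[rule_format, of h "1 / (real i + 2)"] that sm[of n i] by (simp add: q_def i_def)
      moreover have "\<bar>q i - l\<bar> < e / 2" using k[of i] by (simp add: i_def)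
      ultimately show ?thesis by linarith
    qed
    then show "\<forall>\<^sub>F h in at_right 0. dist (diffquot f v h x) l < e"
      unfolding eventually_at_right_field dist_real_def
      by (intro exI[of _ "1 / (real n + 1)"]) (auto simp: add.commute)
  qed
  then show "right_diff f v x" by (auto simp: right_diff_def)
qed

lemma borel_right_diff:
  fixes f :: "'a::euclidean_space \<Rightarrow> real"
  assumes "continuous_on UNIV f"
  shows "{x. right_diff f v x} \<in> sets borel"
proof -
  \<comment> \<open>This includes \<open>s = 0\<close> and \<open>t = 0\<close>, where division by
    zero makes the quotient constantly 0.\<close>
  have c: "continuous_on UNIV (\<lambda>x. \<bar>diffquot f v s x - diffquot f v t x\<bar>)" for s t
    by (cases "s = 0"; cases "t = 0")
       (auto intro!: continuous_intros continuous_on_compose2[OF assms])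
  have "closed {x. diffquot_osc_le f v n m x}" for n m :: nat
    by (intro closed_Collect_all closed_Collect_imp closed_Collect_le c continuous_intros) auto
  then have "(\<Inter>m::nat. \<Union>n::nat. {x. diffquot_osc_le f v n m x}) \<in> sets borel"
    by (intro sets.countable_INT' sets.countable_UN borel_closed) auto
  moreover have "{x. right_diff f v x} = (\<Inter>m::nat. \<Union>n::nat. {x. diffquot_osc_le f v n m x})"
    by (auto simp: right_diff_iff_Cauchy)
  ultimately show ?thesis by simp
qed

lemma emeasure_lborel_translation:
  fixes A :: "'a::euclidean_space set"
  assumes "A \<in> sets borel"
  shows "emeasure lborel ((\<lambda>x. x + c) -` A) = emeasure lborel A"
proof -
  have "emeasure lborel A = emeasure (distr lborel borel ((+) c)) A"
    by (simp add: lborel_distr_plus)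
  also have "\<dots> = emeasure lborel ((\<lambda>x. x + c) -` A)"
    using assms by (subst emeasure_distr) (auto simp: vimage_def add.commute)
  finally show ?thesis ..
qed

text \<open>Averaging the translates of \<open>A\<close> along \<open>v\<close> reduces Fubini in an arbitrary direction to
  Tonelli on a product, without a change of coordinates.\<close>

lemma emeasure_eq_0_if_null_on_lines:
  fixes A :: "'a::euclidean_space set"
  assumes A: "A \<in> sets borel" and line: "\<And>x. negligible {t. x + t *\<^sub>R v \<in> A}"
  shows "emeasure lborel A = 0"
proof -
  have [measurable]: "A \<in> sets borel" by fact
  have [measurable]: "(\<lambda>(t, x). x + t *\<^sub>R v) \<in> borel_measurable (lborel \<Otimes>\<^sub>M (lborel :: 'a measure))"
    by measurable
  have "emeasure lborel A = (\<integral>\<^sup>+t. emeasure lborel A * indicator {0..1::real} t \<partial>lborel)"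
    by (simp add: nn_integral_cmult)
  also have "\<dots> = (\<integral>\<^sup>+t. (\<integral>\<^sup>+x. indicator A (x + t *\<^sub>R v) * indicator {0..1::real} t \<partial>lborel) \<partial>lborel)"
  proof (intro nn_integral_cong)
    fix t :: real
    have m: "(\<lambda>x. x + t *\<^sub>R v) -` A \<in> sets lborel"
      using measurable_sets[of "\<lambda>x. x + t *\<^sub>R v" lborel borel A] A by simp
    have "(\<integral>\<^sup>+x. indicator A (x + t *\<^sub>R v) * indicator {0..1::real} t \<partial>lborel) =
      (\<integral>\<^sup>+x. indicator ((\<lambda>x. x + t *\<^sub>R v) -` A) x * indicator {0..1::real} t \<partial>lborel)"
      by (intro nn_integral_cong) (simp add: indicator_def)
    also have "\<dots> = emeasure lborel ((\<lambda>x. x + t *\<^sub>R v) -` A) * indicator {0..1::real} t"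
      using m by (simp only: nn_integral_multc borel_measurable_indicator nn_integral_indicator)
    finally show "emeasure lborel A * indicator {0..1} t = (\<integral>\<^sup>+x. indicator A (x + t *\<^sub>R v) * indicator {0..1::real} t \<partial>lborel)"
      by (simp add: emeasure_lborel_translation[OF A])
  qed
  also have "\<dots> = (\<integral>\<^sup>+x. (\<integral>\<^sup>+t. indicator A (x + t *\<^sub>R v) * indicator {0..1::real} t \<partial>lborel) \<partial>lborel)"
    by (intro lborel_pair.Fubini') measurable
  also have "\<dots> = (\<integral>\<^sup>+x. 0 \<partial>(lborel :: 'a measure))"
  proof (intro nn_integral_cong)
    fix x :: 'a
    have m: "{t. x + t *\<^sub>R v \<in> A} \<in> sets borel"
      using measurable_sets[of "\<lambda>t. x + t *\<^sub>R v" borel borel A] A by (simp add: vimage_def)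
    have "AE t in lborel. t \<notin> {t. x + t *\<^sub>R v \<in> A}"
      using line[of x] m by (intro AE_not_in) (simp add: negligible_iff_null_sets null_sets_def)
    then have "(\<integral>\<^sup>+t. indicator A (x + t *\<^sub>R v) * indicator {0..1::real} t \<partial>lborel) = (\<integral>\<^sup>+(t::real). 0 \<partial>lborel)"
      by (intro nn_integral_cong_AE) (auto elim!: eventually_mono simp: indicator_def)
    then show "(\<integral>\<^sup>+t. indicator A (x + t *\<^sub>R v) * indicator {0..1::real} t \<partial>lborel) = 0" by simp
  qed
  finally show ?thesis by simp
qed

lemma right_diff_ae:
  fixes f :: "'a::euclidean_space \<Rightarrow> real"
  assumes L: "L-lipschitz_on UNIV f"
  shows "AE x in lborel. right_diff f v x"
proof -
  let ?A = "{x. \<not> right_diff f v x}"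
  have cont: "continuous_on UNIV f" using L lipschitz_on_continuous_on by blast
  have A: "?A \<in> sets borel"
    using sets.compl_sets[OF borel_right_diff[OF cont, of v]] by (simp add: Compl_eq_Diff_UNIV[symmetric] Collect_neg_eq)
  have "negligible {t. x + t *\<^sub>R v \<in> ?A}" for x
  proof -
    have "(L * norm v)-lipschitz_on UNIV (\<lambda>t. f (x + t *\<^sub>R v))"
    proof (rule lipschitz_onI)
      fix s t :: real
      show "dist (f (x + s *\<^sub>R v)) (f (x + t *\<^sub>R v)) \<le> L * norm v * dist s t"
        using lipschitz_onD[OF L, of "x + s *\<^sub>R v" "x + t *\<^sub>R v"]
        by (simp add: dist_norm scaleR_diff_left[symmetric] mult_ac)
    qed (use lipschitz_on_nonneg[OF L] in auto)
    from lipschitz_right_derivative_ae[OF this] show ?thesis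
      by (simp add: right_diff_def scaleR_add_left add.assoc)
  qed
  from emeasure_eq_0_if_null_on_lines[OF A this] have "?A \<in> null_sets lborel"
    using A by auto
  then show ?thesis by (rule AE_I'[of ?A]) auto
qed

text \<open>A limit along one fixed sequence, so that a Borel function on the whole space results;
  where \<open>right_diff\<close> holds it is the true one-sided derivative.\<close>

definition right_deriv :: "('a::real_normed_vector \<Rightarrow> real) \<Rightarrow> 'a \<Rightarrow> 'a \<Rightarrow> real" where
  "right_deriv f v x = lim (\<lambda>n. diffquot f v (1 / Suc n) x)"

lemma right_diff_tendsto:
  assumes "right_diff f v x"
  shows "((\<lambda>h. diffquot f v h x) \<longlongrightarrow> right_deriv f v x) (at_right 0)"
    and "(\<lambda>n. diffquot f v (1 / Suc n) x) \<longlonglongrightarrow> right_deriv f v x"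
proof -
  obtain l where l: "((\<lambda>h. diffquot f v h x) \<longlongrightarrow> l) (at_right 0)"
    using assms by (auto simp: right_diff_def)
  have "filterlim (\<lambda>n. 1 / real (Suc n)) (at_right 0) sequentially"
    using LIMSEQ_inverse_real_of_nat by (auto simp: filterlim_at divide_inverse)
  from filterlim_compose[OF l this] have *: "(\<lambda>n. diffquot f v (1 / Suc n) x) \<longlonglongrightarrow> l" .
  then have "right_deriv f v x = l" unfolding right_deriv_def by (rule limI)
  then show "((\<lambda>h. diffquot f v h x) \<longlongrightarrow> right_deriv f v x) (at_right 0)"
    "(\<lambda>n. diffquot f v (1 / Suc n) x) \<longlonglongrightarrow> right_deriv f v x" using l * by auto
qed

lemma right_deriv_eqI:
  assumes "((\<lambda>h. diffquot f v h x) \<longlongrightarrow> l) (at_right 0)"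
  shows "right_deriv f v x = l"
proof -
  have "right_diff f v x" using assms by (auto simp: right_diff_def)
  from right_diff_tendsto(1)[OF this] show ?thesis
    using assms by (rule tendsto_unique[OF trivial_limit_at_right_real])
qed

lemma right_deriv_scale:
  assumes "right_diff f v x" "c > 0"
  shows "right_deriv f (c *\<^sub>R v) x = c * right_deriv f v x"
proof (rule right_deriv_eqI)
  have "filterlim (\<lambda>h. c * h) (at_right 0) (at_right (0::real))"
    unfolding filterlim_at
  proof
    show "\<forall>\<^sub>F x in at_right 0. c * x \<in> {0<..} \<and> c * x \<noteq> 0"
      using assms(2) by (intro eventually_mono[OF eventually_at_right_less]) auto
    show "((\<lambda>h. c * h) \<longlongrightarrow> 0) (at_right 0)"
      by (rule tendsto_eq_intros refl | simp)+
  qed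
  from filterlim_compose[OF right_diff_tendsto(1)[OF assms(1)] this]
  have "((\<lambda>h. c * diffquot f v (c * h) x) \<longlongrightarrow> c * right_deriv f v x) (at_right 0)"
    by (rule tendsto_mult_left)
  then show "((\<lambda>h. diffquot f (c *\<^sub>R v) h x) \<longlongrightarrow> c * right_deriv f v x) (at_right 0)"
    using assms(2) by (simp add: mult.commute)
qed

section \<open>Linearity in the direction and Rademacher's theorem\<close>

lemma ae_zero_if_integral_cbox_zero:
  fixes g :: "'a::euclidean_space \<Rightarrow> real"
  assumes g: "g \<in> borel_measurable borel" and int: "\<And>a b. set_integrable lborel (cbox a b) g"
    and zero: "\<And>a b. (LINT x:cbox a b|lborel. g x) = 0"
  shows "AE x in lborel. g x = 0"
proof -
  have [simp]: "g integrable_on cbox a b" for a b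
    by (rule set_borel_integral_eq_integral(1)[OF int])
  have z: "integral (cbox a b) g = 0" for a b
    using set_borel_integral_eq_integral(2)[OF int, of a b] zero[of a b] by simp
  obtain N where N: "negligible N"
    "\<And>x e. \<lbrakk>x \<notin> N; 0 < e\<rbrakk> \<Longrightarrow> \<exists>d>0. \<forall>h. 0 < h \<and> h < d \<longrightarrow>
       norm(integral (cbox x (x + h *\<^sub>R One)) g /\<^sub>R h ^ DIM('a) - g x) < e"
    by (rule integrable_ccontinuous_explicit[of g]) simp_all
  have "g x = 0" if xN: "x \<notin> N" for x
  proof (rule ccontr)
    assume "g x \<noteq> 0"
    then obtain d where "d > 0" "\<forall>h. 0 < h \<and> h < d \<longrightarrow>
       norm(integral (cbox x (x + h *\<^sub>R One)) g /\<^sub>R h ^ DIM('a) - g x) < \<bar>g x\<bar>"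
      using N(2)[OF xN, of "\<bar>g x\<bar>"] by auto
    from this(2)[rule_format, of "d/2"] this(1) show False by (simp add: z)
  qed
  then have "{x. g x \<noteq> 0} \<subseteq> N" by auto
  then have "negligible {x. g x \<noteq> 0}" by (rule negligible_subset[OF N(1)])
  moreover have "{x. g x \<noteq> 0} \<in> sets borel" using g by measurable
  ultimately have "{x. g x \<noteq> 0} \<in> null_sets lborel"
    by (simp add: negligible_iff_null_sets null_sets_def)
  then show ?thesis by (rule AE_I'[of "{x. g x \<noteq> 0}"]) auto
qed

lemma abs_diffquot_le:
  fixes f :: "'a::real_normed_vector \<Rightarrow> real"
  assumes L: "L-lipschitz_on UNIV f"
  shows "\<bar>diffquot f v h x\<bar> \<le> L * norm v"
proof (cases "h = 0")
  case False
  have "\<bar>f (x + h *\<^sub>R v) - f x\<bar> \<le> L * norm (h *\<^sub>R v)"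
    using lipschitz_onD[OF L, of "x + h *\<^sub>R v" x] by (simp add: dist_norm)
  then show ?thesis using False by (simp add: abs_divide divide_le_eq mult_ac)
qed (use lipschitz_on_nonneg[OF L] in auto)

lemma continuous_diffquot:
  fixes f :: "'a::real_normed_vector \<Rightarrow> real"
  assumes "continuous_on UNIV f"
  shows "continuous_on UNIV (diffquot f v h)"
  by (cases "h = 0") (auto intro!: continuous_intros continuous_on_compose2[OF assms])

lemma borel_right_deriv:
  fixes f :: "'a::euclidean_space \<Rightarrow> real"
  assumes "continuous_on UNIV f"
  shows "right_deriv f v \<in> borel_measurable borel"
proof -
  have "(\<lambda>x. lim (\<lambda>n. diffquot f v (1 / Suc n) x)) \<in> borel_measurable borel"
    by (intro borel_measurable_lim_metric borel_measurable_continuous_onI continuous_diffquot assms)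
  then show ?thesis unfolding right_deriv_def[abs_def] .
qed

lemma abs_right_deriv_le:
  fixes f :: "'a::real_normed_vector \<Rightarrow> real"
  assumes L: "L-lipschitz_on UNIV f" and "right_diff f v x"
  shows "\<bar>right_deriv f v x\<bar> \<le> L * norm v"
proof (rule tendsto_upperbound)
  show "(\<lambda>n. \<bar>diffquot f v (1 / Suc n) x\<bar>) \<longlonglongrightarrow> \<bar>right_deriv f v x\<bar>"
    by (intro tendsto_rabs right_diff_tendsto assms)
  show "\<forall>\<^sub>F n in sequentially. \<bar>diffquot f v (1 / Suc n) x\<bar> \<le> L * norm v"
    by (intro always_eventually allI abs_diffquot_le[OF L])
qed simp

lemma integrable_indicator_cbox:
  "integrable lborel (indicat_real (cbox a b :: 'a::euclidean_space set))"
  using emeasure_lborel_cbox_finite[of a b] by (intro integrable_real_indicator) auto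

lemma set_integrable_AE_bounded:
  fixes f :: "'a::euclidean_space \<Rightarrow> real"
  assumes "f \<in> borel_measurable borel" "AE x in lborel. \<bar>f x\<bar> \<le> B"
  shows "set_integrable lborel (cbox a b) f"
  unfolding set_integrable_def
proof (rule Bochner_Integration.integrable_bound)
  show "integrable lborel (\<lambda>x. indicator (cbox a b) x *\<^sub>R B)"
    by (simp add: integrable_indicator_cbox)
  show "(\<lambda>x. indicator (cbox a b) x *\<^sub>R f x) \<in> borel_measurable lborel"
    using assms(1) by simp
  show "AE x in lborel. norm (indicator (cbox a b) x *\<^sub>R f x) \<le> norm (indicator (cbox a b) x *\<^sub>R B)"
    using assms(2) by eventually_elim (auto simp: indicator_def)
qed

text \<open>The difference quotients of \<open>v\<close> are evaluated at points shifted by \<open>h w\<close>; on averages over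
  a box the shift has no effect in the limit, which gives additivity without any integration by parts.\<close>

lemma right_deriv_add_ae:
  fixes f :: "'a::euclidean_space \<Rightarrow> real"
  assumes L: "L-lipschitz_on UNIV f"
  shows "AE x in lborel. right_deriv f (v + w) x = right_deriv f v x + right_deriv f w x"
proof -
  have cont: "continuous_on UNIV f" using L lipschitz_on_continuous_on by blast
  note [measurable] = borel_right_deriv[OF cont]
  have [measurable]: "f \<in> borel_measurable borel"
    by (intro borel_measurable_continuous_onI cont)
  note rd = right_diff_ae[OF L]
  have bd: "AE x in lborel. \<bar>right_deriv f u x\<bar> \<le> L * norm u" for u
    using rd[of u] by eventually_elim (rule abs_right_deriv_le[OF L])
  have L0: "L \<ge> 0" by (rule lipschitz_on_nonneg[OF L])
  define g where "g = (\<lambda>x. right_deriv f (v + w) x - right_deriv f w x - right_deriv f v x)"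
  have si: "set_integrable lborel (cbox a b) (right_deriv f u)" for a b u
    by (rule set_integrable_AE_bounded[OF _ bd]) measurable
  have gi: "set_integrable lborel (cbox a b) g" for a b
    unfolding g_def by (intro set_integral_diff si)
  have zero: "(LINT x:cbox a b|lborel. g x) = 0" for a b
  proof -
    define h where "h = (\<lambda>n. 1 / real (Suc n))"
    \<comment> \<open>A box that contains the translates of \<open>cbox a b\<close> by all vectors
      \<open>h n *\<^sub>R w\<close>, because \<open>h n\<close> \<le> 1; it carries the dominating
      function.\<close>
    define K where "K = cbox (a - norm w *\<^sub>R One) (b + norm w *\<^sub>R One)"
    define A where "A = (\<lambda>n. LINT x|lborel. indicator (cbox a b) x * diffquot f v (h n) (x + h n *\<^sub>R w))"
    have h0: "h \<longlonglongrightarrow> 0" unfolding h_def using LIMSEQ_inverse_real_of_nat by (simp add: divide_inverse)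
    have h1: "0 < h n" "h n \<le> 1" for n by (auto simp: h_def)
    have "A \<longlonglongrightarrow> (LINT x|lborel. indicator (cbox a b) x * (right_deriv f (v + w) x - right_deriv f w x))"
      unfolding A_def
    proof (rule integral_dominated_convergence[where w="\<lambda>x. indicator (cbox a b) x * (L * norm v)"])
      show "AE x in lborel. (\<lambda>n. indicator (cbox a b) x * diffquot f v (h n) (x + h n *\<^sub>R w))
          \<longlonglongrightarrow> indicator (cbox a b) x * (right_deriv f (v + w) x - right_deriv f w x)"
        using rd[of "v + w"] rd[of w]
      proof eventually_elim
        case (elim x)
        \<comment> \<open>The quotient along \<open>v\<close>, based at the shifted point,
          telescopes into two quotients based at \<open>x\<close>, whose limits are known.\<close>
        have "diffquot f v (h n) (x + h n *\<^sub>R w) = diffquot f (v + w) (h n) x - diffquot f w (h n) x" for n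
          by (simp add: diff_divide_distrib[symmetric] scaleR_add_right add_ac)
        then show ?case
          using right_diff_tendsto(2)[OF elim(1)] right_diff_tendsto(2)[OF elim(2)]
          by (auto simp: h_def intro!: tendsto_intros)
      qed
      show "AE x in lborel. norm (indicator (cbox a b) x * diffquot f v (h n) (x + h n *\<^sub>R w))
          \<le> indicator (cbox a b) x * (L * norm v)" for n
        using abs_diffquot_le[OF L] by (intro AE_I2) (auto simp: indicator_def abs_mult)
      show "integrable lborel (\<lambda>x. indicator (cbox a b) x * (L * norm v))"
        by (intro integrable_mult_left) (simp add: integrable_indicator_cbox)
    qed measurable
    moreover have "A \<longlonglongrightarrow> (LINT x|lborel. indicator (cbox a b) x * right_deriv f v x)"
    proof -
      \<comment> \<open>Translation invariance moves the shift from the quotient to the box. Off the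
        boundary of the box, a null set, the shifted indicators converge.\<close>
      have "A = (\<lambda>n. LINT x|lborel. indicator (cbox a b) (x - h n *\<^sub>R w) * diffquot f v (h n) x)"
      proof
        fix n
        have "(LINT x|lborel. indicator (cbox a b) (x - h n *\<^sub>R w) * diffquot f v (h n) x)
          = (LINT x|distr lborel borel ((+) (h n *\<^sub>R w)). indicator (cbox a b) (x - h n *\<^sub>R w) * diffquot f v (h n) x)"
          by (simp add: lborel_distr_plus)
        also have "\<dots> = A n"
          unfolding A_def by (subst integral_distr) (auto simp: add.commute)
        finally show "A n = (LINT x|lborel. indicator (cbox a b) (x - h n *\<^sub>R w) * diffquot f v (h n) x)" ..
      qed
      moreover have "(\<lambda>n. LINT x|lborel. indicator (cbox a b) (x - h n *\<^sub>R w) * diffquot f v (h n) x) \<longlonglongrightarrow>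
        (LINT x|lborel. indicator (cbox a b) x * right_deriv f v x)"
      proof (rule integral_dominated_convergence[where w="\<lambda>x. indicator K x * (L * norm v)"])
        have fr: "AE x in lborel. x \<notin> cbox a b - box a b"
          using negligible_frontier_interval[of a b]
          by (intro AE_not_in) (auto simp: negligible_iff_null_sets null_sets_def)
        show "AE x in lborel. (\<lambda>n. indicator (cbox a b) (x - h n *\<^sub>R w) * diffquot f v (h n) x)
          \<longlonglongrightarrow> indicator (cbox a b) x * right_deriv f v x"
          using rd[of v] fr
        proof eventually_elim
          case (elim x)
          have t: "(\<lambda>n. x - h n *\<^sub>R w) \<longlonglongrightarrow> x"
            using tendsto_diff[OF tendsto_const[of x] tendsto_scaleR[OF h0 tendsto_const[of w]]] by simp
          have "\<forall>\<^sub>F n in sequentially. indicator (cbox a b) (x - h n *\<^sub>R w) = (indicator (cbox a b) x :: real)"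
          proof (cases "x \<in> box a b")
            case True
            then have "\<forall>\<^sub>F n in sequentially. x - h n *\<^sub>R w \<in> box a b"
              using topological_tendstoD[OF t open_box] by blast
            then show ?thesis
              by eventually_elim (use True box_subset_cbox[of a b] in \<open>auto simp: indicator_def\<close>)
          next
            case False
            then have "x \<in> - cbox a b" using elim by auto
            then have "\<forall>\<^sub>F n in sequentially. x - h n *\<^sub>R w \<in> - cbox a b"
              using topological_tendstoD[OF t open_Compl[OF closed_cbox]] by blast
            then show ?thesis
              by eventually_elim (use \<open>x \<in> - cbox a b\<close> in \<open>auto simp: indicator_def\<close>)
          qed
          then have "(\<lambda>n. indicator (cbox a b) (x - h n *\<^sub>R w) :: real) \<longlonglongrightarrow> indicator (cbox a b) x"
            by (rule tendsto_eventually)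
          then show ?case
            using right_diff_tendsto(2)[OF elim(1)] by (auto simp: h_def intro!: tendsto_intros)
        qed
        show "AE x in lborel. norm (indicator (cbox a b) (x - h n *\<^sub>R w) * diffquot f v (h n) x)
          \<le> indicator K x * (L * norm v)" for n
        proof (rule AE_I2)
          fix x
          have "x \<in> K" if "x - h n *\<^sub>R w \<in> cbox a b"
          proof -
            have "\<bar>h n * (w \<bullet> i)\<bar> \<le> norm w" if "i \<in> Basis" for i
            proof -
              have "\<bar>h n * (w \<bullet> i)\<bar> = h n * \<bar>w \<bullet> i\<bar>" using h1[of n] by (simp add: abs_mult)
              also have "\<dots> \<le> 1 * norm w"
                using h1[of n] Basis_le_norm[OF that, of w] by (intro mult_mono) auto
              finally show ?thesis by simp
            qed
            then show ?thesis
              using that unfolding K_def mem_box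
              by (simp add: inner_diff_left inner_add_left) (smt (verit, best))
          qed
          then show "norm (indicator (cbox a b) (x - h n *\<^sub>R w) * diffquot f v (h n) x)
            \<le> indicator K x * (L * norm v)"
            using abs_diffquot_le[OF L, of x "h n" v] L0 by (auto simp: indicator_def abs_mult)
        qed
        show "integrable lborel (\<lambda>x. indicator K x * (L * norm v))"
          unfolding K_def by (intro integrable_mult_left) (simp add: integrable_indicator_cbox)
      qed measurable
      ultimately show ?thesis by simp
    qed
    ultimately have eq: "(LINT x|lborel. indicator (cbox a b) x * (right_deriv f (v + w) x - right_deriv f w x))
      = (LINT x|lborel. indicator (cbox a b) x * right_deriv f v x)"
      by (rule LIMSEQ_unique)
    have "(LINT x:cbox a b|lborel. g x) = (LINT x:cbox a b|lborel. right_deriv f (v + w) x - right_deriv f w x)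
        - (LINT x:cbox a b|lborel. right_deriv f v x)"
      unfolding g_def by (intro set_integral_diff si)
    also have "\<dots> = 0" using eq by (simp add: set_lebesgue_integral_def)
    finally show ?thesis .
  qed
  have "g \<in> borel_measurable borel" unfolding g_def by measurable
  from ae_zero_if_integral_cbox_zero[OF this gi zero] show ?thesis
    by eventually_elim (simp add: g_def)
qed

lemma right_deriv_zero [simp]: "right_deriv f 0 x = 0"
  by (rule right_deriv_eqI) simp

text \<open>For negative factors a one-sided limit gives nothing directly; the sign is obtained from
  additivity, the derivatives along \<open>c *\<^sub>R v\<close> and
  \<open>(- c) *\<^sub>R v\<close> adding up to that along 0.\<close>

lemma right_deriv_scale_ae:
  fixes f :: "'a::euclidean_space \<Rightarrow> real"
  assumes L: "L-lipschitz_on UNIV f"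
  shows "AE x in lborel. right_deriv f (c *\<^sub>R v) x = c * right_deriv f v x"
proof (cases c "0 :: real" rule: linorder_cases)
  case less
  show ?thesis
    using right_deriv_add_ae[OF L, of "c *\<^sub>R v" "(- c) *\<^sub>R v"] right_diff_ae[OF L, of v]
  proof eventually_elim
    case (elim x)
    have "right_deriv f ((- c) *\<^sub>R v) x = - c * right_deriv f v x"
      using elim less by (intro right_deriv_scale) auto
    then show ?case using elim(1) by simp
  qed
next
  case greater
  show ?thesis using right_diff_ae[OF L, of v]
    by eventually_elim (rule right_deriv_scale, use greater in auto)
qed simp

lemma right_deriv_eq_inner_ae:
  fixes f :: "'a::euclidean_space \<Rightarrow> real"
  assumes L: "L-lipschitz_on UNIV f"
  shows "AE x in lborel. right_deriv f v x = v \<bullet> (\<Sum>b\<in>Basis. right_deriv f b x *\<^sub>R b)"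
proof -
  have "AE x in lborel. right_deriv f (\<Sum>b\<in>A. (v \<bullet> b) *\<^sub>R b) x = (\<Sum>b\<in>A. (v \<bullet> b) * right_deriv f b x)"
    if "finite A" for A
    using that
  proof induction
    case (insert b A)
    show ?case
      using insert.IH right_deriv_add_ae[OF L, of "(v \<bullet> b) *\<^sub>R b" "\<Sum>b\<in>A. (v \<bullet> b) *\<^sub>R b"]
        right_deriv_scale_ae[OF L, of "v \<bullet> b" b]
      by eventually_elim (use insert.hyps in simp)
  qed simp
  from this[OF finite_Basis] show ?thesis
    by eventually_elim (simp add: euclidean_representation inner_sum_right mult.commute)
qed

text \<open>The unit sphere is covered by finitely many small balls around directions in
  \<open>S\<close>. Convergence is uniform over these finitely many directions, and the Lipschitz
  bound transfers it to all others.\<close>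

lemma differentiable_if_right_diff_dense:
  fixes f :: "'a::euclidean_space \<Rightarrow> real"
  assumes L: "L-lipschitz_on UNIV f" and dense: "closure S = UNIV"
    and dir: "\<And>v. v \<in> S \<Longrightarrow> ((\<lambda>h. diffquot f v h x) \<longlongrightarrow> v \<bullet> G) (at_right 0)"
  shows "f differentiable (at x)"
proof -
  have L0: "L \<ge> 0" by (rule lipschitz_on_nonneg[OF L])
  have key: "\<exists>d>0. \<forall>y. norm (y - x) < d \<longrightarrow> \<bar>f y - f x - (y - x) \<bullet> G\<bar> \<le> e * norm (y - x)"
    if e: "e > 0" for e
  proof -
    \<comment> \<open>The three errors are \<open>r\<close> in the quotient, \<open>L * r\<close>
      from moving the argument and \<open>r * norm G\<close> from moving the linear term; together
      they make \<open>e\<close>.\<close>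
    define r where "r = e / (L + norm G + 1)"
    have "L + norm G + 1 > 0" using L0 by (simp add: add_nonneg_pos)
    then have r: "r > 0" "r * (L + norm G + 1) = e" using e by (auto simp: r_def)
    have "sphere (0::'a) 1 \<subseteq> (\<Union>v\<in>S. ball v r)"
    proof
      fix u :: 'a
      have "u \<in> closure S" using dense by simp
      then obtain v where "v \<in> S" "dist v u < r" using r(1) closure_approachable by blast
      then show "u \<in> (\<Union>v\<in>S. ball v r)" by auto
    qed
    from compactE_image[OF compact_sphere _ this] obtain T where T: "T \<subseteq> S" "finite T"
      "sphere (0::'a) 1 \<subseteq> (\<Union>v\<in>T. ball v r)" by auto
    have "\<forall>v\<in>T. \<forall>\<^sub>F h in at_right 0. \<bar>diffquot f v h x - v \<bullet> G\<bar> < r"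
    proof
      fix v assume "v \<in> T"
      then show "\<forall>\<^sub>F h in at_right 0. \<bar>diffquot f v h x - v \<bullet> G\<bar> < r"
        using tendstoD[OF dir[of v] r(1)] T(1) by (auto simp: dist_real_def)
    qed
    then have "\<forall>\<^sub>F h in at_right 0. \<forall>v\<in>T. \<bar>diffquot f v h x - v \<bullet> G\<bar> < r"
      using T(2) by (rule eventually_ball_finite[rotated])
    then obtain d where d: "d > 0" "\<And>h v. 0 < h \<Longrightarrow> h < d \<Longrightarrow> v \<in> T \<Longrightarrow> \<bar>diffquot f v h x - v \<bullet> G\<bar> < r"
      unfolding eventually_at_right_field by blast
    have "\<bar>f y - f x - (y - x) \<bullet> G\<bar> \<le> e * norm (y - x)" if y: "norm (y - x) < d" for y
    proof (cases "y = x")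
      case False
      define t where "t = norm (y - x)"
      define u where "u = (y - x) /\<^sub>R t"
      have t: "t > 0" "t < d" using False y by (auto simp: t_def)
      have u: "norm u = 1" "y = x + t *\<^sub>R u" using t by (auto simp: u_def t_def)
      from u(1) T(3) obtain v where v: "v \<in> T" "norm (v - u) < r"
        by (force simp: dist_norm)
      have "\<bar>diffquot f v t x - v \<bullet> G\<bar> < r" using d(2) t v by blast
      moreover have "\<bar>(f (x + t *\<^sub>R v) - f x) - t * (v \<bullet> G)\<bar> = t * \<bar>diffquot f v t x - v \<bullet> G\<bar>"
        using t(1) by (simp add: abs_mult_pos[symmetric] abs_mult[symmetric] field_simps)
      ultimately have 1: "\<bar>(f (x + t *\<^sub>R v) - f x) - t * (v \<bullet> G)\<bar> \<le> t * r"
        using t(1) by simp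
      have "dist (x + t *\<^sub>R u) (x + t *\<^sub>R v) = t * norm (v - u)"
        using t(1) by (simp add: dist_norm scaleR_diff_right[symmetric] norm_minus_commute)
      then have "\<bar>f y - f (x + t *\<^sub>R v)\<bar> \<le> L * (t * norm (v - u))"
        using lipschitz_onD[OF L, of "x + t *\<^sub>R u" "x + t *\<^sub>R v"] u(2) by (simp add: dist_real_def)
      also have "\<dots> \<le> L * (t * r)" using v(2) t(1) L0 by (intro mult_left_mono) auto
      finally have 2: "\<bar>f y - f (x + t *\<^sub>R v)\<bar> \<le> L * (t * r)" .
      have "\<bar>t * ((v - u) \<bullet> G)\<bar> \<le> t * (r * norm G)"
        using Cauchy_Schwarz_ineq2[of "v - u" G] v(2) t(1)
        by (simp add: abs_mult) (meson mult_right_mono norm_ge_zero order_less_imp_le order_trans)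
      then have 3: "\<bar>t * (v \<bullet> G) - (y - x) \<bullet> G\<bar> \<le> t * (r * norm G)"
        using u(2) by (simp add: inner_diff_left algebra_simps)
      have "\<bar>f y - f x - (y - x) \<bullet> G\<bar> \<le> L * (t * r) + t * r + t * (r * norm G)"
        using 1 2 3 by linarith
      also have "\<dots> = t * (r * (L + norm G + 1))" by (simp add: algebra_simps)
      finally show ?thesis using r(2) by (simp add: t_def mult.commute)
    qed simp
    then show ?thesis using d(1) by blast
  qed
  have "(f has_derivative (\<lambda>h. h \<bullet> G)) (at x)"
    unfolding has_derivative_at_alt
    using key by (auto intro: bounded_linear_inner_left)
  then show ?thesis by (rule differentiableI)
qed

text \<open>Linearity in the direction has its own exceptional set for each direction; passing to a
  countable dense set of directions keeps the union null.\<close>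

theorem rademacher:
  fixes f :: "'a::euclidean_space \<Rightarrow> real"
  assumes L: "L-lipschitz_on UNIV f"
  shows "negligible {x. \<not> f differentiable (at x)}"
proof -
  obtain S :: "'a set" where S: "countable S" "closure S = UNIV"
    using separable[of "UNIV :: 'a set"] by (metis UNIV_eq_I subset_UNIV top.extremum_uniqueI)
  have "AE x in lborel. \<forall>v\<in>S. right_diff f v x \<and> right_deriv f v x = v \<bullet> (\<Sum>b\<in>Basis. right_deriv f b x *\<^sub>R b)"
    by (intro AE_ball_countable' S(1) AE_conjI right_diff_ae[OF L] right_deriv_eq_inner_ae[OF L])
  then have "AE x in lborel. f differentiable (at x)"
  proof eventually_elim
    case (elim x)
    show ?case
    proof (rule differentiable_if_right_diff_dense[OF L S(2)])
      fix v assume "v \<in> S"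
      then show "((\<lambda>h. diffquot f v h x) \<longlongrightarrow> v \<bullet> (\<Sum>b\<in>Basis. right_deriv f b x *\<^sub>R b)) (at_right 0)"
        using elim right_diff_tendsto(1)[of f v x] by simp
    qed
  qed
  then have "AE x in lebesgue. f differentiable (at x)" by (rule AE_completion)
  then show ?thesis
    using negligible_subset unfolding eventually_ae_filter_negligible by auto
qed

section \<open>Alexandrov's theorem\<close>

text \<open>\<open>T\<close> picks a subgradient at every point, with no regularity, and its
  existence forces convexity of \<open>h\<close>. For sup-convolutions \<open>T\<close> will be the
  point at which the supremum is attained.\<close>

locale subgradient_selection =
  fixes h :: "'a::euclidean_space \<Rightarrow> real" and T :: "'a \<Rightarrow> 'a"
  assumes subgradient: "h x + T x \<bullet> (y - x) \<le> h y"
begin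

lemma convex: "convex_on UNIV h"
proof (rule convex_onI)
  fix t :: real and x y :: 'a assume t: "0 < t" "t < 1"
  define z where "z = (1 - t) *\<^sub>R x + t *\<^sub>R y"
  have "(1 - t) * (h z + T z \<bullet> (x - z)) + t * (h z + T z \<bullet> (y - z)) \<le> (1 - t) * h x + t * h y"
    using t by (intro add_mono mult_left_mono subgradient) auto
  also have "(1 - t) * (h z + T z \<bullet> (x - z)) + t * (h z + T z \<bullet> (y - z))
    = h z + T z \<bullet> ((1 - t) *\<^sub>R x + t *\<^sub>R y - z)"
    by (simp add: inner_diff_right inner_add_right algebra_simps)
  finally show "h ((1 - t) *\<^sub>R x + t *\<^sub>R y) \<le> (1 - t) * h x + t * h y"
    by (simp add: z_def)
qed simp

lemma continuous: "continuous_on UNIV h"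
  by (rule convex_on_continuous[OF open_UNIV convex])

text \<open>The point is the minimiser of h + |. - x|^2 / 2. Comparison with points at parameter t
  on the segment from it towards y, as t tends to 0, yields the subgradient inequality.\<close>

lemma prox_exists: "\<exists>z. \<forall>y. h z + (x - z) \<bullet> (y - z) \<le> h y"
proof -
  define e where "e = (\<lambda>z. h z + (norm (z - x))\<^sup>2 / 2)"
  \<comment> \<open>Beyond this radius the quadratic term outweighs the largest decrease that the
    subgradient at \<open>x\<close> allows.\<close>
  define r where "r = 2 * norm (T x)"
  have "continuous_on (cball x r) e"
    unfolding e_def by (intro continuous_intros continuous_on_subset[OF continuous]) auto
  then obtain z where z: "z \<in> cball x r" "\<And>y. y \<in> cball x r \<Longrightarrow> e z \<le> e y"
    using continuous_attains_inf[OF compact_cball, of x r e] by (auto simp: r_def)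
  have min: "e z \<le> e y" for y
  proof (cases "y \<in> cball x r")
    case False
    then have y: "norm (y - x) > r" by (simp add: dist_norm norm_minus_commute)
    have "e z \<le> e x" by (rule z(2)) (simp add: r_def)
    also have "e x = h x" by (simp add: e_def)
    also have "\<dots> \<le> h y - T x \<bullet> (y - x)" using subgradient[of x y] by simp
    also have "\<dots> \<le> h y + norm (T x) * norm (y - x)"
      using Cauchy_Schwarz_ineq2[of "T x" "y - x"] by linarith
    also have "norm (T x) * norm (y - x) \<le> (norm (y - x) / 2) * norm (y - x)"
      using y by (intro mult_right_mono) (auto simp: r_def)
    finally show ?thesis by (simp add: e_def power2_eq_square)
  qed (use z in blast)
  have "h z + (x - z) \<bullet> (y - z) \<le> h y" for y
  proof -
    have "(x - z) \<bullet> (y - z) \<le> h y - h z + t * ((norm (y - z))\<^sup>2 / 2)" if t: "0 < t" "t < 1" for t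
    proof -
      have "h (z + t *\<^sub>R (y - z)) \<le> h z + t * (h y - h z)"
        using convex_onD[OF convex, of t z y] t by (simp add: algebra_simps)
      moreover have "(norm (z + t *\<^sub>R (y - z) - x))\<^sup>2 = (norm (z - x))\<^sup>2 - 2 * t * ((x - z) \<bullet> (y - z)) + t\<^sup>2 * (norm (y - z))\<^sup>2"
        unfolding power2_norm_eq_inner
        by (simp add: inner_diff_left inner_diff_right inner_add_left inner_add_right inner_commute
            algebra_simps power2_eq_square)
      ultimately have "t * ((x - z) \<bullet> (y - z)) \<le> t * (h y - h z + t * ((norm (y - z))\<^sup>2 / 2))"
        using min[of "z + t *\<^sub>R (y - z)"] by (simp add: e_def algebra_simps power2_eq_square)
      then show ?thesis using t by simp
    qed
    then have "\<forall>\<^sub>F t in at_right 0. (x - z) \<bullet> (y - z) \<le> h y - h z + t * ((norm (y - z))\<^sup>2 / 2)"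
      unfolding eventually_at_right_field by (intro exI[of _ 1]) auto
    moreover have "((\<lambda>t. h y - h z + t * ((norm (y - z))\<^sup>2 / 2)) \<longlongrightarrow> h y - h z + 0 * ((norm (y - z))\<^sup>2 / 2)) (at_right 0)"
      by (intro tendsto_intros)
    ultimately have "(x - z) \<bullet> (y - z) \<le> h y - h z"
      using tendsto_lowerbound[OF _ _ trivial_limit_at_right_real] by fastforce
    then show ?thesis by simp
  qed
  then show ?thesis by blast
qed

definition prox :: "'a \<Rightarrow> 'a" where "prox x = (SOME z. \<forall>y. h z + (x - z) \<bullet> (y - z) \<le> h y)"

lemma prox: "h (prox x) + (x - prox x) \<bullet> (y - prox x) \<le> h y"
  unfolding prox_def using someI_ex[OF prox_exists[of x]] by blast

text \<open>Sum of the two subgradient inequalities. This firm form, stronger than the Lipschitz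
  bound, also gives monotonicity along lines.\<close>

lemma prox_firm: "(norm (prox x - prox y))\<^sup>2 \<le> (prox x - prox y) \<bullet> (x - y)"
  using prox[of x "prox y"] prox[of y "prox x"]
  unfolding power2_norm_eq_inner
  by (simp add: inner_diff_left inner_diff_right inner_commute)

lemma prox_lipschitz: "norm (prox x - prox y) \<le> norm (x - y)"
proof -
  have "norm (prox x - prox y) * norm (prox x - prox y) \<le> norm (prox x - prox y) * norm (x - y)"
    using prox_firm[of x y] norm_cauchy_schwarz[of "prox x - prox y" "x - y"]
    by (simp add: power2_eq_square)
  then show ?thesis
    by (cases "prox x = prox y") (auto simp: mult_le_cancel_left)
qed

text \<open>The proximal map inverts the identity plus the subdifferential, so the result is
  \<open>z\<close> whichever subgradient was selected. In particular every point is a value of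
  \<open>prox\<close>.\<close>

lemma prox_subgradient [simp]: "prox (z + T z) = z"
proof -
  have "(norm (prox (z + T z) - z))\<^sup>2 \<le> 0"
    using prox[of "z + T z" z] subgradient[of z "prox (z + T z)"]
    unfolding power2_norm_eq_inner
    by (simp add: inner_diff_left inner_diff_right inner_add_left inner_add_right inner_commute)
  then show ?thesis by simp
qed

text \<open>The derivative of \<open>T\<close> is obtained by inverting that of the proximal map, which is the resolvent of
  the subdifferential.\<close>

lemma subgradient_has_derivative:
  assumes D: "(prox has_derivative D) (at (z + T z))" and inj: "inj D"
  shows "\<exists>S. (T has_derivative S) (at z)"
proof -
  define x where "x = z + T z"
  have Jx: "prox x = z" by (simp add: x_def)
  have lin: "linear D" using D has_derivative_linear by blast
  obtain D' where D': "linear D'" "\<And>x. D' (D x) = x"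
    using linear_injective_left_inverse[OF lin inj] by (metis comp_apply id_apply)
  obtain B where B: "B > 0" "\<And>y. norm (D' y) \<le> B * norm y"
    using linear_bounded_pos[OF D'(1)] by blast
  have "\<exists>d>0. \<forall>y. norm (y - z) < d \<longrightarrow> norm (T y - T z - (D' (y - z) - (y - z))) \<le> e * norm (y - z)"
    if e: "e > 0" for e
  proof -
    \<comment> \<open>The first bound makes the linearisation error absorbable in
      \<open>low\<close>; the second makes the final error, amplified by
      \<open>2 * B\<^sup>2\<close>, at most \<open>e\<close>.\<close>
    define \<zeta> where "\<zeta> = min (1 / (2 * B)) (e / (2 * B\<^sup>2))"
    have \<zeta>: "\<zeta> > 0" "\<zeta> \<le> 1 / (2 * B)" "2 * B\<^sup>2 * \<zeta> \<le> e"
    proof -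
      show "\<zeta> > 0" using e B by (simp add: \<zeta>_def)
      show "\<zeta> \<le> 1 / (2 * B)" by (simp add: \<zeta>_def)
      have "\<zeta> \<le> e / (2 * B\<^sup>2)" by (simp add: \<zeta>_def)
      then show "2 * B\<^sup>2 * \<zeta> \<le> e" using B by (simp add: field_simps)
    qed
    obtain \<delta>' where \<delta>': "\<delta>' > 0" "\<And>y. norm (y - x) < \<delta>' \<Longrightarrow> norm (prox y - z - D (y - x)) \<le> \<zeta> * norm (y - x)"
      using D \<zeta>(1) unfolding has_derivative_at_alt x_def[symmetric] Jx by blast
    define \<delta> where "\<delta> = \<delta>' / 2"
    have \<delta>: "\<delta> > 0" "\<And>y. norm (y - x) \<le> \<delta> \<Longrightarrow> norm (prox y - z - D (y - x)) \<le> \<zeta> * norm (y - x)"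
      using \<delta>' by (auto simp: \<delta>_def)
    \<comment> \<open>Injectivity of \<open>D\<close> forces \<open>prox\<close> to move points near
      \<open>x\<close> by at least a fixed proportion.\<close>
    have low: "norm (y - x) \<le> 2 * B * norm (prox y - z)" if y: "norm (y - x) \<le> \<delta>" for y
    proof -
      have "norm (y - x) \<le> B * norm (D (y - x))" using B(2)[of "D (y - x)"] D'(2) by simp
      also have "norm (D (y - x)) \<le> norm (prox y - z) + norm (prox y - z - D (y - x))"
        using norm_triangle_ineq4[of "prox y - z" "prox y - z - D (y - x)"] by simp
      also have "norm (prox y - z - D (y - x)) \<le> 1 / (2 * B) * norm (y - x)"
        using \<delta>(2)[OF y] \<zeta>(2) by (meson mult_right_mono norm_ge_zero order_trans)
      finally have "norm (y - x) \<le> B * (norm (prox y - z) + 1 / (2 * B) * norm (y - x))"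
        using B(1) by simp
      then show ?thesis using B(1) by (simp add: algebra_simps)
    qed
    define c where "c = 1 / (2 * B)"
    have c: "c > 0" using B by (simp add: c_def)
    have "norm (T y - T z - (D' (y - z) - (y - z))) \<le> e * norm (y - z)" if y: "norm (y - z) < c\<^sup>2 * \<delta>" for y
    proof -
      define k where "k = y - z"
      define x' where "x' = y + T y"
      have Jx': "prox x' = y" by (simp add: x'_def)
      \<comment> \<open>As \<open>T\<close> is not known to be continuous, \<open>y + T y\<close>
        could be far from \<open>x\<close> although \<open>y\<close> is near \<open>z\<close>. If
        so, stop at distance \<delta> on the way to it: by \<open>low\<close> and firmness the
        component of \<open>prox\<close> along \<open>u\<close> has already grown by c^2 \<delta>,
        and monotonicity prevents it from decreasing afterwards.\<close>
      have near: "norm (x' - x) \<le> \<delta>"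
      proof (rule ccontr)
        assume far: "\<not> norm (x' - x) \<le> \<delta>"
        define r where "r = norm (x' - x)"
        define u where "u = (x' - x) /\<^sub>R r"
        define xt where "xt = x + \<delta> *\<^sub>R u"
        have r: "r > \<delta>" "r > 0" using far \<delta>(1) by (auto simp: r_def)
        have u: "norm u = 1" "x' - x = r *\<^sub>R u" using r by (auto simp: u_def r_def)
        have nxt: "norm (xt - x) = \<delta>" using u \<delta>(1) by (simp add: xt_def)
        have m: "c * \<delta> \<le> norm (prox xt - z)"
          using low[of xt] nxt B(1) by (simp add: c_def field_simps)
        have "(c * \<delta>)\<^sup>2 \<le> (norm (prox xt - z))\<^sup>2"
          using m c \<delta>(1) by (intro power_mono) auto
        also have "\<dots> \<le> \<delta> * ((prox xt - z) \<bullet> u)"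
          using prox_firm[of xt x] by (simp add: Jx xt_def)
        finally have "c\<^sup>2 * \<delta> \<le> (prox xt - z) \<bullet> u"
          using \<delta>(1) by (simp add: power2_eq_square)
        moreover have "0 \<le> (y - prox xt) \<bullet> u"
        proof -
          have "x' - xt = (r - \<delta>) *\<^sub>R u" using u(2) by (simp add: xt_def algebra_simps)
          then have "(norm (y - prox xt))\<^sup>2 \<le> (r - \<delta>) * ((y - prox xt) \<bullet> u)"
            using prox_firm[of x' xt] by (simp add: Jx')
          then have "0 \<le> (r - \<delta>) * ((y - prox xt) \<bullet> u)"
            by (rule order_trans[OF zero_le_power2])
          then show ?thesis using r(1) by (simp add: zero_le_mult_iff)
        qed
        moreover have "(y - z) \<bullet> u \<le> norm (y - z)"
          using norm_cauchy_schwarz[of "y - z" u] u(1) by simp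
        ultimately show False using y by (simp add: inner_diff_left)
      qed
      have "T y - T z - (D' (y - z) - (y - z)) = D' (D (x' - x) - (prox x' - z))"
        using D'(2) by (simp add: linear_diff[OF D'(1)] Jx' x'_def x_def)
      also have "norm \<dots> \<le> B * norm (prox x' - z - D (x' - x))"
        using B(2) by (simp add: norm_minus_commute)
      also have "\<dots> \<le> B * (\<zeta> * norm (x' - x))"
        using \<delta>(2)[OF near] B(1) by (intro mult_left_mono) auto
      also have "\<dots> \<le> B * (\<zeta> * (2 * B * norm (y - z)))"
        using low[OF near] B(1) \<zeta>(1) by (intro mult_left_mono) (auto simp: Jx')
      also have "\<dots> = 2 * B\<^sup>2 * \<zeta> * norm (y - z)" by (simp add: power2_eq_square)
      also have "\<dots> \<le> e * norm (y - z)" using \<zeta>(3) by (intro mult_right_mono) auto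
      finally show ?thesis .
    qed
    then show ?thesis using c \<delta>(1) by (intro exI[of _ "c\<^sup>2 * \<delta>"]) auto
  qed
  moreover have "bounded_linear (\<lambda>k. D' k - k)"
    using D'(1) by (intro bounded_linear_sub bounded_linear_ident) (simp add: linear_conv_bounded_linear)
  ultimately have "(T has_derivative (\<lambda>k. D' k - k)) (at z)"
    unfolding has_derivative_at_alt by blast
  then show ?thesis by blast
qed

end

section \<open>From a derivative of the subgradient to a second order expansion\<close>

text \<open>Integration of an affine bound for slopes by Riemann sums over equal pieces; no
  derivative of \<open>G\<close> has to exist.\<close>

lemma increment_le_of_slope_le:
  fixes G :: "real \<Rightarrow> real"
  assumes "\<And>s t. 0 \<le> s \<Longrightarrow> s \<le> t \<Longrightarrow> t \<le> 1 \<Longrightarrow> G t - G s \<le> (t - s) * (a + b * t)"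
  shows "G 1 - G 0 \<le> a + b / 2"
proof -
  have "G 1 - G 0 \<le> a + b / 2 + b / 2 * (1 / real (Suc n))" for n
  proof -
    let ?m = "Suc n"
    have "G 1 - G 0 = (\<Sum>i<?m. G (real (Suc i) / ?m) - G (real i / ?m))"
      by (subst sum_lessThan_telescope) simp
    also have "\<dots> \<le> (\<Sum>i<?m. (1 / ?m) * (a + b * (real (Suc i) / ?m)))"
    proof (rule sum_mono)
      fix i assume "i \<in> {..<?m}"
      then have i: "Suc i \<le> ?m" by auto
      have "real (Suc i) / ?m \<le> 1" using i by (simp only: divide_le_eq_1 of_nat_le_iff) auto
      moreover have "real i / ?m \<le> real (Suc i) / ?m" by (intro divide_right_mono) auto
      moreover have "real (Suc i) / ?m - real i / ?m = 1 / ?m"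
        by (simp add: diff_divide_distrib[symmetric])
      ultimately show "G (real (Suc i) / ?m) - G (real i / ?m) \<le> (1 / ?m) * (a + b * (real (Suc i) / ?m))"
        using assms[of "real i / ?m" "real (Suc i) / ?m"] by simp
    qed
    also have "\<dots> = a + b / ?m\<^sup>2 * (\<Sum>i<?m. real (Suc i))"
    proof -
      have "(1 / c) * (a + b * (x / c)) = a / c + b / c\<^sup>2 * x" if "c \<noteq> 0" for c x :: real
        using that by (simp add: field_simps power2_eq_square)
      from this[of "real ?m"]
      have "(1 / ?m) * (a + b * (real (Suc i) / ?m)) = a / ?m + b / ?m\<^sup>2 * real (Suc i)" for i
        by simp
      then show ?thesis by (simp only: sum.distrib sum_distrib_left) simp
    qed
    also have "(\<Sum>i<?m. real (Suc i)) = real ?m * (real ?m + 1) / 2"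
      by (induction n) (simp_all add: field_simps)
    also have "a + b / ?m\<^sup>2 * (real ?m * (real ?m + 1) / 2) = a + b / 2 + b / 2 * (1 / real ?m)"
    proof -
      have "a + b / c\<^sup>2 * (c * (c + 1) / 2) = a + b / 2 + b / 2 * (1 / c)" if "c \<noteq> 0" for c :: real
        using that by (simp add: field_simps power2_eq_square)
      from this[of "real ?m"] show ?thesis by simp
    qed
    finally show ?thesis .
  qed
  moreover have "(\<lambda>n. a + b / 2 + b / 2 * (1 / real (Suc n))) \<longlonglongrightarrow> a + b / 2 + b / 2 * 0"
    using LIMSEQ_inverse_real_of_nat by (intro tendsto_intros) (simp add: divide_inverse)
  ultimately show ?thesis
    using LIMSEQ_le_const[of _ "a + b / 2"] by (metis (no_types, lifting) add.right_neutral mult_zero_right)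
qed

text \<open>The upper bound applied to the reversed path t \<mapsto> G(1 - t).\<close>

lemma increment_ge_of_slope_ge:
  fixes G :: "real \<Rightarrow> real"
  assumes "\<And>s t. 0 \<le> s \<Longrightarrow> s \<le> t \<Longrightarrow> t \<le> 1 \<Longrightarrow> (t - s) * (a + b * s) \<le> G t - G s"
  shows "a + b / 2 \<le> G 1 - G 0"
proof -
  have "G (1 - 1) - G (1 - 0) \<le> (- a - b) + b / 2"
  proof (rule increment_le_of_slope_le[of "\<lambda>t. G (1 - t)"])
    fix s t :: real assume "0 \<le> s" "s \<le> t" "t \<le> 1"
    then show "G (1 - t) - G (1 - s) \<le> (t - s) * (- a - b + b * t)"
      using assms[of "1 - t" "1 - s"] by (simp add: algebra_simps)
  qed
  then show ?thesis by simp
qed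

text \<open>A second order Taylor expansion at one point, as in Alexandrov's theorem.
  \<open>S\<close> enters only through its quadratic form; it is symmetrised when a matrix is
  needed.\<close>

definition quadratic_expansion :: "('a::real_inner \<Rightarrow> real) \<Rightarrow> 'a \<Rightarrow> 'a \<Rightarrow> ('a \<Rightarrow> 'a) \<Rightarrow> bool" where
  "quadratic_expansion f x p S \<longleftrightarrow> linear S \<and>
     (\<forall>e>0. \<exists>d>0. \<forall>k. norm k < d \<longrightarrow> \<bar>f (x + k) - f x - p \<bullet> k - (S k \<bullet> k) / 2\<bar> \<le> e * (norm k)\<^sup>2)"

text \<open>On a segment the increments of \<open>h\<close> lie between those predicted by the
  subgradients at the two ends, and the derivative of \<open>T\<close> makes these affine up to a
  small error; integration produces the factor 1/2.\<close>

lemma (in subgradient_selection) quadratic_expansion_of_derivative: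
  assumes "(T has_derivative S) (at z)"
  shows "quadratic_expansion h z (T z) S"
  unfolding quadratic_expansion_def
proof (intro conjI allI impI)
  show lin: "linear S" using assms has_derivative_linear by blast
  fix e :: real assume "e > 0"
  then obtain d where d: "d > 0" "\<And>y. norm (y - z) < d \<Longrightarrow> norm (T y - T z - S (y - z)) \<le> e * norm (y - z)"
    using assms unfolding has_derivative_at_alt by blast
  have "\<bar>h (z + k) - h z - T z \<bullet> k - (S k \<bullet> k) / 2\<bar> \<le> e * (norm k)\<^sup>2" if k: "norm k < d" for k
  proof -
    define G where "G = (\<lambda>t. h (z + t *\<^sub>R k))"
    have slope: "\<bar>T (z + t *\<^sub>R k) \<bullet> k - (T z \<bullet> k + t * (S k \<bullet> k))\<bar> \<le> e * (norm k)\<^sup>2" if "0 \<le> t" "t \<le> 1" for t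
    proof -
      have tk: "norm (t *\<^sub>R k) \<le> norm k" using that by (simp add: mult_left_le_one_le)
      have "norm (T (z + t *\<^sub>R k) - T z - S (t *\<^sub>R k)) \<le> e * norm (t *\<^sub>R k)"
        using d(2)[of "z + t *\<^sub>R k"] tk k by simp
      also have "\<dots> \<le> e * norm k" using tk \<open>e > 0\<close> by (intro mult_left_mono) auto
      finally have "norm (T (z + t *\<^sub>R k) - T z - S (t *\<^sub>R k)) * norm k \<le> e * norm k * norm k"
        by (intro mult_right_mono) auto
      with Cauchy_Schwarz_ineq2[of "T (z + t *\<^sub>R k) - T z - S (t *\<^sub>R k)" k] show ?thesis
        by (simp add: inner_diff_left linear_scale[OF lin] power2_eq_square algebra_simps)
    qed
    have sub: "(t - s) * (T (z + s *\<^sub>R k) \<bullet> k) \<le> G t - G s" for s t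
      using subgradient[of "z + s *\<^sub>R k" "z + t *\<^sub>R k"]
      by (simp add: G_def scaleR_diff_left[symmetric])
    have "G 1 - G 0 \<le> (T z \<bullet> k + e * (norm k)\<^sup>2) + (S k \<bullet> k) / 2"
    proof (rule increment_le_of_slope_le)
      fix s t :: real assume st: "0 \<le> s" "s \<le> t" "t \<le> 1"
      have "G t - G s \<le> (t - s) * (T (z + t *\<^sub>R k) \<bullet> k)" using sub[of s t] by (simp add: algebra_simps)
      also have "\<dots> \<le> (t - s) * (T z \<bullet> k + e * (norm k)\<^sup>2 + (S k \<bullet> k) * t)"
        using slope[of t] st by (intro mult_left_mono) (auto simp: algebra_simps)
      finally show "G t - G s \<le> (t - s) * (T z \<bullet> k + e * (norm k)\<^sup>2 + (S k \<bullet> k) * t)" .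
    qed
    moreover have "(T z \<bullet> k - e * (norm k)\<^sup>2) + (S k \<bullet> k) / 2 \<le> G 1 - G 0"
    proof (rule increment_ge_of_slope_ge)
      fix s t :: real assume st: "0 \<le> s" "s \<le> t" "t \<le> 1"
      have "(t - s) * (T z \<bullet> k - e * (norm k)\<^sup>2 + (S k \<bullet> k) * s) \<le> (t - s) * (T (z + s *\<^sub>R k) \<bullet> k)"
        using slope[of s] st by (intro mult_left_mono) (auto simp: algebra_simps)
      also have "\<dots> \<le> G t - G s" by (rule sub)
      finally show "(t - s) * (T z \<bullet> k - e * (norm k)\<^sup>2 + (S k \<bullet> k) * s) \<le> G t - G s" .
    qed
    ultimately show ?thesis by (simp add: G_def abs_le_iff)
  qed
  then show "\<exists>d>0. \<forall>k. norm k < d \<longrightarrow> \<bar>h (z + k) - h z - T z \<bullet> k - (S k \<bullet> k) / 2\<bar> \<le> e * (norm k)\<^sup>2"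
    using d(1) by blast
qed

text \<open>Null sets of bad arguments of \<open>prox\<close> are not enough, since the points to be
  excluded are its values. The image of the set of non-differentiability is null because
  \<open>prox\<close> is Lipschitz, the image of the critical set by Sard.\<close>

theorem alexandrov:
  fixes h :: "real ^ 'n::{finite,wellorder} \<Rightarrow> real"
  assumes sub: "\<And>x y. h x + T x \<bullet> (y - x) \<le> h y"
  shows "negligible {z. \<not> (\<exists>p S. quadratic_expansion h z p S)}"
proof -
  interpret subgradient_selection h T by unfold_locales (rule sub)
  define N0 where "N0 = (\<Union>i\<in>UNIV. {x. \<not> (\<lambda>x. prox x $ i) differentiable (at x)})"
  have "1-lipschitz_on UNIV (\<lambda>x. prox x $ i)" for i
  proof (rule lipschitz_onI)
    fix x y
    show "dist (prox x $ i) (prox y $ i) \<le> 1 * dist x y"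
      using prox_lipschitz[of x y] component_le_norm_cart[of "prox x - prox y" i]
      by (simp add: dist_norm)
  qed simp
  then have N0: "negligible N0"
    unfolding N0_def by (intro negligible_Union) (auto intro: rademacher)
  have diff: "(prox has_derivative frechet_derivative prox (at x)) (at x)" if "x \<notin> N0" for x
  proof -
    have "(\<lambda>x. prox x \<bullet> b) differentiable (at x)" if "b \<in> Basis" for b
      using that \<open>x \<notin> N0\<close> by (auto simp: N0_def Basis_vec_def inner_axis)
    then have "prox differentiable (at x)"
      using differentiable_componentwise_within by blast
    then show ?thesis by (simp only: frechet_derivative_works)
  qed
  define N1 where "N1 = {x. x \<notin> N0 \<and> \<not> inj (frechet_derivative prox (at x))}"
  have im0: "negligible (prox ` N0)"
    using N0 prox_lipschitz
    by (intro negligible_locally_Lipschitz_image)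
       (auto intro!: exI[of _ UNIV] exI[of _ "1::real"])
  have im1: "negligible (prox ` N1)"
  proof (rule baby_Sard)
    fix x assume x: "x \<in> N1"
    then have D: "(prox has_derivative frechet_derivative prox (at x)) (at x)"
      using diff by (simp add: N1_def)
    then show "(prox has_derivative frechet_derivative prox (at x)) (at x within N1)"
      by (rule has_derivative_at_withinI)
    have "linear (frechet_derivative prox (at x))" using D has_derivative_linear by blast
    then have "frechet_derivative prox (at x) = (*v) (matrix (frechet_derivative prox (at x)))"
      by (intro ext) (simp add: matrix_works)
    then have "\<not> inj ((*v) (matrix (frechet_derivative prox (at x))))"
      using x by (simp add: N1_def)
    then show "rank (matrix (frechet_derivative prox (at x))) < CARD('n)"
      by (simp add: less_rank_noninjective)
  qed simp
  \<comment> \<open>As z = \<open>prox (z + T z)\<close>, a point outside both images has its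
    argument \<open>z + T z\<close> outside both bad sets.\<close>
  have "\<exists>p S. quadratic_expansion h z p S" if z: "z \<notin> prox ` N0 \<union> prox ` N1" for z
  proof -
    have 0: "z + T z \<notin> N0" using z imageI[of "z + T z" N0 prox] by auto
    have 1: "z + T z \<notin> N1" using z imageI[of "z + T z" N1 prox] by auto
    have "inj (frechet_derivative prox (at (z + T z)))" using 0 1 by (simp add: N1_def)
    from subgradient_has_derivative[OF diff[OF 0] this] obtain S where "(T has_derivative S) (at z)" ..
    from quadratic_expansion_of_derivative[OF this] show ?thesis by (intro exI)
  qed
  then have "{z. \<not> (\<exists>p S. quadratic_expansion h z p S)} \<subseteq> prox ` N0 \<union> prox ` N1" by blast
  then show ?thesis by (rule negligible_subset[rotated]) (simp add: im0 im1)
qed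

section \<open>Jensen's lemma and sup-convolutions\<close>

lemma negligible_Times:
  fixes A :: "'a::euclidean_space set" and B :: "'b::euclidean_space set"
  assumes "negligible A \<or> negligible B"
  shows "negligible (A \<times> B)"
proof -
  \<comment> \<open>A Borel null superset is taken first, since the product formula for measures is
    applied to Borel sets.\<close>
  have null: "\<exists>N. N \<in> null_sets lborel \<and> S \<subseteq> N" if "negligible S" for S :: "'c::euclidean_space set"
    using that null_sets_completion_iff2[of S lborel] by (auto simp: negligible_iff_null_sets)
  have prod: "negligible (N \<times> N')" if N: "N \<in> sets lborel" "N' \<in> sets lborel"
      and 0: "emeasure lborel N = 0 \<or> emeasure lborel N' = 0" for N :: "'a set" and N' :: "'b set"
  proof -
    have "emeasure (lborel \<Otimes>\<^sub>M lborel) (N \<times> N') = emeasure lborel N * emeasure lborel N'"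
      by (rule lborel.emeasure_pair_measure_Times[OF N])
    then have "N \<times> N' \<in> null_sets (lborel \<Otimes>\<^sub>M lborel)"
      using N 0 by (auto simp: null_sets_def)
    then have "N \<times> N' \<in> null_sets lborel" by (simp only: lborel_prod)
    then show ?thesis by (simp add: negligible_iff_null_sets null_sets_completionI)
  qed
  from assms show ?thesis
  proof
    assume "negligible A"
    from null[OF this] obtain N where "N \<in> null_sets lborel" "A \<subseteq> N" by blast
    then show ?thesis
      by (intro negligible_subset[OF prod[of N UNIV]]) (auto simp: null_sets_def)
  next
    assume "negligible B"
    from null[OF this] obtain N where "N \<in> null_sets lborel" "B \<subseteq> N" by blast
    then show ?thesis
      by (intro negligible_subset[OF prod[of UNIV N]]) (auto simp: null_sets_def)
  qed
qed

text \<open>Jensen's lemma: a maximum point of \<open>F - q\<close> determines \<open>q\<close>, and does so in a Lipschitz way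
  because \<open>F\<close> is squeezed there between paraboloids. So the maximum points for a whole ball of slopes
  cannot all lie in a null set.\<close>

lemma jensen_perturbed_maximum:
  fixes F :: "'b::euclidean_space \<Rightarrow> real"
  assumes cont: "continuous_on UNIV F" and pos: "0 < \<eta>" "0 < \<rho>" and C: "0 \<le> C"
    and max: "\<And>z. F z \<le> F zh - \<eta> * (norm (z - zh))\<^sup>2"
    and low: "\<And>z. norm (z - zh) < \<rho> \<Longrightarrow> \<exists>s. \<forall>h. F z + s \<bullet> h - C / 2 * (norm h)\<^sup>2 \<le> F (z + h)"
    and N: "negligible N"
  shows "\<exists>q z. z \<notin> N \<and> norm (z - zh) < \<rho> \<and> norm q < \<eta> * \<rho> \<and> (\<forall>h. F (z + h) \<le> F z + q \<bullet> h)"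
proof (rule ccontr)
  assume contr: "\<not> ?thesis"
  define P where "P = (\<lambda>q z. norm (z - zh) < \<rho> \<and> (\<forall>h. F (z + h) \<le> F z + q \<bullet> h))"
  have ex: "\<exists>z. P q z" if q: "q \<in> ball 0 (\<eta> * \<rho>)" for q
  proof -
    \<comment> \<open>At distance at least \<open>r\<close> from \<open>zh\<close> the strictness
      \<eta> d^2 of the maximum beats the tilt |q| d, and r < \<rho>.\<close>
    define r where "r = norm q / \<eta>"
    have r: "0 \<le> r" "r < \<rho>" "norm q = \<eta> * r" using pos q by (auto simp: r_def field_simps)
    define e where "e = (\<lambda>z. F z - q \<bullet> (z - zh))"
    have "continuous_on (cball zh r) e"
      unfolding e_def by (intro continuous_intros continuous_on_subset[OF cont]) auto
    then obtain z where z: "z \<in> cball zh r" "\<And>y. y \<in> cball zh r \<Longrightarrow> e y \<le> e z"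
      using continuous_attains_sup[OF compact_cball, of zh r e] r(1) by auto
    have "e y \<le> e z" for y
    proof (cases "y \<in> cball zh r")
      case False
      then have y: "r \<le> norm (y - zh)" by (simp add: dist_norm norm_minus_commute)
      have "e y \<le> F zh - \<eta> * (norm (y - zh))\<^sup>2 + norm q * norm (y - zh)"
        using max[of y] Cauchy_Schwarz_ineq2[of q "y - zh"] by (simp add: e_def)
      also have "\<dots> = F zh - \<eta> * norm (y - zh) * (norm (y - zh) - r)"
        using r(3) by (simp add: power2_eq_square algebra_simps)
      also have "\<dots> \<le> F zh" using y pos by simp
      also have "\<dots> = e zh" by (simp add: e_def)
      also have "\<dots> \<le> e z" using r(1) by (intro z(2)) simp
      finally show ?thesis .
    qed (use z in blast)
    then have "F (z + h) \<le> F z + q \<bullet> h" for h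
      using \<open>\<And>y. e y \<le> e z\<close>[of "z + h"] by (simp add: e_def inner_diff_right inner_add_right)
    moreover have "norm (z - zh) < \<rho>"
      using z(1) r(2) by (simp add: dist_norm norm_minus_commute)
    ultimately show ?thesis by (auto simp: P_def)
  qed
  define Z where "Z = {z. \<exists>q \<in> ball 0 (\<eta> * \<rho>). P q z}"
  have ZN: "Z \<subseteq> N" using contr by (force simp: Z_def P_def)
  obtain s where s: "\<And>z h. norm (z - zh) < \<rho> \<Longrightarrow> F z + s z \<bullet> h - C / 2 * (norm h)\<^sup>2 \<le> F (z + h)"
  proof -
    have "\<forall>z. \<exists>s. norm (z - zh) < \<rho> \<longrightarrow> (\<forall>h. F z + s \<bullet> h - C / 2 * (norm h)\<^sup>2 \<le> F (z + h))"
      using low by auto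
    from choice[OF this] show ?thesis using that by auto
  qed
  \<comment> \<open>A plane of slope \<open>q\<close> above and a paraboloid with slope
    \<open>s z\<close> below meet at \<open>z\<close>; a short step in the direction
    \<open>s z - q\<close> would contradict two different slopes.\<close>
  have sq: "s z = q" if "P q z" for q z
  proof (rule ccontr)
    assume ne: "s z \<noteq> q"
    define t where "t = 1 / (\<bar>C\<bar> + 1)"
    have t: "t > 0" "C / 2 * t < 1" by (auto simp: t_def field_simps)
    define w where "w = s z - q"
    have "F z + s z \<bullet> (t *\<^sub>R w) - C / 2 * (norm (t *\<^sub>R w))\<^sup>2 \<le> F (z + t *\<^sub>R w)"
      using that by (intro s) (simp add: P_def)
    moreover have "F (z + t *\<^sub>R w) \<le> F z + q \<bullet> (t *\<^sub>R w)" using that unfolding P_def by blast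
    ultimately have "s z \<bullet> (t *\<^sub>R w) - C / 2 * (norm (t *\<^sub>R w))\<^sup>2 \<le> q \<bullet> (t *\<^sub>R w)"
      by linarith
    moreover have "s z \<bullet> (t *\<^sub>R w) - q \<bullet> (t *\<^sub>R w) = t * (norm w)\<^sup>2"
      by (simp add: w_def power2_norm_eq_inner inner_diff_left inner_diff_right algebra_simps)
    moreover have "C / 2 * (norm (t *\<^sub>R w))\<^sup>2 = t * (norm w)\<^sup>2 * (C / 2 * t)"
      by (simp add: power_mult_distrib power2_eq_square)
    ultimately have "t * (norm w)\<^sup>2 \<le> t * (norm w)\<^sup>2 * (C / 2 * t)"
      by linarith
    then have "t * (norm (s z - q))\<^sup>2 \<le> t * (norm (s z - q))\<^sup>2 * (C / 2 * t)"
      by (simp only: w_def)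
    moreover have "t * (norm (s z - q))\<^sup>2 > 0" using t ne by simp
    ultimately show False
      using mult_strict_left_mono[OF t(2), of "t * (norm (s z - q))\<^sup>2"] by linarith
  qed
  \<comment> \<open>The paraboloid below at \<open>z2\<close> is compared with the plane above at
    \<open>z1\<close>, at a point displaced from \<open>z2\<close> by the distance |z2 - z1| in the
    direction of the difference of slopes.\<close>
  have lip: "norm (s z2 - s z1) \<le> C * norm (z2 - z1)" if Z: "z1 \<in> Z" "z2 \<in> Z" for z1 z2
  proof (cases "z1 = z2 \<or> s z1 = s z2")
    case False
    have P: "P (s z1) z1" "P (s z2) z2" using Z sq by (auto simp: Z_def)
    define d where "d = norm (z2 - z1)"
    define h where "h = (d / norm (s z2 - s z1)) *\<^sub>R (s z2 - s z1)"
    have d: "d > 0" using False by (auto simp: d_def)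
    have n: "norm (s z2 - s z1) > 0" using False by auto
    have h: "norm h = d" "(s z2 - s z1) \<bullet> h = d * norm (s z2 - s z1)"
      using n d by (simp_all add: h_def dot_square_norm power2_eq_square)
    have "F z2 + s z2 \<bullet> h - C / 2 * d\<^sup>2 \<le> F (z2 + h)"
      using s[of z2 h] P(2) by (simp add: P_def h(1))
    also have "F (z2 + h) \<le> F z1 + s z1 \<bullet> (z2 - z1 + h)"
    proof -
      have "F (z1 + (z2 - z1 + h)) \<le> F z1 + s z1 \<bullet> (z2 - z1 + h)"
        using P(1) unfolding P_def by (elim conjE) (rule spec)
      then show ?thesis by simp
    qed
    finally have 1: "F z2 + s z2 \<bullet> h - C / 2 * d\<^sup>2 \<le> F z1 + s z1 \<bullet> (z2 - z1) + s z1 \<bullet> h"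
      by (simp add: inner_add_right)
    have "F z1 + s z1 \<bullet> (z2 - z1) - C / 2 * d\<^sup>2 \<le> F z2"
      using s[of z1 "z2 - z1"] P(1) by (simp add: P_def d_def)
    with 1 have "(s z2 - s z1) \<bullet> h \<le> C * d\<^sup>2" by (simp add: inner_diff_left)
    then have "d * norm (s z2 - s z1) \<le> d * (C * d)" by (simp add: h(2) power2_eq_square mult_ac)
    then have "norm (s z2 - s z1) \<le> C * d" using d by (rule mult_left_le_imp_le)
    then show ?thesis by (simp only: d_def)
  qed (use C in auto)
  have "negligible (s ` Z)"
  proof (rule negligible_locally_Lipschitz_image)
    show "negligible Z" by (rule negligible_subset[OF N ZN])
    show "\<exists>T B. open T \<and> x \<in> T \<and> (\<forall>y\<in>Z \<inter> T. norm (s y - s x) \<le> B * norm (y - x))" if "x \<in> Z" for x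
      using lip[OF that] by (intro exI[of _ UNIV] exI[of _ C]) auto
  qed simp
  moreover have "ball 0 (\<eta> * \<rho>) \<subseteq> s ` Z"
  proof
    fix q :: 'b assume q: "q \<in> ball 0 (\<eta> * \<rho>)"
    from ex[OF q] obtain z where z: "P q z" ..
    then have "z \<in> Z" using q by (auto simp: Z_def)
    then show "q \<in> s ` Z" using sq[OF z] by (intro image_eqI[of _ _ z]) auto
  qed
  ultimately have "negligible (ball (0::'b) (\<eta> * \<rho>))" using negligible_subset by blast
  moreover have "ball (0::'b) (\<eta> * \<rho>) \<noteq> {}" using mult_pos_pos[OF pos] by simp
  ultimately show False using open_not_negligible[OF open_ball] by blast
qed

text \<open>The maximum is attained for bounded continuous \<open>u\<close> and \<open>e > 0\<close>; otherwise the choice is arbitrary.\<close>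

definition supconv_arg :: "real \<Rightarrow> ('a::euclidean_space \<Rightarrow> real) \<Rightarrow> 'a \<Rightarrow> 'a" where
  "supconv_arg e u x = (SOME \<xi>. \<forall>\<xi>'. u \<xi>' - (norm (x - \<xi>'))\<^sup>2 / (2 * e) \<le> u \<xi> - (norm (x - \<xi>))\<^sup>2 / (2 * e))"

definition supconv :: "real \<Rightarrow> ('a::euclidean_space \<Rightarrow> real) \<Rightarrow> 'a \<Rightarrow> real" where
  "supconv e u x = u (supconv_arg e u x) - (norm (x - supconv_arg e u x))\<^sup>2 / (2 * e)"

section \<open>Sup-convolutions of bounded continuous functions\<close>

locale bounded_continuous =
  fixes u :: "'a::euclidean_space \<Rightarrow> real" and M e :: real
  assumes cont: "continuous_on UNIV u" and bound: "\<bar>u x\<bar> \<le> M" and e: "0 < e"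
begin

abbreviation "V \<equiv> supconv e u"
abbreviation "\<xi> \<equiv> supconv_arg e u"

lemma supconv_ge: "u y - (norm (x - y))\<^sup>2 / (2 * e) \<le> V x"
proof -
  define f where "f = (\<lambda>y. u y - (norm (x - y))\<^sup>2 / (2 * e))"
  have M0: "M \<ge> 0" using bound[of x] by linarith
  \<comment> \<open>Outside this radius the penalty exceeds \<open>2 * M\<close>, the largest
    possible gain in \<open>u\<close>.\<close>
  define r where "r = sqrt (4 * M * e)"
  have r: "r \<ge> 0" "r\<^sup>2 = 4 * M * e" using M0 e by (auto simp: r_def)
  have "continuous_on (cball x r) f"
    unfolding f_def by (intro continuous_intros continuous_on_subset[OF cont]) (use e in auto)
  then obtain z where z: "z \<in> cball x r" "\<And>y. y \<in> cball x r \<Longrightarrow> f y \<le> f z"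
    using continuous_attains_sup[OF compact_cball, of x r f] r(1) by auto
  have "f y \<le> f z" for y
  proof (cases "y \<in> cball x r")
    case False
    then have "r < norm (x - y)" by (simp add: dist_norm)
    then have "r\<^sup>2 \<le> (norm (x - y))\<^sup>2" using r(1) by (intro power_mono) auto
    then have "2 * M \<le> (norm (x - y))\<^sup>2 / (2 * e)" using e r(2) by (simp add: field_simps)
    then have "f y \<le> - M" using bound[of y] by (simp add: f_def)
    also have "\<dots> \<le> f x" using bound[of x] by (simp add: f_def)
    also have "\<dots> \<le> f z" using r(1) by (intro z(2)) simp
    finally show ?thesis .
  qed (use z in blast)
  then have "\<exists>z. \<forall>y. u y - (norm (x - y))\<^sup>2 / (2 * e) \<le> u z - (norm (x - z))\<^sup>2 / (2 * e)"
    by (auto simp: f_def)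
  from someI_ex[OF this] show ?thesis
    unfolding supconv_def supconv_arg_def by blast
qed

lemma supconv_lower: "u x \<le> V x"
  using supconv_ge[of x x] by simp

lemma supconv_upper: "V x \<le> u (\<xi> x)"
  using e by (simp add: supconv_def)

lemma abs_supconv_le: "\<bar>V x\<bar> \<le> M"
  using supconv_lower[of x] supconv_upper[of x] bound[of x] bound[of "\<xi> x"] by linarith

lemma supconv_arg_near: "(norm (x - \<xi> x))\<^sup>2 \<le> 4 * M * e"
proof -
  have "(norm (x - \<xi> x))\<^sup>2 / (2 * e) \<le> 2 * M"
    using supconv_lower[of x] bound[of x] bound[of "\<xi> x"] by (simp add: supconv_def)
  then show ?thesis using e by (simp add: field_simps)
qed

text \<open>Moving \<open>x\<close> and the attaining point by the same vector leaves the penalty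
  unchanged. Since \<open>k\<close> is arbitrary, this transfers jets and also the global increments
  in the integral term from the convolution back to \<open>u\<close>.\<close>

lemma supconv_shift: "u (\<xi> x + k) - u (\<xi> x) \<le> V (x + k) - V x"
  using supconv_ge[of "\<xi> x + k" "x + k"] by (simp add: supconv_def)

lemma supconv_periodic:
  assumes per: "\<And>x. u (x + h) = u x"
  shows "V (x + h) = V x"
proof (rule antisym)
  show "V x \<le> V (x + h)"
    using supconv_ge[of "\<xi> x + h" "x + h"] by (simp add: per supconv_def)
  have "u (\<xi> (x + h) - h) = u (\<xi> (x + h))" using per[of "\<xi> (x + h) - h"] by simp
  then show "V (x + h) \<le> V x"
    using supconv_ge[of "\<xi> (x + h) - h" x] by (simp add: supconv_def algebra_simps)
qed

text \<open>Expanding the square exhibits e V(x) + |x|^2 / 2 as a supremum of affine functions of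
  \<open>x\<close> whose slopes are the competing points; so the attaining point is a
  subgradient.\<close>

lemma supconv_subgradient:
  "(e * V x + (norm x)\<^sup>2 / 2) + \<xi> x \<bullet> (y - x) \<le> e * V y + (norm y)\<^sup>2 / 2"
proof -
  have "e * (u (\<xi> x) - (norm (y - \<xi> x))\<^sup>2 / (2 * e)) \<le> e * V y"
    using supconv_ge e by (intro mult_left_mono) auto
  then have "e * u (\<xi> x) - (norm (y - \<xi> x))\<^sup>2 / 2 \<le> e * V y"
    using e by (simp add: right_diff_distrib)
  moreover have "e * V x = e * u (\<xi> x) - (norm (x - \<xi> x))\<^sup>2 / 2"
    using e by (simp add: supconv_def field_simps)
  moreover have "\<xi> x \<bullet> (y - x) = ((norm (x - \<xi> x))\<^sup>2 - (norm x)\<^sup>2 - (norm (y - \<xi> x))\<^sup>2 + (norm y)\<^sup>2) / 2"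
    unfolding power2_norm_eq_inner
    by (simp add: inner_diff_left inner_diff_right inner_commute field_simps)
  ultimately show ?thesis by (simp add: field_simps)
qed

text \<open>Semiconvexity with constant 1/e, in the form of the paraboloid from below that Jensen's
  lemma requires.\<close>

lemma supconv_lower_paraboloid:
  "V x + ((\<xi> x - x) /\<^sub>R e) \<bullet> k - 1 / (2 * e) * (norm k)\<^sup>2 \<le> V (x + k)"
proof -
  have "e * V x + (\<xi> x - x) \<bullet> k - (norm k)\<^sup>2 / 2 \<le> e * V (x + k)"
  proof -
    have "(norm (x + k))\<^sup>2 = (norm x)\<^sup>2 + 2 * (x \<bullet> k) + (norm k)\<^sup>2"
      unfolding power2_norm_eq_inner by (simp add: inner_add_left inner_add_right inner_commute)
    then show ?thesis using supconv_subgradient[of x "x + k"] by (simp add: inner_diff_left add_divide_distrib)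
  qed
  then have "(e * V x + (\<xi> x - x) \<bullet> k - (norm k)\<^sup>2 / 2) / e \<le> V (x + k)"
    using e by (simp add: field_simps)
  moreover have "(e * a + b - c / 2) / e = a + inverse e * b - 1 / (2 * e) * c" for a b c :: real
    using e by (simp add: field_simps)
  from this[of "V x" "(\<xi> x - x) \<bullet> k" "(norm k)\<^sup>2"]
  have "(e * V x + (\<xi> x - x) \<bullet> k - (norm k)\<^sup>2 / 2) / e
      = V x + ((\<xi> x - x) /\<^sub>R e) \<bullet> k - 1 / (2 * e) * (norm k)\<^sup>2"
    by (simp only: inner_scaleR_left)
  ultimately show ?thesis by simp
qed

lemma supconv_continuous: "continuous_on UNIV V"
proof -
  interpret subgradient_selection "\<lambda>x. e * V x + (norm x)\<^sup>2 / 2" \<xi>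
    by unfold_locales (rule supconv_subgradient)
  have "continuous_on UNIV (\<lambda>x. ((e * V x + (norm x)\<^sup>2 / 2) - (norm x)\<^sup>2 / 2) / e)"
    by (intro continuous_intros continuous) (use e in auto)
  then show ?thesis using e by simp
qed

lemma supconv_expansion:
  assumes "quadratic_expansion (\<lambda>x. e * V x + (norm x)\<^sup>2 / 2) z p S"
  shows "quadratic_expansion V z ((p - z) /\<^sub>R e) (\<lambda>k. (S k - k) /\<^sub>R e)"
  unfolding quadratic_expansion_def
proof (intro conjI allI impI)
  have lin: "linear S" using assms by (simp add: quadratic_expansion_def)
  then show "linear (\<lambda>k. (S k - k) /\<^sub>R e)"
    by (intro linear_compose_scale_right linear_compose_sub linear_id[unfolded id_def])
  fix \<epsilon> :: real assume "\<epsilon> > 0"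
  then have "\<epsilon> * e > 0" using e by simp
  then obtain d where d: "d > 0" "\<And>k. norm k < d \<Longrightarrow>
     \<bar>(e * V (z + k) + (norm (z + k))\<^sup>2 / 2) - (e * V z + (norm z)\<^sup>2 / 2) - p \<bullet> k - (S k \<bullet> k) / 2\<bar> \<le> \<epsilon> * e * (norm k)\<^sup>2"
    using assms unfolding quadratic_expansion_def by blast
  have "\<bar>V (z + k) - V z - ((p - z) /\<^sub>R e) \<bullet> k - (((S k - k) /\<^sub>R e) \<bullet> k) / 2\<bar> \<le> \<epsilon> * (norm k)\<^sup>2"
    if "norm k < d" for k
  proof -
    have "e * (V (z + k) - V z - ((p - z) /\<^sub>R e) \<bullet> k - (((S k - k) /\<^sub>R e) \<bullet> k) / 2)
      = (e * V (z + k) + (norm (z + k))\<^sup>2 / 2) - (e * V z + (norm z)\<^sup>2 / 2) - p \<bullet> k - (S k \<bullet> k) / 2"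
    proof -
      have 1: "e * ((w /\<^sub>R e) \<bullet> k) = w \<bullet> k" for w using e by simp
      have 2: "(norm (z + k))\<^sup>2 = (norm z)\<^sup>2 + 2 * (z \<bullet> k) + (norm k)\<^sup>2"
        unfolding power2_norm_eq_inner by (simp add: inner_add_left inner_add_right inner_commute)
      have "e * (a - b - c - d / 2) = e * a - e * b - e * c - (e * d) / 2" for a b c d :: real
        by (simp add: algebra_simps)
      then show ?thesis
        by (simp only: 1 2) (simp add: inner_diff_left power2_norm_eq_inner field_simps)
    qed
    with d(2)[OF that] have "\<bar>e * (V (z + k) - V z - ((p - z) /\<^sub>R e) \<bullet> k - (((S k - k) /\<^sub>R e) \<bullet> k) / 2)\<bar>
       \<le> e * (\<epsilon> * (norm k)\<^sup>2)" by (simp add: mult_ac)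
    then show ?thesis using e by (simp add: abs_mult del: right_diff_distrib)
  qed
  then show "\<exists>d>0. \<forall>k. norm k < d \<longrightarrow>
     \<bar>V (z + k) - V z - ((p - z) /\<^sub>R e) \<bullet> k - (((S k - k) /\<^sub>R e) \<bullet> k) / 2\<bar> \<le> \<epsilon> * (norm k)\<^sup>2"
    using d(1) by blast
qed

end

lemma supconv_twice_differentiable_ae:
  fixes u :: "real ^ 'n::{finite,wellorder} \<Rightarrow> real"
  assumes "bounded_continuous u M e"
  shows "negligible {z. \<not> (\<exists>p S. quadratic_expansion (supconv e u) z p S)}"
proof (rule negligible_subset)
  interpret bounded_continuous u M e by fact
  show "negligible {z. \<not> (\<exists>p S. quadratic_expansion (\<lambda>x. e * supconv e u x + (norm x)\<^sup>2 / 2) z p S)}"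
    by (rule alexandrov[OF supconv_subgradient])
  show "{z. \<not> (\<exists>p S. quadratic_expansion (supconv e u) z p S)} \<subseteq>
      {z. \<not> (\<exists>p S. quadratic_expansion (\<lambda>x. e * supconv e u x + (norm x)\<^sup>2 / 2) z p S)}"
    using supconv_expansion by blast
qed

section \<open>Test function and nonlocal term\<close>

lemma powr_le_tangent:
  fixes t \<alpha> :: real
  assumes "0 \<le> t" "0 < \<alpha>" "\<alpha> < 1"
  shows "t powr \<alpha> \<le> 1 + \<alpha> * (t - 1)"
proof (cases "t = 0")
  case False
  then show ?thesis
    using Youngs_inequality_0[of \<alpha> "1 - \<alpha>" t 1] assms by (simp add: algebra_simps)
qed (use assms in simp)

lemma powr_norm_scale:
  fixes a b :: "'a::real_normed_vector"
  assumes "a \<noteq> 0"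
  shows "norm b powr \<theta> = norm a powr \<theta> * (norm b / norm a) powr \<theta>"
  using assms by (simp add: powr_divide)

lemma powr_norm_minus_two:
  fixes a :: "'a::real_normed_vector"
  assumes "a \<noteq> 0"
  shows "norm a powr (\<theta> - 2) = norm a powr \<theta> / (norm a)\<^sup>2"
  using assms by (simp add: powr_diff)

text \<open>|a + h|^\<theta> is the concave power \<theta>/2 of |a + h|^2, which lies below its
  tangent at |a|^2. The bound therefore holds for every \<open>h\<close>, even where a + h =
  0.\<close>

lemma powr_norm_upper_paraboloid:
  fixes a h :: "'a::real_inner"
  assumes "a \<noteq> 0" "0 < \<theta>" "\<theta> < 1"
  shows "norm (a + h) powr \<theta> \<le> norm a powr \<theta> + \<theta> * norm a powr (\<theta> - 2) * (a \<bullet> h + (norm h)\<^sup>2 / 2)"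
proof -
  define r where "r = norm a"
  have r: "r > 0" using assms by (simp add: r_def)
  define t where "t = (norm (a + h))\<^sup>2 / r\<^sup>2"
  have t: "t - 1 = 2 * (a \<bullet> h + (norm h)\<^sup>2 / 2) / r\<^sup>2"
  proof -
    have "(norm (a + h))\<^sup>2 = r\<^sup>2 + 2 * (a \<bullet> h + (norm h)\<^sup>2 / 2)"
      unfolding power2_norm_eq_inner r_def
      by (simp add: inner_add_left inner_add_right inner_commute)
    then show ?thesis using r by (simp add: t_def add_divide_distrib)
  qed
  have "(norm (a + h) / norm a) powr \<theta> = t powr (\<theta> / 2)"
  proof -
    have "t = (norm (a + h) / norm a) powr 2" using r by (simp add: t_def r_def power_divide)
    then show ?thesis by (simp only: powr_powr) simp
  qed
  also have "\<dots> \<le> 1 + \<theta> / 2 * (t - 1)"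
    using assms by (intro powr_le_tangent) (auto simp: t_def)
  finally have "norm a powr \<theta> * (norm (a + h) / norm a) powr \<theta> \<le> norm a powr \<theta> * (1 + \<theta> / 2 * (t - 1))"
    by (intro mult_left_mono) auto
  also have "\<dots> = norm a powr \<theta> + \<theta> * norm a powr (\<theta> - 2) * (a \<bullet> h + (norm h)\<^sup>2 / 2)"
    unfolding t powr_norm_minus_two[OF assms(1)] by (simp add: r_def distrib_left add_divide_distrib mult_ac)
  finally show ?thesis by (simp only: powr_norm_scale[OF assms(1), symmetric])
qed

text \<open>Half of the amount by which t^\<theta> lies below its tangent at t = 1 when evaluated at
  t = 3/2; part of the other half pays for replacing the point a/2 by a ball around it.\<close>

definition concavity_gap :: "real \<Rightarrow> real" where
  "concavity_gap \<theta> = (1 + \<theta> / 2 - (3/2) powr \<theta>) / 2"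

text \<open>By the mean value theorem the increment from 1 to 3/2 uses the derivative at a point
  beyond 1, which is smaller than \<theta>.\<close>

lemma concavity_gap_pos:
  assumes "0 < \<theta>" "\<theta> < 1"
  shows "0 < concavity_gap \<theta>"
proof -
  have "\<exists>z::real. 1 < z \<and> z < 3/2 \<and> (3/2) powr \<theta> - 1 powr \<theta> = (3/2 - 1) * (\<theta> * z powr (\<theta> - 1))"
    by (rule MVT2) (auto intro!: has_real_derivative_powr)
  then obtain z :: real where z: "1 < z" "(3/2) powr \<theta> - 1 = 1/2 * (\<theta> * z powr (\<theta> - 1))" by auto
  have "z powr (\<theta> - 1) < 1" using z(1) assms by (simp add: powr_less_one)
  then have "\<theta> * z powr (\<theta> - 1) < \<theta>" using assms by simp
  then show ?thesis using z(2) by (simp add: concavity_gap_def)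
qed

text \<open>A ball around \<open>a/2\<close> replaces the usual cone around \<open>a\<close>: its mass under the Levy density can be
  bounded below without rotation invariance.\<close>

lemma powr_norm_strict_concave:
  fixes a z :: "'a::real_inner"
  assumes a: "a \<noteq> 0" and \<theta>: "0 < \<theta>" "\<theta> < 1"
    and \<kappa>: "0 < \<kappa>" "\<kappa> \<le> concavity_gap \<theta> / 4" "\<kappa> \<le> 1/4"
    and z: "norm (z - a /\<^sub>R 2) \<le> \<kappa> * norm a"
  shows "(norm (a + z) powr \<theta> - norm a powr \<theta> - \<theta> * norm a powr (\<theta> - 2) * (a \<bullet> z)) +
         (norm (a - z) powr \<theta> - norm a powr \<theta> + \<theta> * norm a powr (\<theta> - 2) * (a \<bullet> z))
      \<le> - concavity_gap \<theta> * norm a powr \<theta>"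
proof -
  define r where "r = norm a"
  have r: "r > 0" using a by (simp add: r_def)
  define e where "e = z - a /\<^sub>R 2"
  have e: "norm e \<le> \<kappa> * r" using z by (simp add: e_def r_def)
  define b where "b = a /\<^sub>R 2"
  have ab: "a = b + b" by (simp add: b_def flip: scaleR_add_left)
  have nb: "norm b = r / 2" by (simp add: b_def r_def)
  have b3: "3 *\<^sub>R b = b + b + b" using scaleR_left_distrib[of 2 1 b] by (simp add: scaleR_2)
  have "a + z = 3 *\<^sub>R b + e" "a - z = b - e"
    unfolding b3 by (simp_all add: e_def ab[symmetric] b_def[symmetric]) (simp_all add: ab)
  then have "norm (a + z) \<le> 3/2 * r + \<kappa> * r" "norm (a - z) \<le> 1/2 * r + \<kappa> * r"
    using norm_triangle_ineq[of "3 *\<^sub>R b" e] norm_triangle_ineq4[of b e] e nb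
    by auto
  then have n: "norm (a + z) / r \<le> 3/2 + \<kappa>" "norm (a - z) / r \<le> 1/2 + \<kappa>"
    using r by (auto simp: divide_le_eq algebra_simps)
  have "(norm (a + z) / r) powr \<theta> \<le> (3/2 + \<kappa>) powr \<theta>"
    using n(1) r \<theta> by (intro powr_mono2) auto
  also have "\<dots> = (3/2) powr \<theta> * (1 + \<kappa> * (2/3)) powr \<theta>"
    using \<kappa> by (simp add: powr_mult[symmetric] algebra_simps)
  also have "\<dots> \<le> (3/2) powr \<theta> * (1 + \<theta> * (\<kappa> * (2/3)))"
    using powr_le_tangent[of "1 + \<kappa> * (2/3)" \<theta>] \<kappa> \<theta> by (intro mult_left_mono) auto
  also have "\<dots> \<le> (3/2) powr \<theta> + \<kappa>"
  proof -
    have "(3/2::real) powr \<theta> \<le> (3/2) powr 1" using \<theta> by (intro powr_mono) auto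
    then have "\<theta> * (3/2) powr \<theta> \<le> 1 * (3/2)" using \<theta> by (intro mult_mono) auto
    then have "\<kappa> * (2/3) * (\<theta> * (3/2) powr \<theta>) \<le> \<kappa> * (2/3) * (3/2)"
      using \<kappa> by (intro mult_left_mono) auto
    then show ?thesis by (simp add: algebra_simps)
  qed
  finally have 1: "(norm (a + z) / r) powr \<theta> \<le> (3/2) powr \<theta> + \<kappa>" .
  have "(norm (a - z) / r) powr \<theta> \<le> (1/2 + \<kappa>) powr \<theta>"
    using n(2) r \<theta> by (intro powr_mono2) auto
  also have "\<dots> \<le> 1 + \<theta> * (\<kappa> - 1/2)"
    using powr_le_tangent[of "1/2 + \<kappa>" \<theta>] \<kappa> \<theta> by simp
  also have "\<dots> \<le> 1 + \<kappa> - \<theta> / 2" using \<theta> \<kappa> by (simp add: algebra_simps mult_left_le_one_le)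
  finally have 2: "(norm (a - z) / r) powr \<theta> \<le> 1 + \<kappa> - \<theta> / 2" .
  \<comment> \<open>With \<kappa> = 0 the left side is \<open>- 2 * concavity_gap \<theta>\<close>;
    each of the two \<kappa> costs at most a quarter of the gap.\<close>
  have gap: "(3/2) powr \<theta> + \<kappa> + (1 + \<kappa> - \<theta> / 2) - 2 \<le> - concavity_gap \<theta>"
    using \<kappa> by (simp add: concavity_gap_def field_simps)
  have "norm (a + z) powr \<theta> + norm (a - z) powr \<theta> - 2 * r powr \<theta>
    = r powr \<theta> * ((norm (a + z) / r) powr \<theta> + (norm (a - z) / r) powr \<theta> - 2)"
    using powr_norm_scale[OF a, of "a + z" \<theta>] powr_norm_scale[OF a, of "a - z" \<theta>]
    by (simp add: r_def algebra_simps)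
  also have "\<dots> \<le> r powr \<theta> * (- concavity_gap \<theta>)"
    using 1 2 gap by (intro mult_left_mono) auto
  finally show ?thesis by (simp add: r_def mult.commute)
qed

section \<open>Estimates for the integral term\<close>

locale levy =
  fixes \<gamma> C1 C2 C3 :: real and c :: "real ^ 'n \<Rightarrow> real"
  assumes levy: "levy_density \<gamma> C1 C2 C3 c" and C2: "C2 > 0"
begin

lemma c_measurable [measurable]: "c \<in> borel_measurable lebesgue"
  and c_nonneg: "AE z in lebesgue. 0 \<le> c z"
  and c_int: "integrable lebesgue (\<lambda>z. min ((norm z)\<^sup>2) 1 * c z)"
  and c_int_le: "(LINT z|lebesgue. min ((norm z)\<^sup>2) 1 * c z) \<le> C1"
  and c_lower: "0 < norm z \<Longrightarrow> norm z \<le> 1 \<Longrightarrow> C2 / norm z powr (real CARD('n) + \<gamma>) \<le> \<bar>c z\<bar>"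
  using levy by (auto simp: levy_density_def)

lemma integrable_mult_c:
  assumes f: "f \<in> borel_measurable lebesgue" and b: "\<And>z. \<bar>f z\<bar> \<le> K * min ((norm z)\<^sup>2) 1"
  shows "integrable lebesgue (\<lambda>z. f z * c z)"
proof (rule Bochner_Integration.integrable_bound)
  show "integrable lebesgue (\<lambda>z. K * (min ((norm z)\<^sup>2) 1 * c z))"
    by (intro integrable_mult_right c_int)
  show "(\<lambda>z. f z * c z) \<in> borel_measurable lebesgue" using f by measurable
  show "AE z in lebesgue. norm (f z * c z) \<le> norm (K * (min ((norm z)\<^sup>2) 1 * c z))"
  proof (rule AE_I2)
    fix z
    have "\<bar>f z\<bar> \<le> \<bar>K * min ((norm z)\<^sup>2) 1\<bar>" using b[of z] by linarith
    then show "norm (f z * c z) \<le> norm (K * (min ((norm z)\<^sup>2) 1 * c z))"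
      by (simp add: abs_mult mult.assoc[symmetric] mult_right_mono)
  qed
qed

text \<open>The four integrals are merged into one, so that only pointwise bounds in
  \<open>z\<close> are required: a gain \<open>b\<close> on \<open>S\<close> and an error that the
  Levy condition integrates to at most \<open>s * C1\<close>. The factor 2 in the bound for the
  forms cancels the 1/2 in \<open>near_int\<close>.\<close>

lemma nonlocal_difference_le:
  fixes v :: "real ^ 'n \<Rightarrow> real" and X Y :: "real ^ 'n ^ 'n"
  assumes v: "continuous_on UNIV v" "\<And>x. \<bar>v x\<bar> \<le> M" and \<epsilon>: "0 < \<epsilon>" "\<epsilon> \<le> 1"
    and S: "S \<in> sets lebesgue" "\<And>z. z \<in> S \<Longrightarrow> \<epsilon> \<le> norm z"
    and XY: "\<And>z. (X *v z) \<bullet> z \<le> (Y *v z) \<bullet> z + 2 * s * (norm z)\<^sup>2"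
    and D: "\<And>z. (v (x + z) - v x - indicator {z. norm z \<le> 1} z * (z \<bullet> p))
        - (v (y + z) - v y - indicator {z. norm z \<le> 1} z * (z \<bullet> p')) \<le> s * min ((norm z)\<^sup>2) 1 - b * indicator S z"
    and s: "0 \<le> s"
  shows "near_int c \<epsilon> X + far_int c v \<epsilon> x p - near_int c \<epsilon> Y - far_int c v \<epsilon> y p'
      \<le> s * C1 - b * (LINT z:S|lebesgue. c z)"
proof -
  define m where "m = (\<lambda>z :: real ^ 'n. min ((norm z)\<^sup>2) 1)"
  define f where "f = (\<lambda>x p z. v (x + z) - v x - indicator {z. norm z \<le> 1} z * (z \<bullet> p))"
  have cm: "g \<in> borel_measurable lebesgue" if "continuous_on UNIV g" for g :: "real ^ 'n \<Rightarrow> real"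
    using borel_measurable_continuous_onI[OF that] by (simp add: measurable_completion)
  have ball[measurable]: "{z :: real ^ 'n. norm z \<le> 1} \<in> sets lebesgue" "{z :: real ^ 'n. norm z < \<epsilon>} \<in> sets lebesgue"
    "{z :: real ^ 'n. norm z \<ge> \<epsilon>} \<in> sets lebesgue"
    by (auto intro!: sets_completionI_sets borel_closed borel_open closed_Collect_le open_Collect_less
        continuous_intros simp del: sets_completion)
  note [measurable] = S(1)
  have quadm: "(\<lambda>z. (Z *v z) \<bullet> z) \<in> borel_measurable lebesgue" for Z :: "real ^ 'n ^ 'n"
    by (intro cm continuous_intros linear_continuous_on) (auto intro: matrix_vector_mul_bounded_linear)
  have fm: "f x p \<in> borel_measurable lebesgue" for x p
  proof -
    have [measurable]: "(\<lambda>z. v (x + z)) \<in> borel_measurable lebesgue" "(\<lambda>z. z \<bullet> p) \<in> borel_measurable lebesgue"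
      by (intro cm continuous_intros continuous_on_compose2[OF v(1)]; auto)+
    show ?thesis unfolding f_def by measurable
  qed
  have mpos: "0 \<le> m z" for z by (simp add: m_def)
  have near: "integrable lebesgue (\<lambda>z. indicator {z. norm z < \<epsilon>} z * (1/2 * ((Z *v z) \<bullet> z)) * c z)" for Z
  proof -
    obtain B where B: "\<And>z. norm (Z *v z) \<le> B * norm z" "B > 0"
      using linear_bounded_pos[OF matrix_vector_mul_linear, of Z] by blast
    show ?thesis
    proof (rule integrable_mult_c)
      show "(\<lambda>z. indicator {z. norm z < \<epsilon>} z * (1/2 * ((Z *v z) \<bullet> z))) \<in> borel_measurable lebesgue"
        using quadm[of Z] by measurable
      fix z :: "real ^ 'n"
      have "\<bar>(Z *v z) \<bullet> z\<bar> \<le> norm (Z *v z) * norm z" by (rule Cauchy_Schwarz_ineq2)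
      also have "\<dots> \<le> B * norm z * norm z" using B by (intro mult_right_mono) auto
      finally have *: "\<bar>(Z *v z) \<bullet> z\<bar> \<le> B * (norm z)\<^sup>2" by (simp add: power2_eq_square)
      show "\<bar>indicator {z. norm z < \<epsilon>} z * (1/2 * ((Z *v z) \<bullet> z))\<bar> \<le> B / 2 * min ((norm z)\<^sup>2) 1"
      proof (cases "norm z < \<epsilon>")
        case True
        then have "(norm z)\<^sup>2 \<le> 1\<^sup>2" using \<epsilon> by (intro power_mono) auto
        then show ?thesis using * True by simp
      qed (use B in simp)
    qed
  qed
  have far: "integrable lebesgue (\<lambda>z. indicator {z. norm z \<ge> \<epsilon>} z * f x p z * c z)" for x p
  proof (rule integrable_mult_c)
    show "(\<lambda>z. indicator {z. norm z \<ge> \<epsilon>} z * f x p z) \<in> borel_measurable lebesgue"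
      using fm[of x p] by measurable
    fix z :: "real ^ 'n"
    have M0: "M \<ge> 0" using v(2)[of 0] by linarith
    show "\<bar>indicator {z. norm z \<ge> \<epsilon>} z * f x p z\<bar> \<le> (2 * M + norm p) / \<epsilon>\<^sup>2 * min ((norm z)\<^sup>2) 1"
    proof (cases "\<epsilon> \<le> norm z")
      case True
      have "\<bar>indicator {z. norm z \<le> 1} z * (z \<bullet> p)\<bar> \<le> norm p"
      proof (cases "norm z \<le> 1")
        case True
        have "\<bar>z \<bullet> p\<bar> \<le> norm z * norm p" by (rule Cauchy_Schwarz_ineq2)
        also have "\<dots> \<le> 1 * norm p" using True by (intro mult_right_mono) auto
        finally show ?thesis using True by simp
      qed simp
      then have "\<bar>f x p z\<bar> \<le> 2 * M + norm p"
        using v(2)[of x] v(2)[of "x + z"] by (simp add: f_def)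
      also have "\<dots> = (2 * M + norm p) / \<epsilon>\<^sup>2 * \<epsilon>\<^sup>2" using \<epsilon> by simp
      also have "\<dots> \<le> (2 * M + norm p) / \<epsilon>\<^sup>2 * min ((norm z)\<^sup>2) 1"
        using True \<epsilon> M0 by (intro mult_left_mono) (auto simp: power_mono power_le_one)
      finally show ?thesis using True by simp
    qed (use M0 in simp)
  qed
  have Sint: "integrable lebesgue (\<lambda>z. b * (indicator S z * c z))"
  proof -
    have "integrable lebesgue (\<lambda>z. indicator S z * c z)"
    proof (rule integrable_mult_c)
      fix z :: "real ^ 'n"
      show "\<bar>indicator S z\<bar> \<le> 1 / \<epsilon>\<^sup>2 * min ((norm z)\<^sup>2) 1"
      proof (cases "z \<in> S")
        case True
        then have "1 / \<epsilon>\<^sup>2 * \<epsilon>\<^sup>2 \<le> 1 / \<epsilon>\<^sup>2 * min ((norm z)\<^sup>2) 1"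
          using S(2) \<epsilon> by (intro mult_left_mono) (auto simp: power_mono power_le_one)
        then show ?thesis using True \<epsilon> by simp
      qed simp
    qed measurable
    then show ?thesis by simp
  qed
  have n: "near_int c \<epsilon> Z = (LINT z|lebesgue. indicator {z. norm z < \<epsilon>} z * (1/2 * ((Z *v z) \<bullet> z)) * c z)" for Z
    by (simp add: near_int_def set_lebesgue_integral_def mult.assoc)
  have fa: "far_int c v \<epsilon> x p = (LINT z|lebesgue. indicator {z. norm z \<ge> \<epsilon>} z * f x p z * c z)" for x p
    by (simp add: far_int_def f_def set_lebesgue_integral_def mult.assoc)
  have "near_int c \<epsilon> X + far_int c v \<epsilon> x p - near_int c \<epsilon> Y - far_int c v \<epsilon> y p' =
    (LINT z|lebesgue. indicator {z. norm z < \<epsilon>} z * (1/2 * ((X *v z) \<bullet> z)) * c z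
      + indicator {z. norm z \<ge> \<epsilon>} z * f x p z * c z
      - indicator {z. norm z < \<epsilon>} z * (1/2 * ((Y *v z) \<bullet> z)) * c z
      - indicator {z. norm z \<ge> \<epsilon>} z * f y p' z * c z)"
    unfolding n fa
    by (simp only: Bochner_Integration.integral_add Bochner_Integration.integral_diff
        Bochner_Integration.integrable_add Bochner_Integration.integrable_diff near far)
  also have "\<dots> \<le> (LINT z|lebesgue. s * (m z * c z) - b * (indicator S z * c z))"
  proof (rule integral_mono_AE)
    show "integrable lebesgue (\<lambda>z. s * (m z * c z) - b * (indicator S z * c z))"
      unfolding m_def by (intro Bochner_Integration.integrable_diff Sint integrable_mult_right c_int)
    show "AE z in lebesgue. indicator {z. norm z < \<epsilon>} z * (1/2 * ((X *v z) \<bullet> z)) * c z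
      + indicator {z. norm z \<ge> \<epsilon>} z * f x p z * c z
      - indicator {z. norm z < \<epsilon>} z * (1/2 * ((Y *v z) \<bullet> z)) * c z
      - indicator {z. norm z \<ge> \<epsilon>} z * f y p' z * c z \<le> s * (m z * c z) - b * (indicator S z * c z)"
      using c_nonneg
    proof eventually_elim
      case (elim z)
      show ?case
      proof (cases "norm z < \<epsilon>")
        case True
        \<comment> \<open>\<open>S\<close> does not meet the inner ball, so the matrix bound, which
          contains no gain, suffices there.\<close>
        then have nS: "z \<notin> S" using S(2) by force
        have "(norm z)\<^sup>2 \<le> 1\<^sup>2" using \<epsilon> True by (intro power_mono) auto
        then have "1/2 * ((X *v z) \<bullet> z) - 1/2 * ((Y *v z) \<bullet> z) \<le> s * m z"
          using XY[of z] by (simp add: m_def)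
        from mult_right_mono[OF this elim] show ?thesis using True nS
          by (simp add: algebra_simps)
      next
        case False
        have "f x p z - f y p' z \<le> s * m z - b * indicator S z"
          using D[of z] by (simp add: f_def m_def)
        from mult_right_mono[OF this elim] show ?thesis using False
          by (simp add: algebra_simps)
      qed
    qed
  qed (intro Bochner_Integration.integrable_add Bochner_Integration.integrable_diff near far)
  also have "\<dots> = s * (LINT z|lebesgue. m z * c z) - b * (LINT z:S|lebesgue. c z)"
    using Sint c_int unfolding m_def set_lebesgue_integral_def
    by (subst Bochner_Integration.integral_diff) auto
  also have "\<dots> \<le> s * C1 - b * (LINT z:S|lebesgue. c z)"
    using mult_left_mono[OF c_int_le s] by (simp add: m_def)
  finally show ?thesis .
qed

text \<open>On this ball |a|/4 \<le> |z| \<le> |a|, hence c(z) \<ge> C2 |a|^(-N-\<gamma>), while the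
  volume is proportional to (\<kappa> |a|)^N; the powers with exponent N cancel.\<close>

lemma ball_mass_lower:
  assumes \<kappa>: "0 < \<kappa>" "\<kappa> \<le> 1/4" and a: "0 < norm a" "norm a \<le> 1" and \<gamma>: "0 < \<gamma>"
  shows "C2 * unit_ball_vol (real CARD('n)) * \<kappa> ^ CARD('n) * norm a powr (- \<gamma>)
    \<le> (LINT z:ball (a /\<^sub>R 2) (\<kappa> * norm a)|lebesgue. c z)"
proof -
  define r where "r = norm a"
  define S where "S = ball (a /\<^sub>R 2) (\<kappa> * r)"
  define K where "K = C2 * r powr (- (real CARD('n) + \<gamma>))"
  have r: "0 < r" "r \<le> 1" using a by (auto simp: r_def)
  have Snorm: "r / 4 \<le> norm z" "norm z \<le> r" "0 < norm z" if "z \<in> S" for z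
  proof -
    have d: "norm (a /\<^sub>R 2 - z) < \<kappa> * r" using that by (simp add: S_def dist_norm)
    have "\<kappa> * r \<le> 1/4 * r" using \<kappa> r by (intro mult_right_mono) auto
    moreover have "norm (a /\<^sub>R 2) = r / 2" by (simp add: r_def)
    ultimately show "r / 4 \<le> norm z" "norm z \<le> r" "0 < norm z"
      using d norm_triangle_ineq2[of "a /\<^sub>R 2" z] norm_triangle_ineq3[of "a /\<^sub>R 2" z] r(1) by linarith+
  qed
  have Slow: "K \<le> c z" if "z \<in> S" "0 \<le> c z" for z
  proof -
    have "r powr (- (real CARD('n) + \<gamma>)) \<le> norm z powr (- (real CARD('n) + \<gamma>))"
      using Snorm[OF that(1)] \<gamma> by (intro powr_mono2') auto
    then have "K \<le> C2 / norm z powr (real CARD('n) + \<gamma>)"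
      unfolding K_def powr_minus divide_inverse using C2 by (intro mult_left_mono) auto
    also have "\<dots> \<le> \<bar>c z\<bar>" using Snorm[OF that(1)] r by (intro c_lower) auto
    finally show ?thesis using that by simp
  qed
  have Sm: "S \<in> lmeasurable" by (simp add: S_def)
  have cS: "integrable lebesgue (\<lambda>z. indicator S z * c z)"
  proof (rule integrable_mult_c)
    show "indicator S \<in> borel_measurable lebesgue" using Sm by (simp add: fmeasurableD)
    fix z :: "real ^ 'n"
    show "\<bar>indicator S z\<bar> \<le> 16 / r\<^sup>2 * min ((norm z)\<^sup>2) 1"
    proof (cases "z \<in> S")
      case True
      have "(r / 4)\<^sup>2 \<le> (norm z)\<^sup>2" using Snorm[OF True] r by (intro power_mono) auto
      moreover have "(r / 4)\<^sup>2 \<le> 1" using r by (intro power_le_one) auto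
      ultimately have "16 / r\<^sup>2 * (r / 4)\<^sup>2 \<le> 16 / r\<^sup>2 * min ((norm z)\<^sup>2) 1"
        by (intro mult_left_mono) auto
      then show ?thesis using True r by (simp add: power_divide)
    qed simp
  qed
  have "C2 * unit_ball_vol (real CARD('n)) * \<kappa> ^ CARD('n) * r powr (- \<gamma>) = measure lebesgue S * K"
  proof -
    have "r powr (- \<gamma>) = r powr (real CARD('n)) * r powr (- (real CARD('n) + \<gamma>))"
      by (simp add: powr_add[symmetric])
    also have "r powr (real CARD('n)) = r ^ CARD('n)" using r by (simp add: powr_realpow)
    finally show ?thesis
      using content_ball[of "\<kappa> * r" "a /\<^sub>R 2"] \<kappa> r by (simp add: S_def K_def power_mult_distrib)
  qed
  also have "\<dots> = (LINT z|lebesgue. indicator S z * K)"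
    using Sm by simp
  also have "\<dots> \<le> (LINT z|lebesgue. indicator S z * c z)"
  proof (rule integral_mono_AE)
    show "integrable lebesgue (\<lambda>z. indicator S z * K)"
      using Sm by (intro integrable_mult_left) (auto simp: fmeasurable_def)
    show "AE z in lebesgue. indicator S z * K \<le> indicator S z * c z"
      using c_nonneg by eventually_elim (auto simp: indicator_def Slow)
  qed (rule cS)
  finally show ?thesis by (simp add: S_def r_def set_lebesgue_integral_def)
qed

end

section \<open>Doubling of variables\<close>

text \<open>Test along rays t h. Terms of order t give (p - l) \<bullet> h \<le> 0 for every h,
  hence p = l; once they vanish, terms of order t^2 compare the quadratic forms.\<close>

lemma quadratic_expansion_upper:
  fixes f :: "'a::real_inner \<Rightarrow> real"
  assumes q: "quadratic_expansion f x p S" and up: "\<And>h. f (x + h) - f x \<le> l \<bullet> h + B * (norm h)\<^sup>2"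
  shows "p = l" "S h \<bullet> h \<le> 2 * B * (norm h)\<^sup>2"
proof -
  have lin: "linear S" using q by (simp add: quadratic_expansion_def)
  have key: "\<exists>d>0. \<forall>t. 0 < t \<and> t < d \<longrightarrow> (p - l) \<bullet> h + t * (S h \<bullet> h) / 2 \<le> t * (B + e) * (norm h)\<^sup>2"
    if e: "e > 0" for e h
  proof -
    obtain d where d: "d > 0" "\<And>k. norm k < d \<Longrightarrow> \<bar>f (x + k) - f x - p \<bullet> k - (S k \<bullet> k) / 2\<bar> \<le> e * (norm k)\<^sup>2"
      using q e unfolding quadratic_expansion_def by blast
    have "(p - l) \<bullet> h + t * (S h \<bullet> h) / 2 \<le> t * (B + e) * (norm h)\<^sup>2" if t: "0 < t" "t < d / (norm h + 1)" for t
    proof -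
      have "t * norm h \<le> t * (norm h + 1)" using t by (intro mult_left_mono) auto
      also have "\<dots> < d" using t(2) by (simp add: pos_less_divide_eq add_nonneg_pos)
      finally have "norm (t *\<^sub>R h) < d" using t by simp
      from d(2)[OF this] up[of "t *\<^sub>R h"]
      have "p \<bullet> (t *\<^sub>R h) + (S (t *\<^sub>R h) \<bullet> (t *\<^sub>R h)) / 2 \<le> l \<bullet> (t *\<^sub>R h) + (B + e) * (norm (t *\<^sub>R h))\<^sup>2"
        by (simp add: algebra_simps)
      then have "t * ((p - l) \<bullet> h + t * (S h \<bullet> h) / 2) \<le> t * (t * (B + e) * (norm h)\<^sup>2)"
        using t by (simp add: linear_scale[OF lin] inner_diff_left power_mult_distrib power2_eq_square algebra_simps)
      then show ?thesis using t(1) by (rule mult_left_le_imp_le)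
    qed
    moreover have "d / (norm h + 1) > 0" using d(1) by (intro divide_pos_pos) (auto simp: add_nonneg_pos)
    ultimately show ?thesis by blast
  qed
  have "(p - l) \<bullet> h \<le> 0" for h
  proof -
    obtain d where d: "d > 0" "\<forall>t. 0 < t \<and> t < d \<longrightarrow> (p - l) \<bullet> h + t * (S h \<bullet> h) / 2 \<le> t * (B + 1) * (norm h)\<^sup>2"
      using key[of 1 h] by auto
    have "\<forall>\<^sub>F t in at_right 0. (p - l) \<bullet> h \<le> t * ((B + 1) * (norm h)\<^sup>2 - (S h \<bullet> h) / 2)"
      unfolding eventually_at_right_field using d by (intro exI[of _ d]) (auto simp: algebra_simps)
    moreover have "((\<lambda>t. t * ((B + 1) * (norm h)\<^sup>2 - (S h \<bullet> h) / 2)) \<longlongrightarrow> 0 * ((B + 1) * (norm h)\<^sup>2 - (S h \<bullet> h) / 2)) (at_right 0)"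
      by (intro tendsto_intros)
    ultimately show ?thesis
      using tendsto_lowerbound[OF _ _ trivial_limit_at_right_real] by fastforce
  qed
  from this[of "p - l"] show pl: "p = l" by (metis inner_gt_zero_iff not_le right_minus_eq)
  have "S h \<bullet> h \<le> 2 * B * (norm h)\<^sup>2 + e" if e: "e > 0" for e
  proof -
    define e' where "e' = e / (2 * ((norm h)\<^sup>2 + 1))"
    have n: "(norm h)\<^sup>2 + 1 > 0" by (simp add: add_nonneg_pos)
    then have e': "e' > 0" using e by (simp add: e'_def)
    obtain d where d: "d > 0" "\<forall>t. 0 < t \<and> t < d \<longrightarrow> (p - l) \<bullet> h + t * (S h \<bullet> h) / 2 \<le> t * (B + e') * (norm h)\<^sup>2"
      using key[OF e', of h] by auto
    have "(p - l) \<bullet> h + d / 2 * (S h \<bullet> h) / 2 \<le> d / 2 * (B + e') * (norm h)\<^sup>2"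
      using d(1) by (intro d(2)[rule_format]) simp
    then have "d / 2 * (S h \<bullet> h) \<le> d / 2 * (2 * (B + e') * (norm h)\<^sup>2)" by (simp add: pl algebra_simps)
    then have "S h \<bullet> h \<le> 2 * (B + e') * (norm h)\<^sup>2"
      by (rule mult_left_le_imp_le) (use d(1) in simp)
    also have "\<dots> \<le> 2 * B * (norm h)\<^sup>2 + 2 * e' * ((norm h)\<^sup>2 + 1)" using e' by (simp add: algebra_simps)
    also have "2 * e' * ((norm h)\<^sup>2 + 1) = e" using n by (simp add: e'_def field_simps)
    finally show ?thesis .
  qed
  then show "S h \<bullet> h \<le> 2 * B * (norm h)\<^sup>2" by (rule field_le_epsilon)
qed

lemma quadratic_expansion_uminus:
  assumes "quadratic_expansion f x p S"
  shows "quadratic_expansion (\<lambda>x. - f x) x (- p) (\<lambda>h. - S h)"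
proof -
  have "\<bar>- f (x + k) - - f x - (- p) \<bullet> k - (- S k \<bullet> k) / 2\<bar> = \<bar>f (x + k) - f x - p \<bullet> k - (S k \<bullet> k) / 2\<bar>" for k
    by (subst abs_minus_cancel[symmetric]) simp
  then show ?thesis
    using assms unfolding quadratic_expansion_def by (auto intro: linear_compose_neg)
qed

lemma quadratic_expansion_add:
  assumes "quadratic_expansion f x p S" "quadratic_expansion g y q T"
  shows "quadratic_expansion (\<lambda>z. f (x + z) + g (y + z)) 0 (p + q) (\<lambda>h. S h + T h)"
  unfolding quadratic_expansion_def
proof (intro conjI allI impI)
  show "linear (\<lambda>h. S h + T h)"
    using assms by (auto simp: quadratic_expansion_def intro: linear_compose_add)
  fix e :: real assume "e > 0"
  then have e: "e / 2 > 0" by simp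
  obtain d where d: "d > 0" "\<And>k. norm k < d \<Longrightarrow> \<bar>f (x + k) - f x - p \<bullet> k - (S k \<bullet> k) / 2\<bar> \<le> e / 2 * (norm k)\<^sup>2"
    using assms(1) e unfolding quadratic_expansion_def by blast
  obtain d' where d': "d' > 0" "\<And>k. norm k < d' \<Longrightarrow> \<bar>g (y + k) - g y - q \<bullet> k - (T k \<bullet> k) / 2\<bar> \<le> e / 2 * (norm k)\<^sup>2"
    using assms(2) e unfolding quadratic_expansion_def by blast
  have "\<bar>f (x + (0 + k)) + g (y + (0 + k)) - (f (x + 0) + g (y + 0)) - (p + q) \<bullet> k - ((S k + T k) \<bullet> k) / 2\<bar> \<le> e * (norm k)\<^sup>2"
    if "norm k < min d d'" for k
  proof -
    have "\<bar>f (x + k) - f x - p \<bullet> k - (S k \<bullet> k) / 2\<bar> \<le> e / 2 * (norm k)\<^sup>2"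
      "\<bar>g (y + k) - g y - q \<bullet> k - (T k \<bullet> k) / 2\<bar> \<le> e / 2 * (norm k)\<^sup>2"
      using d(2)[of k] d'(2)[of k] that by auto
    moreover have "e / 2 * (norm k)\<^sup>2 + e / 2 * (norm k)\<^sup>2 = e * (norm k)\<^sup>2" by simp
    moreover have "f (x + (0 + k)) + g (y + (0 + k)) - (f (x + 0) + g (y + 0)) - (p + q) \<bullet> k - ((S k + T k) \<bullet> k) / 2
       = (f (x + k) - f x - p \<bullet> k - (S k \<bullet> k) / 2) + (g (y + k) - g y - q \<bullet> k - (T k \<bullet> k) / 2)"
      by (simp add: inner_add_left add_divide_distrib)
    ultimately show ?thesis by linarith
  qed
  then show "\<exists>d>0. \<forall>k. norm k < d \<longrightarrow> \<bar>f (x + (0 + k)) + g (y + (0 + k)) - (f (x + 0) + g (y + 0)) - (p + q) \<bullet> k - ((S k + T k) \<bullet> k) / 2\<bar> \<le> e * (norm k)\<^sup>2"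
    using d(1) d'(1) by (intro exI[of _ "min d d'"]) auto
qed

text \<open>Symmetrisation preserves the quadratic form and gives the element of \<open>Sym\<close>
  that jets ask for.\<close>

lemma symmetric_matrix_of_linear:
  fixes S :: "real ^ 'n \<Rightarrow> real ^ 'n"
  assumes "linear S"
  shows "\<exists>X\<in>Sym. \<forall>k. (X *v k) \<bullet> k = S k \<bullet> k"
proof -
  define A where "A = matrix S"
  have A: "A *v k = S k" for k using assms by (simp add: A_def matrix_works)
  define X where "X = (1/2) *\<^sub>R (A + transpose A)"
  have "X \<in> Sym"
    by (simp add: Sym_def X_def transpose_def vec_eq_iff add.commute)
  moreover have "(X *v k) \<bullet> k = S k \<bullet> k" for k
  proof -
    have "(transpose A *v k) \<bullet> k = (A *v k) \<bullet> k"
      by (metis dot_lmul_matrix inner_commute transpose_matrix_vector)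
    moreover have "(X *v k) \<bullet> k = (1/2) * ((A *v k) \<bullet> k + (transpose A *v k) \<bullet> k)"
      by (simp add: X_def matrix_vector_mult_add_rdistrib inner_add_left flip: scaleR_matrix_vector_assoc)
    ultimately show ?thesis by (simp add: A)
  qed
  ultimately show ?thesis by blast
qed

lemma unit_cell_translate:
  fixes x :: "real ^ 'n"
  shows "\<exists>h. (\<forall>i. h $ i \<in> \<int>) \<and> x + h \<in> cbox 0 1"
proof -
  define h where "h = (\<chi> i. - real_of_int \<lfloor>x $ i\<rfloor>)"
  have "0 \<le> x $ i - of_int \<lfloor>x $ i\<rfloor>" "x $ i - of_int \<lfloor>x $ i\<rfloor> \<le> 1" for i
    by linarith+
  then have "x + h \<in> cbox 0 1" by (simp add: mem_box_cart h_def)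
  then show ?thesis by (intro exI[of _ h]) (simp add: h_def)
qed

lemma periodic_uniformly_continuous:
  fixes v :: "real ^ 'n \<Rightarrow> real"
  assumes cont: "continuous_on UNIV v" and per: "Z_periodic v" and e: "0 < e"
  shows "\<exists>d>0. \<forall>x y. norm (x - y) < d \<longrightarrow> \<bar>v x - v y\<bar> < e"
proof -
  obtain b where b: "\<And>x. x \<in> cbox (0 :: real ^ 'n) 1 \<Longrightarrow> norm x \<le> b"
    using bounded_cbox[of "0 :: real ^ 'n" 1] by (auto simp: bounded_iff)
  have "uniformly_continuous_on (cball 0 (b + 1)) v"
    by (intro compact_uniformly_continuous continuous_on_subset[OF cont]) auto
  then obtain d where d: "d > 0" "\<And>x y. x \<in> cball 0 (b + 1) \<Longrightarrow> y \<in> cball 0 (b + 1) \<Longrightarrow> dist y x < d \<Longrightarrow> dist (v y) (v x) < e"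
    using e unfolding uniformly_continuous_on_def by metis
  have "\<bar>v x - v y\<bar> < e" if xy: "norm (x - y) < min d 1" for x y
  proof -
    obtain h where h: "\<forall>i. h $ i \<in> \<int>" "x + h \<in> cbox 0 1" using unit_cell_translate by blast
    have nx: "norm (x + h) \<le> b" by (rule b[OF h(2)])
    have "norm (y + h) \<le> norm (x + h) + norm (x - y)"
      using norm_triangle_ineq4[of "x + h" "x - y"] by (simp add: add.commute)
    then have "y + h \<in> cball 0 (b + 1)" "x + h \<in> cball 0 (b + 1)" using nx xy by auto
    then have "dist (v (x + h)) (v (y + h)) < e" using xy by (intro d(2)) (auto simp: dist_norm)
    moreover have "v (x + h) = v x" "v (y + h) = v y" using per h(1) by (auto simp: Z_periodic_def)
    ultimately show ?thesis by (simp add: dist_real_def)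
  qed
  then show ?thesis using d(1) by (intro exI[of _ "min d 1"]) auto
qed

section \<open>The doubled function and its perturbed maximum\<close>

locale doubling =
  fixes v :: "real ^ 'n::{finite,wellorder} \<Rightarrow> real" and M e K \<theta> :: real
  assumes v_cont: "continuous_on UNIV v" and v_bound: "\<bar>v x\<bar> \<le> M" and v_per: "Z_periodic v"
    and e_pos: "0 < e" and K: "0 < K" and \<theta>: "0 < \<theta>" "\<theta> < 1"
begin

sublocale Vc: bounded_continuous v M e
  by unfold_locales (auto simp: v_cont v_bound e_pos)

sublocale Wc: bounded_continuous "\<lambda>x. - v x" M e
  by unfold_locales (auto simp: v_bound e_pos intro!: continuous_intros v_cont)

definition "V = supconv e v"
text \<open>\<open>- W\<close> is the inf-convolution of \<open>v\<close>. With this sign the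
  doubled function is a sum of semiconvex functions minus the test term.\<close>

definition "W = supconv e (\<lambda>x. - v x)"
definition "\<phi> x y = V x + W y - K * norm (x - y) powr \<theta>"

lemma \<phi>_translate:
  assumes "\<forall>i. h $ i \<in> \<int>"
  shows "\<phi> (x + h) (y + h) = \<phi> x y"
proof -
  have "v (x + h) = v x" for x using v_per assms by (simp add: Z_periodic_def)
  then have "V (x + h) = V x" "W (y + h) = W y"
    unfolding V_def W_def by (auto intro: Vc.supconv_periodic Wc.supconv_periodic)
  then show ?thesis by (simp add: \<phi>_def)
qed

lemma \<phi>_le: "\<phi> x y \<le> 2 * M - K * norm (x - y) powr \<theta>"
  using Vc.abs_supconv_le[of x] Wc.abs_supconv_le[of y] by (simp add: \<phi>_def V_def W_def)

lemma \<phi>_le_v: "\<phi> x y \<le> v (Vc.\<xi> x) - v (Wc.\<xi> y)"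
proof -
  have "\<phi> x y \<le> V x + W y" using K by (simp add: \<phi>_def)
  then show ?thesis
    using Vc.supconv_upper[of x] Wc.supconv_upper[of y] by (simp add: V_def W_def)
qed

lemma \<phi>_ge: "v x - v y - K * norm (x - y) powr \<theta> \<le> \<phi> x y"
  using Vc.supconv_lower[of x] Wc.supconv_lower[of y] by (simp add: \<phi>_def V_def W_def)

lemma \<phi>_continuous: "continuous_on UNIV (\<lambda>z. \<phi> (fst z) (snd z))"
proof -
  have VW: "continuous_on UNIV V" "continuous_on UNIV W"
    unfolding V_def W_def by (rule Vc.supconv_continuous Wc.supconv_continuous)+
  have "continuous_on UNIV (\<lambda>z :: (real ^ 'n::_) \<times> (real ^ 'n::_). V (fst z))"
    "continuous_on UNIV (\<lambda>z :: (real ^ 'n::_) \<times> (real ^ 'n::_). W (snd z))"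
    by (rule continuous_on_compose2[OF VW(1)] continuous_on_compose2[OF VW(2)]; auto intro: continuous_intros)+
  moreover have "continuous_on UNIV (\<lambda>z :: (real ^ 'n::_) \<times> (real ^ 'n::_). norm (fst z - snd z) powr \<theta>)"
    using \<theta> by (intro continuous_on_powr' continuous_on_norm continuous_on_diff continuous_on_fst
        continuous_on_snd continuous_on_id continuous_on_const) auto
  ultimately show ?thesis
    unfolding \<phi>_def by (intro continuous_on_add continuous_on_diff continuous_on_mult continuous_on_const)
qed

definition "cell_radius = (SOME b. 0 \<le> b \<and> (\<forall>x \<in> cbox (0 :: real ^ 'n::_) 1. norm x \<le> b))"

lemma cell_radius: "0 \<le> cell_radius" "x \<in> cbox (0 :: real ^ 'n::_) 1 \<Longrightarrow> norm x \<le> cell_radius"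
proof -
  obtain b where b: "\<And>x. x \<in> cbox (0 :: real ^ 'n::_) 1 \<Longrightarrow> norm x \<le> b"
    using bounded_cbox[of "0 :: real ^ 'n::_" 1] by (auto simp: bounded_iff)
  have "0 \<le> b" using b[of 0] by (simp add: mem_box_cart)
  then have "\<exists>b\<ge>0. \<forall>x \<in> cbox (0 :: real ^ 'n::_) 1. norm x \<le> b" using b by blast
  from someI_ex[OF this] show "0 \<le> cell_radius" "x \<in> cbox (0 :: real ^ 'n::_) 1 \<Longrightarrow> norm x \<le> cell_radius"
    unfolding cell_radius_def by blast+
qed

text \<open>Translating both variables by the same integer vector preserves \<open>\<phi>\<close>,
  so \<open>x\<close> may be taken in the unit cell. Then \<open>y\<close> stays bounded wherever
  \<open>\<phi>\<close> > 0, because the test term is at most 2M there.\<close>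

lemma maximum_exists:
  assumes pos: "0 < \<phi> x0 y0"
  shows "\<exists>xh yh. xh \<in> cbox 0 1 \<and> (\<forall>x y. \<phi> x y \<le> \<phi> xh yh)"
proof -
  have M0: "0 \<le> M" using v_bound[of 0] by linarith
  define R where "R = (2 * M / K) powr (1 / \<theta>)"
  define A where "A = cbox (0 :: real ^ 'n::_) 1 \<times> cball (0 :: real ^ 'n::_) (cell_radius + R)"
  have inA: "(x, y) \<in> A" if x: "x \<in> cbox 0 1" and p: "0 < \<phi> x y" for x y
  proof -
    have "norm (x - y) \<le> R"
    proof (rule ccontr)
      assume "\<not> norm (x - y) \<le> R"
      then have "R powr \<theta> \<le> norm (x - y) powr \<theta>" using \<theta> by (intro powr_mono2) (auto simp: R_def)
      moreover have "R powr \<theta> = 2 * M / K" using M0 K \<theta> by (simp add: R_def powr_powr)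
      ultimately have "2 * M \<le> K * norm (x - y) powr \<theta>" using K by (simp add: field_simps)
      then show False using p \<phi>_le[of x y] by linarith
    qed
    then have "norm y \<le> cell_radius + R"
      using cell_radius(2)[OF x] norm_triangle_ineq4[of x "x - y"] by simp
    then show ?thesis using x by (simp add: A_def)
  qed
  obtain h0 where h0: "\<forall>i. h0 $ i \<in> \<int>" "x0 + h0 \<in> cbox 0 1" using unit_cell_translate by blast
  have A0: "(x0 + h0, y0 + h0) \<in> A" using h0 pos by (intro inA) (auto simp: \<phi>_translate)
  have "compact A" unfolding A_def by (intro compact_Times) auto
  then obtain z where z: "z \<in> A" "\<And>w. w \<in> A \<Longrightarrow> \<phi> (fst w) (snd w) \<le> \<phi> (fst z) (snd z)"
    using continuous_attains_sup[of A "\<lambda>z. \<phi> (fst z) (snd z)"] A0 continuous_on_subset[OF \<phi>_continuous]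
    by (metis empty_iff subset_UNIV)
  have "\<phi> x y \<le> \<phi> (fst z) (snd z)" for x y
  proof (cases "0 < \<phi> x y")
    case True
    obtain h where h: "\<forall>i. h $ i \<in> \<int>" "x + h \<in> cbox 0 1" using unit_cell_translate by blast
    have "(x + h, y + h) \<in> A" using h True by (intro inA) (auto simp: \<phi>_translate)
    from z(2)[OF this] show ?thesis by (simp add: \<phi>_translate[OF h(1)])
  next
    case False
    have "0 < \<phi> (fst z) (snd z)" using z(2)[OF A0] pos by (simp add: \<phi>_translate[OF h0(1)])
    then show ?thesis using False by linarith
  qed
  then show ?thesis using z(1) by (intro exI[of _ "fst z"] exI[of _ "snd z"]) (auto simp: A_def)
qed

end

text \<open>The maximum is made strict by subtracting \<eta> times the squared distance to it, and
  Jensen's lemma is applied on the product space to avoid the points where one of \<open>V\<close>,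
  \<open>W\<close> has no expansion. Tilt and penalty reappear as \<open>b\<close>,
  \<open>b'\<close> and the \<eta>-term.\<close>

lemma (in doubling) perturbed_maximum:
  assumes max: "\<And>x y. \<phi> x y \<le> \<phi> xh yh" and ne: "xh \<noteq> yh" and pos: "0 < \<eta>" "0 < \<tau>"
  shows "\<exists>x y b b' p S p' S'. x \<noteq> y \<and> norm (x - xh) < \<tau> \<and> norm (y - yh) < \<tau> \<and> norm b < \<tau> \<and> norm b' < \<tau> \<and>
    \<phi> xh yh \<le> \<phi> x y + \<tau> \<and> quadratic_expansion V x p S \<and> quadratic_expansion W y p' S' \<and>
    (\<forall>h k. V (x + h) + W (y + k) - K * norm (x - y + (h - k)) powr \<theta>
       \<le> \<phi> x y + b \<bullet> h + b' \<bullet> k + \<eta> * ((norm h)\<^sup>2 + (norm k)\<^sup>2))"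
proof -
  define m where "m = norm (xh - yh) / 2"
  have m: "m > 0" using ne by (simp add: m_def)
  \<comment> \<open>The bound \<open>m / 2\<close> keeps |x - y| \<ge> m, away from the singularity
    of the test term; the bound with \<tau> makes displacement, slopes and loss in
    \<open>\<phi>\<close> at most \<tau>.\<close>
  define \<rho> where "\<rho> = min (min 1 (m / 2)) (\<tau> / (4 * (\<eta> + 1)))"
  have \<rho>: "0 < \<rho>" "\<rho> \<le> 1" "\<rho> \<le> m / 2" "4 * (\<eta> + 1) * \<rho> \<le> \<tau>"
  proof -
    show "0 < \<rho>" using m pos by (auto simp: \<rho>_def)
    show "\<rho> \<le> 1" "\<rho> \<le> m / 2" unfolding \<rho>_def by linarith+
    have "\<rho> \<le> \<tau> / (4 * (\<eta> + 1))" by (simp add: \<rho>_def)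
    then show "4 * (\<eta> + 1) * \<rho> \<le> \<tau>" using pos by (simp add: field_simps)
  qed
  have \<rho>': "4 * (\<eta> * \<rho>) + 4 * \<rho> \<le> \<tau>" using \<rho>(4) by (simp add: algebra_simps)
  define F where "F = (\<lambda>z. \<phi> (fst z) (snd z) - \<eta> * (norm (z - (xh, yh)))\<^sup>2)"
  define NV where "NV = {z. \<not> (\<exists>p S. quadratic_expansion V z p S)}"
  define NW where "NW = {z. \<not> (\<exists>p S. quadratic_expansion W z p S)}"
  have neg: "negligible NV" "negligible NW"
    unfolding NV_def NW_def V_def W_def
    by (rule supconv_twice_differentiable_ae[OF Vc.bounded_continuous_axioms]
        supconv_twice_differentiable_ae[OF Wc.bounded_continuous_axioms])+
  define A where "A = K * \<theta> * m powr (\<theta> - 2)"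
  \<comment> \<open>The contributions are the semiconvexity of the convolutions, the curvature of
    the test term at distance at least \<open>m\<close>, and the penalty; they are doubled because
    Jensen's lemma uses \<open>C / 2\<close>.\<close>
  define C where "C = 2 * (1 / (2 * e) + A + \<eta>)"
  have A0: "0 \<le> A" using K \<theta> by (simp add: A_def)
  have "\<exists>q z. z \<notin> NV \<times> UNIV \<union> UNIV \<times> NW \<and> norm (z - (xh, yh)) < \<rho> \<and> norm q < \<eta> * \<rho> \<and> (\<forall>h. F (z + h) \<le> F z + q \<bullet> h)"
  proof (rule jensen_perturbed_maximum[where C = C])
    show "continuous_on UNIV F"
      unfolding F_def by (intro continuous_on_diff \<phi>_continuous continuous_intros)
    show "0 \<le> C" using A0 e_pos pos by (simp add: C_def)
    show "F z \<le> F (xh, yh) - \<eta> * (norm (z - (xh, yh)))\<^sup>2" for z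
      using max[of "fst z" "snd z"] by (simp add: F_def)
    show "negligible (NV \<times> UNIV \<union> UNIV \<times> NW)"
      using neg by (auto intro: negligible_Times)
    fix z assume z: "norm (z - (xh, yh)) < \<rho>"
    define x where "x = fst z"
    define y where "y = snd z"
    have zxy: "z = (x, y)" by (simp add: x_def y_def)
    define a where "a = x - y"
    have "norm (x - xh) < \<rho>" "norm (y - yh) < \<rho>"
      using z norm_fst_le[of "x - xh" "y - yh"] norm_snd_le[of "y - yh" "x - xh"] by (auto simp: zxy)
    moreover have "norm (xh - yh) \<le> norm a + norm (x - xh) + norm (y - yh)"
      using norm_triangle_ineq4[of "a + (y - yh)" "x - xh"] norm_triangle_ineq[of a "y - yh"]
      by (simp add: a_def)
    ultimately have am: "m \<le> norm a" using \<rho>(3) by (simp add: m_def)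
    then have a0: "a \<noteq> 0" using m by auto
    define A' where "A' = K * (\<theta> * norm a powr (\<theta> - 2))"
    have A': "0 \<le> A'" "A' \<le> A"
    proof -
      show "0 \<le> A'" using K \<theta> by (simp add: A'_def)
      have "norm a powr (\<theta> - 2) \<le> m powr (\<theta> - 2)" using am m \<theta> by (intro powr_mono2') auto
      then show "A' \<le> A" using K \<theta> by (simp add: A'_def A_def)
    qed
    define s1 where "s1 = (Vc.\<xi> x - x) /\<^sub>R e - A' *\<^sub>R a - (2 * \<eta>) *\<^sub>R (x - xh)"
    define s2 where "s2 = (Wc.\<xi> y - y) /\<^sub>R e + A' *\<^sub>R a - (2 * \<eta>) *\<^sub>R (y - yh)"
    have "F z + (s1, s2) \<bullet> h - C / 2 * (norm h)\<^sup>2 \<le> F (z + h)" for h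
    proof -
      obtain h1 h2 where h: "h = (h1, h2)" by (cases h)
      have nh: "(norm h)\<^sup>2 = (norm h1)\<^sup>2 + (norm h2)\<^sup>2" by (simp add: h norm_Pair)
      have 1: "V x + ((Vc.\<xi> x - x) /\<^sub>R e) \<bullet> h1 - 1 / (2 * e) * (norm h1)\<^sup>2 \<le> V (x + h1)"
        unfolding V_def by (rule Vc.supconv_lower_paraboloid)
      have 2: "W y + ((Wc.\<xi> y - y) /\<^sub>R e) \<bullet> h2 - 1 / (2 * e) * (norm h2)\<^sup>2 \<le> W (y + h2)"
        unfolding W_def by (rule Wc.supconv_lower_paraboloid)
      have "K * norm (a + (h1 - h2)) powr \<theta> \<le> K * (norm a powr \<theta> + \<theta> * norm a powr (\<theta> - 2) * (a \<bullet> (h1 - h2) + (norm (h1 - h2))\<^sup>2 / 2))"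
        using K \<theta> a0 by (intro mult_left_mono powr_norm_upper_paraboloid) auto
      also have "\<dots> = K * norm a powr \<theta> + A' * (a \<bullet> (h1 - h2)) + A' * ((norm (h1 - h2))\<^sup>2 / 2)"
        by (simp add: A'_def algebra_simps)
      also have "\<dots> \<le> K * norm a powr \<theta> + A' * (a \<bullet> (h1 - h2)) + A * (norm h)\<^sup>2"
      proof -
        have "(norm (h1 - h2))\<^sup>2 / 2 \<le> (norm h)\<^sup>2"
          using zero_le_power2[of "norm (h1 + h2)"] unfolding power2_norm_eq_inner
          by (simp add: h inner_diff_left inner_diff_right inner_add_left inner_add_right inner_commute)
        then have "A' * ((norm (h1 - h2))\<^sup>2 / 2) \<le> A * (norm h)\<^sup>2"
          using A' A0 by (intro mult_mono) auto
        then show ?thesis by simp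
      qed
      finally have 3: "K * norm (a + (h1 - h2)) powr \<theta> \<le> K * norm a powr \<theta> + A' * (a \<bullet> (h1 - h2)) + A * (norm h)\<^sup>2" .
      have sq: "(norm (z + h - (xh, yh)))\<^sup>2 = (norm (z - (xh, yh)))\<^sup>2 + 2 * ((x - xh) \<bullet> h1 + (y - yh) \<bullet> h2) + (norm h)\<^sup>2"
        unfolding h zxy power2_norm_eq_inner
        by (simp add: inner_add_left inner_add_right inner_diff_left inner_diff_right inner_commute)
      have F1: "F z = V x + W y - K * norm a powr \<theta> - \<eta> * (norm (z - (xh, yh)))\<^sup>2"
        by (simp add: F_def zxy \<phi>_def a_def)
      have F2: "F (z + h) = V (x + h1) + W (y + h2) - K * norm (a + (h1 - h2)) powr \<theta>
          - \<eta> * ((norm (z - (xh, yh)))\<^sup>2 + 2 * ((x - xh) \<bullet> h1 + (y - yh) \<bullet> h2) + (norm h)\<^sup>2)"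
        unfolding sq[symmetric] by (simp add: F_def zxy h \<phi>_def a_def algebra_simps)
      have C: "C / 2 * (norm h)\<^sup>2 = 1 / (2 * e) * (norm h1)\<^sup>2 + 1 / (2 * e) * (norm h2)\<^sup>2 + A * (norm h)\<^sup>2 + \<eta> * (norm h)\<^sup>2"
        unfolding C_def by (simp add: nh distrib_left distrib_right add_divide_distrib)
      have s: "(s1, s2) \<bullet> h = ((Vc.\<xi> x - x) /\<^sub>R e) \<bullet> h1 + ((Wc.\<xi> y - y) /\<^sub>R e) \<bullet> h2
          - A' * (a \<bullet> (h1 - h2)) - 2 * \<eta> * ((x - xh) \<bullet> h1 + (y - yh) \<bullet> h2)"
        by (simp add: h s1_def s2_def inner_add_left inner_diff_left[of _ _ h1] inner_diff_left[of _ _ h2] inner_diff_right algebra_simps del: inner_scaleR_left)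
          (simp add: algebra_simps)
      have "\<eta> * ((norm (z - (xh, yh)))\<^sup>2 + 2 * ((x - xh) \<bullet> h1 + (y - yh) \<bullet> h2) + (norm h)\<^sup>2)
        = \<eta> * (norm (z - (xh, yh)))\<^sup>2 + 2 * \<eta> * ((x - xh) \<bullet> h1 + (y - yh) \<bullet> h2) + \<eta> * (norm h)\<^sup>2"
        by (simp add: algebra_simps)
      with 1 2 3 show ?thesis unfolding F1 F2 C s by linarith
    qed
    then show "\<exists>s. \<forall>h. F z + s \<bullet> h - C / 2 * (norm h)\<^sup>2 \<le> F (z + h)" by blast
  qed (use pos \<rho> in auto)
  then obtain q z where z: "z \<notin> NV \<times> UNIV \<union> UNIV \<times> NW" "norm (z - (xh, yh)) < \<rho>" "norm q < \<eta> * \<rho>"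
    "\<And>h. F (z + h) \<le> F z + q \<bullet> h" by blast
  define x where "x = fst z"
  define y where "y = snd z"
  have zxy: "z = (x, y)" by (simp add: x_def y_def)
  obtain p S where pS: "quadratic_expansion V x p S" using z(1) by (auto simp: NV_def zxy)
  obtain p' S' where pS': "quadratic_expansion W y p' S'" using z(1) by (auto simp: NW_def zxy)
  have nx: "norm (x - xh) < \<rho>" "norm (y - yh) < \<rho>"
    using z(2) norm_fst_le[of "x - xh" "y - yh"] norm_snd_le[of "y - yh" "x - xh"] by (auto simp: zxy)
  have xy: "x \<noteq> y"
  proof
    assume "x = y"
    then have "norm (xh - yh) \<le> norm (x - xh) + norm (y - yh)"
      using norm_triangle_ineq4[of "y - yh" "x - xh"] by simp
    then show False using nx \<rho>(3) m unfolding m_def by linarith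
  qed
  \<comment> \<open>Tilt plus gradient of the penalty at the new point.\<close>
  define b where "b = fst q + (2 * \<eta>) *\<^sub>R (x - xh)"
  define b' where "b' = snd q + (2 * \<eta>) *\<^sub>R (y - yh)"
  have "norm (fst q) < \<eta> * \<rho>" "norm (snd q) < \<eta> * \<rho>"
    using z(3) norm_fst_le[of "fst q" "snd q"] norm_snd_le[of "snd q" "fst q"] by auto
  moreover have "norm ((2 * \<eta>) *\<^sub>R (x - xh)) \<le> 2 * \<eta> * \<rho>" "norm ((2 * \<eta>) *\<^sub>R (y - yh)) \<le> 2 * \<eta> * \<rho>"
    using nx pos by auto
  ultimately have nb: "norm b < \<tau>" "norm b' < \<tau>"
    using norm_triangle_ineq[of "fst q" "(2 * \<eta>) *\<^sub>R (x - xh)"]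
      norm_triangle_ineq[of "snd q" "(2 * \<eta>) *\<^sub>R (y - yh)"] \<rho>' \<rho>(1) mult_pos_pos[OF pos(1) \<rho>(1)]
    unfolding b_def b'_def by linarith+
  have "\<phi> xh yh \<le> F z + q \<bullet> ((xh, yh) - z)" using z(4)[of "(xh, yh) - z"] by (simp add: F_def)
  also have "\<dots> \<le> \<phi> x y + norm q * norm ((xh, yh) - z)"
  proof -
    have "q \<bullet> ((xh, yh) - z) \<le> norm q * norm ((xh, yh) - z)" by (rule norm_cauchy_schwarz)
    moreover have "0 \<le> \<eta> * (norm (z - (xh, yh)))\<^sup>2" using pos by simp
    ultimately show ?thesis by (simp add: F_def x_def y_def)
  qed
  also have "norm q * norm ((xh, yh) - z) \<le> \<eta> * \<rho> * 1"
    using z(2,3) \<rho>(1,2) pos(1) by (intro mult_mono) (auto simp: norm_minus_commute)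
  also have "\<eta> * \<rho> * 1 \<le> \<tau>" using \<rho>' \<rho>(1) mult_pos_pos[OF pos(1) \<rho>(1)] by linarith
  finally have near: "\<phi> xh yh \<le> \<phi> x y + \<tau>" by simp
  have ineq: "V (x + h) + W (y + k) - K * norm (x - y + (h - k)) powr \<theta>
       \<le> \<phi> x y + b \<bullet> h + b' \<bullet> k + \<eta> * ((norm h)\<^sup>2 + (norm k)\<^sup>2)" for h k
  proof -
    have nh: "(norm (h, k))\<^sup>2 = (norm h)\<^sup>2 + (norm k)\<^sup>2" by (simp add: norm_Pair)
    have sq: "(norm (z + (h, k) - (xh, yh)))\<^sup>2 = (norm (z - (xh, yh)))\<^sup>2 + 2 * ((x - xh) \<bullet> h + (y - yh) \<bullet> k) + ((norm h)\<^sup>2 + (norm k)\<^sup>2)"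
      unfolding zxy power2_norm_eq_inner
      by (simp add: inner_add_left inner_add_right inner_diff_left inner_diff_right inner_commute)
    have F2: "F (z + (h, k)) = V (x + h) + W (y + k) - K * norm (x - y + (h - k)) powr \<theta>
        - \<eta> * ((norm (z - (xh, yh)))\<^sup>2 + 2 * ((x - xh) \<bullet> h + (y - yh) \<bullet> k) + ((norm h)\<^sup>2 + (norm k)\<^sup>2))"
      unfolding sq[symmetric] by (simp add: F_def zxy \<phi>_def algebra_simps)
    have F1: "F z = \<phi> x y - \<eta> * (norm (z - (xh, yh)))\<^sup>2" by (simp add: F_def zxy)
    have bb: "b \<bullet> h + b' \<bullet> k = q \<bullet> (h, k) + 2 * \<eta> * ((x - xh) \<bullet> h + (y - yh) \<bullet> k)"
      by (cases q) (simp add: b_def b'_def inner_add_left distrib_left)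
    show ?thesis using z(4)[of "(h, k)"] bb unfolding F1 F2 by (simp add: algebra_simps)
  qed
  have "\<rho> < \<tau>" using \<rho>' \<rho>(1) mult_pos_pos[OF pos(1) \<rho>(1)] by linarith
  then have t: "norm (x - xh) < \<tau>" "norm (y - yh) < \<tau>" using nx by linarith+
  show ?thesis
    by (intro exI[of _ x] exI[of _ y] exI[of _ b] exI[of _ b'] exI[of _ p] exI[of _ S] exI[of _ p'] exI[of _ S']
        conjI allI xy t nb near pS pS' ineq)
qed

section \<open>Jets and increments at the perturbed maximum\<close>

text \<open>The jet condition with explicit \<delta>: it yields both membership in the superjet and,
  for any \<delta>, an admissible radius for the approximation.\<close>

abbreviation touched_above :: "(real ^ 'n \<Rightarrow> real) \<Rightarrow> real ^ 'n \<Rightarrow> real ^ 'n \<Rightarrow> real ^ 'n ^ 'n \<Rightarrow> bool" where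
  "touched_above u x p X \<equiv> \<forall>\<delta>>0. \<exists>d>0. \<forall>k. norm k < d \<longrightarrow>
     u (x + k) \<le> u x + p \<bullet> k + (X *v k) \<bullet> k / 2 + \<delta> * (norm k)\<^sup>2"

abbreviation touched_below :: "(real ^ 'n \<Rightarrow> real) \<Rightarrow> real ^ 'n \<Rightarrow> real ^ 'n \<Rightarrow> real ^ 'n ^ 'n \<Rightarrow> bool" where
  "touched_below u x p X \<equiv> \<forall>\<delta>>0. \<exists>d>0. \<forall>k. norm k < d \<longrightarrow>
     u (x + k) \<ge> u x + p \<bullet> k + (X *v k) \<bullet> k / 2 - \<delta> * (norm k)\<^sup>2"

abbreviation increment :: "('a::real_inner \<Rightarrow> real) \<Rightarrow> 'a \<Rightarrow> 'a \<Rightarrow> 'a \<Rightarrow> real" where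
  "increment u x p z \<equiv> u (x + z) - u x - z \<bullet> p"

abbreviation (in doubling) slope :: "real ^ 'n::_ \<Rightarrow> real ^ 'n::_ \<Rightarrow> real" where
  "slope x y \<equiv> K * (\<theta> * norm (x - y) powr (\<theta> - 2))"

text \<open>The maximum inequality is used with three displacements. Moving \<open>x\<close> or
  \<open>y\<close> alone bounds each Hessian by the curvature of the test term and identifies the
  gradients; moving both together cancels the test term and orders the Hessians.
  \<open>supconv_shift\<close> then passes everything to \<open>v\<close> at the attaining
  points.\<close>

lemma (in doubling) doubling_jets:
  assumes max: "\<And>x y. \<phi> x y \<le> \<phi> xh yh" and ne: "xh \<noteq> yh" and pos: "0 < \<phi> xh yh" and \<eta>: "0 < \<eta>"
  shows "\<exists>x y p1 p2 X Y. x \<noteq> y \<and> norm (x - xh) < \<eta> \<and> norm (y - yh) < \<eta> \<and> \<phi> xh yh / 2 \<le> \<phi> x y \<and>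
    norm (p1 - slope x y *\<^sub>R (x - y)) < \<eta> \<and>
    norm (p2 - slope x y *\<^sub>R (x - y)) < \<eta> \<and>
    X \<in> Sym \<and> Y \<in> Sym \<and>
    touched_above v (Vc.\<xi> x) p1 X \<and>
    touched_below v (Wc.\<xi> y) p2 Y \<and>
    (\<forall>k. (X *v k) \<bullet> k \<le> (slope x y + 2 * \<eta>) * (norm k)\<^sup>2) \<and>
    (\<forall>k. - ((Y *v k) \<bullet> k) \<le> (slope x y + 2 * \<eta>) * (norm k)\<^sup>2) \<and>
    (\<forall>k. (X *v k) \<bullet> k \<le> (Y *v k) \<bullet> k + 4 * \<eta> * (norm k)\<^sup>2) \<and>
    (\<forall>k. - ((X *v k) \<bullet> k) \<le> 1 / e * (norm k)\<^sup>2) \<and>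
    (\<forall>k. (Y *v k) \<bullet> k \<le> 1 / e * (norm k)\<^sup>2) \<and>
    (\<forall>z. increment v (Vc.\<xi> x) p1 z - increment v (Wc.\<xi> y) p2 z \<le> 2 * \<eta> * (norm z)\<^sup>2) \<and>
    (\<forall>z. (v (Vc.\<xi> x + z) - v (Vc.\<xi> x)) - (v (Wc.\<xi> y + z) - v (Wc.\<xi> y)) \<le> \<eta>) \<and>
    (\<forall>z. increment v (Vc.\<xi> x) p1 z - increment v (Wc.\<xi> y) p2 z
       \<le> K * (norm (x - y + z) powr \<theta> - norm (x - y) powr \<theta>)
          + K * (norm (x - y - z) powr \<theta> - norm (x - y) powr \<theta>) + 2 * \<eta> * (norm z)\<^sup>2)"
proof -
  \<comment> \<open>The second bound retains half of the maximum value, so that the new points are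
    still separated.\<close>
  define \<tau> where "\<tau> = min \<eta> (\<phi> xh yh / 2)"
  have \<tau>: "0 < \<tau>" "\<tau> \<le> \<eta>" "\<tau> \<le> \<phi> xh yh / 2" using \<eta> pos by (auto simp: \<tau>_def)
  obtain x y b b' p S p' S' where xy: "x \<noteq> y" and near: "norm (x - xh) < \<tau>" "norm (y - yh) < \<tau>"
    and b: "norm b < \<tau>" "norm b' < \<tau>" and \<phi>xy: "\<phi> xh yh \<le> \<phi> x y + \<tau>"
    and pS: "quadratic_expansion V x p S" and pS': "quadratic_expansion W y p' S'"
    and ineq: "\<And>h k. V (x + h) + W (y + k) - K * norm (x - y + (h - k)) powr \<theta>
       \<le> \<phi> x y + b \<bullet> h + b' \<bullet> k + \<eta> * ((norm h)\<^sup>2 + (norm k)\<^sup>2)"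
    using perturbed_maximum[OF max ne \<eta> \<tau>(1)] by blast
  define a where "a = x - y"
  have a0: "a \<noteq> 0" using xy by (simp add: a_def)
  define A where "A = K * (\<theta> * norm a powr (\<theta> - 2))"
  define P where "P = A *\<^sub>R a"
  have \<phi>: "\<phi> x y = V x + W y - K * norm a powr \<theta>" by (simp add: \<phi>_def a_def)
  have par: "K * norm (a + h) powr \<theta> \<le> K * norm a powr \<theta> + P \<bullet> h + A / 2 * (norm h)\<^sup>2" for h
  proof -
    have "K * norm (a + h) powr \<theta> \<le> K * (norm a powr \<theta> + \<theta> * norm a powr (\<theta> - 2) * (a \<bullet> h + (norm h)\<^sup>2 / 2))"
      using K \<theta> a0 by (intro mult_left_mono powr_norm_upper_paraboloid) auto
    then show ?thesis by (simp add: A_def P_def algebra_simps)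
  qed
  have upV: "V (x + h) - V x \<le> K * (norm (a + h) powr \<theta> - norm a powr \<theta>) + b \<bullet> h + \<eta> * (norm h)\<^sup>2" for h
    using ineq[of h 0] by (simp add: \<phi> a_def algebra_simps)
  have upW: "W (y + k) - W y \<le> K * (norm (a - k) powr \<theta> - norm a powr \<theta>) + b' \<bullet> k + \<eta> * (norm k)\<^sup>2" for k
    using ineq[of 0 k] by (simp add: \<phi> a_def algebra_simps)
  have upVW: "V (x + h) + W (y + h) - (V x + W y) \<le> (b + b') \<bullet> h + 2 * \<eta> * (norm h)\<^sup>2" for h
    using ineq[of h h] by (simp add: \<phi> a_def inner_add_left)
  have V1: "V (x + h) - V x \<le> (P + b) \<bullet> h + (A / 2 + \<eta>) * (norm h)\<^sup>2" for h
    using upV[of h] par[of h] by (simp add: algebra_simps inner_add_left)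
  have W1: "W (y + k) - W y \<le> (- P + b') \<bullet> k + (A / 2 + \<eta>) * (norm k)\<^sup>2" for k
    using upW[of k] par[of "- k"] by (simp add: algebra_simps inner_add_left)
  have p: "p = P + b" and S: "\<And>h. S h \<bullet> h \<le> 2 * (A / 2 + \<eta>) * (norm h)\<^sup>2"
    using quadratic_expansion_upper[OF pS V1] by auto
  have p': "p' = - P + b'" and S': "\<And>h. S' h \<bullet> h \<le> 2 * (A / 2 + \<eta>) * (norm h)\<^sup>2"
    using quadratic_expansion_upper[OF pS' W1] by auto
  have SS': "(S h + S' h) \<bullet> h \<le> 2 * (2 * \<eta>) * (norm h)\<^sup>2" for h
    by (rule quadratic_expansion_upper(2)[OF quadratic_expansion_add[OF pS pS'], where l = "b + b'"])
       (use upVW in simp)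
  \<comment> \<open>This bound blows up as \<open>e\<close> tends to 0 and serves only to confine
    the matrices to a compact set.\<close>
  have lowS: "- S h \<bullet> h \<le> 2 * (1 / (2 * e)) * (norm h)\<^sup>2" for h
  proof (rule quadratic_expansion_upper(2)[OF quadratic_expansion_uminus[OF pS], where l = "- ((Vc.\<xi> x - x) /\<^sub>R e)"])
    fix h
    show "- V (x + h) - - V x \<le> - ((Vc.\<xi> x - x) /\<^sub>R e) \<bullet> h + 1 / (2 * e) * (norm h)\<^sup>2"
      using Vc.supconv_lower_paraboloid[of x h] unfolding V_def inner_minus_left by linarith
  qed
  have lowS': "- S' h \<bullet> h \<le> 2 * (1 / (2 * e)) * (norm h)\<^sup>2" for h
  proof (rule quadratic_expansion_upper(2)[OF quadratic_expansion_uminus[OF pS'], where l = "- ((Wc.\<xi> y - y) /\<^sub>R e)"])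
    fix h
    show "- W (y + h) - - W y \<le> - ((Wc.\<xi> y - y) /\<^sub>R e) \<bullet> h + 1 / (2 * e) * (norm h)\<^sup>2"
      using Wc.supconv_lower_paraboloid[of y h] unfolding W_def inner_minus_left by linarith
  qed
  obtain X where X: "X \<in> Sym" "\<And>k. (X *v k) \<bullet> k = S k \<bullet> k"
    using symmetric_matrix_of_linear[of S] pS by (auto simp: quadratic_expansion_def)
  have "linear (\<lambda>k. - S' k)" using pS' by (auto simp: quadratic_expansion_def intro: linear_compose_neg)
  then obtain Y where Y: "Y \<in> Sym" "\<And>k. (Y *v k) \<bullet> k = - (S' k \<bullet> k)"
    using symmetric_matrix_of_linear[of "\<lambda>k. - S' k"] by auto
  have shV: "v (Vc.\<xi> x + z) - v (Vc.\<xi> x) \<le> V (x + z) - V x" for z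
    unfolding V_def by (rule Vc.supconv_shift)
  have shW: "v (Wc.\<xi> y) - v (Wc.\<xi> y + z) \<le> W (y + z) - W y" for z
    using Wc.supconv_shift[of y z] unfolding W_def by simp
  have 1: "\<exists>d>0. \<forall>k. norm k < d \<longrightarrow>
       v (Vc.\<xi> x + k) \<le> v (Vc.\<xi> x) + p \<bullet> k + (X *v k) \<bullet> k / 2 + \<delta> * (norm k)\<^sup>2" if "\<delta> > 0" for \<delta>
  proof -
    obtain d where d: "d > 0" "\<forall>k. norm k < d \<longrightarrow> \<bar>V (x + k) - V x - p \<bullet> k - (S k \<bullet> k) / 2\<bar> \<le> \<delta> * (norm k)\<^sup>2"
      using pS \<open>\<delta> > 0\<close> unfolding quadratic_expansion_def by blast
    have "v (Vc.\<xi> x + k) \<le> v (Vc.\<xi> x) + p \<bullet> k + (X *v k) \<bullet> k / 2 + \<delta> * (norm k)\<^sup>2" if "norm k < d" for k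
      using d(2)[rule_format, OF that] shV[of k] unfolding X(2) by linarith
    then show ?thesis using d(1) by blast
  qed
  have 2: "\<exists>d>0. \<forall>k. norm k < d \<longrightarrow>
       v (Wc.\<xi> y + k) \<ge> v (Wc.\<xi> y) + (- p') \<bullet> k + (Y *v k) \<bullet> k / 2 - \<delta> * (norm k)\<^sup>2" if "\<delta> > 0" for \<delta>
  proof -
    obtain d where d: "d > 0" "\<forall>k. norm k < d \<longrightarrow> \<bar>W (y + k) - W y - p' \<bullet> k - (S' k \<bullet> k) / 2\<bar> \<le> \<delta> * (norm k)\<^sup>2"
      using pS' \<open>\<delta> > 0\<close> unfolding quadratic_expansion_def by blast
    have "v (Wc.\<xi> y + k) \<ge> v (Wc.\<xi> y) + (- p') \<bullet> k + (Y *v k) \<bullet> k / 2 - \<delta> * (norm k)\<^sup>2" if "norm k < d" for k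
      using d(2)[rule_format, OF that] shW[of k] unfolding Y(2) inner_minus_left by linarith
    then show ?thesis using d(1) by blast
  qed
  have Pz: "z \<bullet> p = P \<bullet> z + b \<bullet> z" "z \<bullet> (- p') = P \<bullet> z - b' \<bullet> z" for z
    by (simp_all add: p p' inner_add_left inner_add_right inner_commute inner_diff_right)
  \<comment> \<open>The difference of the two gradients is exactly the sum of the tilts, so no
    linear term in \<open>z\<close> survives.\<close>
  have 3: "increment v (Vc.\<xi> x) p z - increment v (Wc.\<xi> y) (- p') z \<le> 2 * \<eta> * (norm z)\<^sup>2" for z
    using shV[of z] shW[of z] upVW[of z] unfolding Pz inner_add_left by linarith
  \<comment> \<open>For long \<open>z\<close> a bound growing like |z|^2 could not be integrated;
    near-maximality of (x, y) supplies a constant one.\<close>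
  have 4: "(v (Vc.\<xi> x + z) - v (Vc.\<xi> x)) - (v (Wc.\<xi> y + z) - v (Wc.\<xi> y)) \<le> \<eta>" for z
  proof -
    have "\<phi> (x + z) (y + z) \<le> \<phi> x y + \<eta>" using max[of "x + z" "y + z"] \<phi>xy \<tau>(2) by linarith
    then have "V (x + z) + W (y + z) \<le> V x + W y + \<eta>" by (simp add: \<phi>_def)
    then show ?thesis using shV[of z] shW[of z] by linarith
  qed
  \<comment> \<open>Here \<open>V\<close> and \<open>W\<close> are displaced by \<open>z\<close>
    separately, which produces both a + z and a - z and thus exposes the concavity of the
    power.\<close>
  have 5: "increment v (Vc.\<xi> x) p z - increment v (Wc.\<xi> y) (- p') z
       \<le> K * (norm (a + z) powr \<theta> - norm a powr \<theta>) + K * (norm (a - z) powr \<theta> - norm a powr \<theta>) + 2 * \<eta> * (norm z)\<^sup>2" for z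
    using shV[of z] shW[of z] upV[of z] upW[of z] unfolding Pz by linarith
  have n: "norm (p - P) < \<eta>" "norm (- p' - P) < \<eta>" using b \<tau>(2) by (auto simp: p p')
  have cX: "(X *v k) \<bullet> k \<le> (A + 2 * \<eta>) * (norm k)\<^sup>2" for k
    using S[of k] unfolding X(2) by (simp add: algebra_simps)
  have cY: "- ((Y *v k) \<bullet> k) \<le> (A + 2 * \<eta>) * (norm k)\<^sup>2" for k
    using S'[of k] unfolding Y(2) by (simp add: algebra_simps)
  have cXY: "(X *v k) \<bullet> k \<le> (Y *v k) \<bullet> k + 4 * \<eta> * (norm k)\<^sup>2" for k
    using SS'[of k] unfolding X(2) Y(2) inner_add_left by simp
  have dX: "- ((X *v k) \<bullet> k) \<le> 1 / e * (norm k)\<^sup>2" for k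
    using lowS[of k] unfolding X(2) by simp
  have dY: "(Y *v k) \<bullet> k \<le> 1 / e * (norm k)\<^sup>2" for k
    using lowS'[of k] unfolding Y(2) by simp
  have t: "norm (x - xh) < \<eta>" "norm (y - yh) < \<eta>" "\<phi> xh yh / 2 \<le> \<phi> x y"
    using near \<tau> \<phi>xy by linarith+
  show ?thesis
    by (rule exI[of _ x], rule exI[of _ y], rule exI[of _ p], rule exI[of _ "- p'"], rule exI[of _ X],
        rule exI[of _ Y], unfold a_def[symmetric] A_def[symmetric] P_def[symmetric],
        intro conjI allI impI xy t n X(1) Y(1) 1 2 3 4 5 cX cY cXY dX dY)
qed

lemma superjetI:
  fixes u :: "real ^ 'n \<Rightarrow> real"
  assumes X: "X \<in> Sym"
    and up: "touched_above u x p X"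
  shows "(p, X) \<in> superjet u x"
proof -
  \<comment> \<open>The remainder is the positive part of the excess over the paraboloid; it is
    o(|z|^2) by the hypothesis.\<close>
  define r where "r = (\<lambda>z. max 0 (u (x + z) - u x - p \<bullet> z - (X *v z) \<bullet> z / 2))"
  have "r \<in> o[at 0](\<lambda>z. (norm z)\<^sup>2)"
  proof (rule landau_o.smallI)
    fix \<delta> :: real assume "0 < \<delta>"
    from up[rule_format, OF this] obtain d where d: "d > 0"
      "\<And>k. norm k < d \<Longrightarrow> u (x + k) \<le> u x + p \<bullet> k + (X *v k) \<bullet> k / 2 + \<delta> * (norm k)\<^sup>2" by blast
    have "norm (r k) \<le> \<delta> * norm ((norm k)\<^sup>2)" if "norm k < d" for k
      using d(2)[OF that] \<open>0 < \<delta>\<close> by (simp add: r_def)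
    then show "\<forall>\<^sub>F k in at 0. norm (r k) \<le> \<delta> * norm ((norm k)\<^sup>2)"
      unfolding eventually_at using d(1) by (intro exI[of _ d]) auto
  qed
  moreover have "u (x + z) \<le> u x + p \<bullet> z + (1/2) * ((X *v z) \<bullet> z) + r z" for z
    by (simp add: r_def)
  ultimately show ?thesis using X unfolding superjet_def by auto
qed

lemma subjetI:
  fixes u :: "real ^ 'n \<Rightarrow> real"
  assumes X: "X \<in> Sym"
    and low: "touched_below u x p X"
  shows "(p, X) \<in> subjet u x"
proof -
  define r where "r = (\<lambda>z. min 0 (u (x + z) - u x - p \<bullet> z - (X *v z) \<bullet> z / 2))"
  have "r \<in> o[at 0](\<lambda>z. (norm z)\<^sup>2)"
  proof (rule landau_o.smallI)
    fix \<delta> :: real assume "0 < \<delta>"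
    from low[rule_format, OF this] obtain d where d: "d > 0"
      "\<And>k. norm k < d \<Longrightarrow> u (x + k) \<ge> u x + p \<bullet> k + (X *v k) \<bullet> k / 2 - \<delta> * (norm k)\<^sup>2" by blast
    have "norm (r k) \<le> \<delta> * norm ((norm k)\<^sup>2)" if "norm k < d" for k
      using d(2)[OF that] \<open>0 < \<delta>\<close> by (auto simp: r_def min_def)
    then show "\<forall>\<^sub>F k in at 0. norm (r k) \<le> \<delta> * norm ((norm k)\<^sup>2)"
      unfolding eventually_at using d(1) by (intro exI[of _ d]) auto
  qed
  moreover have "u (x + z) \<ge> u x + p \<bullet> z + (1/2) * ((X *v z) \<bullet> z) + r z" for z
    by (simp add: r_def)
  ultimately show ?thesis using X unfolding subjet_def by auto
qed

lemma upper_approxI: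
  fixes u :: "real ^ 'n \<Rightarrow> real"
  assumes "touched_above u x p X" "0 < \<delta>"
  shows "\<exists>\<epsilon>>0. upper_approx u x p X \<epsilon> \<delta>"
proof -
  obtain d where d: "d > 0" "\<And>k. norm k < d \<Longrightarrow> u (x + k) \<le> u x + p \<bullet> k + (X *v k) \<bullet> k / 2 + \<delta> * (norm k)\<^sup>2"
    using assms by blast
  have "upper_approx u x p X (d / 2) \<delta>"
    unfolding upper_approx_def using d by simp
  then show ?thesis using d(1) by (intro exI[of _ "d / 2"]) simp
qed

lemma lower_approxI:
  fixes u :: "real ^ 'n \<Rightarrow> real"
  assumes "touched_below u x p X" "0 < \<delta>"
  shows "\<exists>\<epsilon>>0. lower_approx u x p X \<epsilon> \<delta>"
proof -
  obtain d where d: "d > 0" "\<And>k. norm k < d \<Longrightarrow> u (x + k) \<ge> u x + p \<bullet> k + (X *v k) \<bullet> k / 2 - \<delta> * (norm k)\<^sup>2"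
    using assms by blast
  have "lower_approx u x p X (d / 2) \<delta>"
    unfolding lower_approx_def using d by simp
  then show ?thesis using d(1) by (intro exI[of _ "d / 2"]) simp
qed

section \<open>Viscosity inequalities\<close>

text \<open>Polarisation with a vector \<open>w\<close> parallel to \<open>Z *v u\<close> and as
  long as \<open>u\<close>, followed by the parallelogram law.\<close>

lemma symmetric_form_bound:
  fixes Z :: "real ^ 'n ^ 'n"
  assumes Z: "Z \<in> Sym" and b: "\<And>u. \<bar>(Z *v u) \<bullet> u\<bar> \<le> C * (norm u)\<^sup>2"
  shows "norm (Z *v u) \<le> C * norm u"
proof (cases "Z *v u = 0 \<or> u = 0")
  case True
  then show ?thesis
  proof
    assume 0: "Z *v u = 0"
    have "0 \<le> C"
    proof (cases "u = 0")
      case False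
      then have "0 \<le> C * (norm u)\<^sup>2" using b[of u] 0 by simp
      then show ?thesis using False by (simp add: zero_le_mult_iff)
    next
      case True
      have "0 \<le> C * (norm (axis undefined 1 :: real ^ 'n))\<^sup>2"
        using b[of "axis undefined 1"] abs_ge_zero order_trans by blast
      then show ?thesis by (simp add: norm_axis_1)
    qed
    then show ?thesis using 0 by simp
  qed simp
next
  case False
  define w where "w = (norm u / norm (Z *v u)) *\<^sub>R (Z *v u)"
  have w: "norm w = norm u" "(Z *v u) \<bullet> w = norm u * norm (Z *v u)"
    using False by (auto simp: w_def dot_square_norm power2_eq_square)
  have sym: "(Z *v w) \<bullet> u = (Z *v u) \<bullet> w"
  proof -
    have "(Z *v w) \<bullet> u = (transpose Z *v u) \<bullet> w"
      by (metis dot_lmul_matrix inner_commute transpose_matrix_vector)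
    moreover have "transpose Z = Z" using Z by (simp add: Sym_def)
    ultimately show ?thesis by (simp only:)
  qed
  have "4 * ((Z *v u) \<bullet> w) = (Z *v (u + w)) \<bullet> (u + w) - (Z *v (u - w)) \<bullet> (u - w)"
    using sym by (simp add: matrix_vector_right_distrib matrix_vector_mult_diff_distrib
        inner_add_left inner_add_right inner_diff_left inner_diff_right)
  also have "\<dots> \<le> C * (norm (u + w))\<^sup>2 + C * (norm (u - w))\<^sup>2"
    using b[of "u + w"] b[of "u - w"] by (simp add: abs_le_iff)
  also have "\<dots> = 4 * (C * (norm u)\<^sup>2)"
  proof -
    have "(norm (u + w))\<^sup>2 + (norm (u - w))\<^sup>2 = 2 * (norm u)\<^sup>2 + 2 * (norm w)\<^sup>2"
      unfolding power2_norm_eq_inner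
      by (simp add: inner_add_left inner_add_right inner_diff_left inner_diff_right inner_commute)
    then have "(norm (u + w))\<^sup>2 + (norm (u - w))\<^sup>2 = 4 * (norm u)\<^sup>2" by (simp add: w(1))
    then have "C * ((norm (u + w))\<^sup>2 + (norm (u - w))\<^sup>2) = C * (4 * (norm u)\<^sup>2)" by simp
    then show ?thesis by (simp add: distrib_left)
  qed
  finally have "norm u * norm (Z *v u) \<le> norm u * (C * norm u)"
    by (simp add: w(2) power2_eq_square mult_ac)
  then show ?thesis using False by (simp add: mult_le_cancel_left)
qed

text \<open>Passes from forms to the Euclidean norm of the entries, in which compactness of sets of
  matrices is expressed.\<close>

lemma matrix_norm_le_of_form_bound:
  fixes Z :: "real ^ 'n ^ 'n"
  assumes Z: "Z \<in> Sym" and b: "\<And>u. \<bar>(Z *v u) \<bullet> u\<bar> \<le> C * (norm u)\<^sup>2"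
  shows "norm Z \<le> real CARD('n) * real CARD('n) * C"
proof -
  have e: "\<bar>Z $ i $ j\<bar> \<le> C" for i j
  proof -
    have "Z $ i $ j = (Z *v axis j 1) $ i" by (simp add: matrix_vector_mult_basis column_def)
    also have "\<bar>\<dots>\<bar> \<le> norm (Z *v axis j 1)" by (rule component_le_norm_cart)
    also have "\<dots> \<le> C" using symmetric_form_bound[OF Z b, of "axis j 1"] by simp
    finally show ?thesis .
  qed
  have "norm Z \<le> (\<Sum>i\<in>UNIV. norm (Z $ i))" unfolding norm_vec_def by (rule L2_set_le_sum) simp
  also have "\<dots> \<le> (\<Sum>i\<in>(UNIV::'n set). \<Sum>j\<in>(UNIV::'n set). C)"
  proof (rule sum_mono)
    fix i
    have "norm (Z $ i) \<le> (\<Sum>j\<in>UNIV. \<bar>Z $ i $ j\<bar>)" by (rule norm_le_l1_cart)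
    also have "\<dots> \<le> (\<Sum>j\<in>(UNIV::'n set). C)" by (intro sum_mono e)
    finally show "norm (Z $ i) \<le> (\<Sum>j\<in>(UNIV::'n set). C)" .
  qed
  finally show ?thesis by simp
qed

text \<open>Testing with the sum and the difference of two basis vectors bounds every entry of a
  positive semidefinite matrix by its trace. The dimensional factor is harmless, as the modulus
  multiplying it can be made small.\<close>

lemma form_le_trace:
  fixes D :: "real ^ 'n ^ 'n"
  assumes D: "D \<in> Sym" and psd: "\<And>u. 0 \<le> (D *v u) \<bullet> u"
  shows "0 \<le> trace D" "(D *v u) \<bullet> u \<le> (real CARD('n))\<^sup>2 * trace D * (norm u)\<^sup>2"
proof -
  have entry: "(D *v u) \<bullet> u = (\<Sum>i\<in>UNIV. \<Sum>j\<in>UNIV. D $ i $ j * u $ j * u $ i)" for u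
    by (simp add: inner_vec_def matrix_vector_mult_def sum_distrib_right)
  have ax: "(D *v axis j 1) \<bullet> axis i 1 = D $ i $ j" for i j
    by (simp add: inner_axis matrix_vector_mult_basis column_def)
  have sym: "D $ i $ j = D $ j $ i" for i j
  proof -
    have "transpose D $ i $ j = D $ i $ j" using D by (simp add: Sym_def)
    then show ?thesis by (simp add: transpose_def)
  qed
  have diag: "0 \<le> D $ i $ i" for i using psd[of "axis i 1"] by (simp add: ax)
  show tr: "0 \<le> trace D" unfolding trace_def by (intro sum_nonneg diag)
  have le: "D $ i $ i \<le> trace D" for i
    unfolding trace_def by (rule member_le_sum) (auto intro: diag)
  have off: "\<bar>D $ i $ j\<bar> \<le> trace D" for i j
  proof -
    have "0 \<le> (D *v (axis i 1 + axis j 1)) \<bullet> (axis i 1 + axis j 1)" "0 \<le> (D *v (axis i 1 - axis j 1)) \<bullet> (axis i 1 - axis j 1)"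
      by (rule psd)+
    then have "0 \<le> D $ i $ i + D $ j $ j + 2 * D $ i $ j" "0 \<le> D $ i $ i + D $ j $ j - 2 * D $ i $ j"
      using sym[of i j] by (simp_all add: matrix_vector_right_distrib matrix_vector_mult_diff_distrib
          inner_add_left inner_add_right inner_diff_left inner_diff_right ax)
    then show ?thesis using le[of i] le[of j] by linarith
  qed
  have "(D *v u) \<bullet> u \<le> (\<Sum>i\<in>(UNIV::'n set). \<Sum>j\<in>(UNIV::'n set). trace D * (norm u)\<^sup>2)"
    unfolding entry
  proof (intro sum_mono)
    fix i j
    have "\<bar>D $ i $ j * u $ j * u $ i\<bar> \<le> trace D * norm u * norm u"
      unfolding abs_mult using off[of i j] component_le_norm_cart[of u i] component_le_norm_cart[of u j] tr
      by (intro mult_mono) auto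
    then show "D $ i $ j * u $ j * u $ i \<le> trace D * (norm u)\<^sup>2" by (simp add: power2_eq_square)
  qed
  then show "(D *v u) \<bullet> u \<le> (real CARD('n))\<^sup>2 * trace D * (norm u)\<^sup>2"
    by (simp add: power2_eq_square mult_ac)
qed

text \<open>Bounds on the full form are hereby inherited by the zero-padded block, by testing on
  truncated vectors.\<close>

lemma head_block_form:
  "(head_block k X *v u) \<bullet> u = (X *v head_vec k u) \<bullet> head_vec k u"
proof -
  have "(head_block k X *v u) \<bullet> u = (\<Sum>i\<in>UNIV. \<Sum>j\<in>UNIV. (head_block k X) $ i $ j * u $ j * u $ i)"
    by (simp add: inner_vec_def matrix_vector_mult_def sum_distrib_right)
  also have "\<dots> = (\<Sum>i\<in>UNIV. \<Sum>j\<in>UNIV. X $ i $ j * (head_vec k u) $ j * (head_vec k u) $ i)"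
    by (intro sum.cong refl) (simp add: head_block_def head_vec_def)
  also have "\<dots> = (X *v head_vec k u) \<bullet> head_vec k u"
    by (simp add: inner_vec_def matrix_vector_mult_def sum_distrib_right)
  finally show ?thesis .
qed

lemma norm_head_vec_le: "norm (head_vec k u) \<le> norm u"
  by (rule norm_le_componentwise_cart) (simp add: head_vec_def)

lemma head_block_Sym: "X \<in> Sym \<Longrightarrow> head_block k X \<in> Sym"
  by (auto simp: Sym_def head_block_def transpose_def vec_eq_iff)

lemma Sym_diff: "X \<in> Sym \<Longrightarrow> Y \<in> Sym \<Longrightarrow> X - Y \<in> Sym"
  by (auto simp: Sym_def transpose_def vec_eq_iff)

lemma Sym_add_scaled_id:
  fixes X :: "real ^ 'n ^ 'n"
  assumes "X \<in> Sym"
  shows "X + t *\<^sub>R mat 1 \<in> Sym"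
  using assms by (auto simp: Sym_def transpose_def vec_eq_iff mat_def)

lemma form_add_scaled_id:
  fixes X :: "real ^ 'n ^ 'n"
  shows "((X + t *\<^sub>R mat 1) *v u) \<bullet> u = (X *v u) \<bullet> u + t * (norm u)\<^sup>2"
  by (simp add: matrix_vector_mult_add_rdistrib inner_add_left power2_norm_eq_inner
      flip: scaleR_matrix_vector_assoc)

text \<open>Only upper bounds on \<open>X\<close> and \<open>-Y\<close> are available; the missing lower bound on the block \<open>X'\<close> costs
  a multiple of the trace of \<open>Y' - X'\<close>, which partial ellipticity pays for when \<open>|x - y|\<close> is small.\<close>

lemma elliptic_difference_le:
  fixes F :: "real ^ 'n::{finite,wellorder} \<Rightarrow> real ^ 'n::_ \<Rightarrow> real ^ 'n::_ ^ 'n::_ \<Rightarrow> real"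
  assumes ell: "\<And>x p X Y. X \<in> Sym \<Longrightarrow> Y \<in> Sym \<Longrightarrow> sym_le (head_block k X) (head_block k Y) \<Longrightarrow>
         F x p X \<ge> F x p Y + lam1 * trace (head_block k Y - head_block k X)"
    and mod: "\<And>x y p X. X \<in> Sym \<Longrightarrow>
         \<bar>F x p X - F y p X\<bar> \<le> w (norm (x - y)) * norm (head_vec k p) powr q
           + \<eta> (norm (x - y)) * onorm ((*v) (head_block k X))"
    and X: "X \<in> Sym" and Y: "Y \<in> Sym" and XY: "\<And>u. (X *v u) \<bullet> u \<le> (Y *v u) \<bullet> u"
    and XB: "\<And>u. (X *v u) \<bullet> u \<le> B * (norm u)\<^sup>2" and YB: "\<And>u. - ((Y *v u) \<bullet> u) \<le> B * (norm u)\<^sup>2"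
    and B: "0 \<le> B" and q: "0 \<le> q"
    and w0: "0 \<le> w (norm (x - y))" and \<eta>0: "0 \<le> \<eta> (norm (x - y))"
    and small: "\<eta> (norm (x - y)) * (real CARD('n))\<^sup>2 \<le> lam1"
  shows "F y p Y - F x p X \<le> w (norm (x - y)) * norm p powr q + \<eta> (norm (x - y)) * B"
proof -
  define D where "D = head_block k Y - head_block k X"
  define N2 where "N2 = (real CARD('n))\<^sup>2"
  have Du: "(D *v u) \<bullet> u = (Y *v head_vec k u) \<bullet> head_vec k u - (X *v head_vec k u) \<bullet> head_vec k u" for u
    by (simp add: D_def matrix_vector_mult_diff_rdistrib inner_diff_left head_block_form)
  have Dsym: "D \<in> Sym" unfolding D_def by (intro Sym_diff head_block_Sym X Y)
  have psd: "0 \<le> (D *v u) \<bullet> u" for u using XY[of "head_vec k u"] by (simp add: Du)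
  note tr = form_le_trace[OF Dsym psd]
  have hv: "B * (norm (head_vec k u))\<^sup>2 \<le> B * (norm u)\<^sup>2" for u :: "real ^ 'n::_"
    using B norm_head_vec_le[of k u] by (intro mult_left_mono power_mono) auto
  have N2: "0 \<le> N2 * trace D" using tr(1) by (simp add: N2_def)
  \<comment> \<open>From above the bound on \<open>X\<close> suffices; from below, X' = Y' - D with
    Y' \<ge> -B and D at most a multiple of its trace.\<close>
  have "\<bar>(head_block k X *v u) \<bullet> u\<bar> \<le> (B + N2 * trace D) * (norm u)\<^sup>2" for u
  proof -
    have "(head_block k X *v u) \<bullet> u \<le> B * (norm u)\<^sup>2"
      using XB[of "head_vec k u"] hv[of u] by (simp add: head_block_form)
    moreover have "(head_block k X *v u) \<bullet> u = (Y *v head_vec k u) \<bullet> head_vec k u - (D *v u) \<bullet> u"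
      by (simp add: Du head_block_form)
    moreover have "- ((Y *v head_vec k u) \<bullet> head_vec k u) \<le> B * (norm u)\<^sup>2"
      using YB[of "head_vec k u"] hv[of u] by linarith
    moreover have "(D *v u) \<bullet> u \<le> N2 * trace D * (norm u)\<^sup>2" using tr(2) by (simp add: N2_def)
    moreover have "0 \<le> N2 * trace D * (norm u)\<^sup>2" using N2 by simp
    moreover have "(B + N2 * trace D) * (norm u)\<^sup>2 = B * (norm u)\<^sup>2 + N2 * trace D * (norm u)\<^sup>2"
      by (rule distrib_right)
    ultimately show ?thesis by linarith
  qed
  then have "norm (head_block k X *v u) \<le> (B + N2 * trace D) * norm u" for u
    by (rule symmetric_form_bound[OF head_block_Sym[OF X]])
  then have "onorm ((*v) (head_block k X)) \<le> B + N2 * trace D" by (rule onorm_le)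
  then have "\<eta> (norm (x - y)) * onorm ((*v) (head_block k X)) \<le> \<eta> (norm (x - y)) * (B + N2 * trace D)"
    using \<eta>0 by (rule mult_left_mono)
  also have "\<dots> = \<eta> (norm (x - y)) * B + \<eta> (norm (x - y)) * N2 * trace D" by (simp add: algebra_simps)
  also have "\<eta> (norm (x - y)) * N2 * trace D \<le> lam1 * trace D"
    using small tr(1) unfolding N2_def by (rule mult_right_mono)
  finally have 1: "\<eta> (norm (x - y)) * onorm ((*v) (head_block k X)) \<le> \<eta> (norm (x - y)) * B + lam1 * trace D"
    by simp
  have "w (norm (x - y)) * norm (head_vec k p) powr q \<le> w (norm (x - y)) * norm p powr q"
    using w0 q norm_head_vec_le[of k p] by (intro mult_left_mono powr_mono2) auto
  moreover have "sym_le (head_block k X) (head_block k Y)"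
    using XY by (simp add: sym_le_def head_block_form)
  then have "F y p Y + lam1 * trace D \<le> F y p X" unfolding D_def by (rule ell[OF X Y])
  moreover have "\<bar>F x p X - F y p X\<bar> \<le> w (norm (x - y)) * norm (head_vec k p) powr q
           + \<eta> (norm (x - y)) * onorm ((*v) (head_block k X))" by (rule mod[OF X])
  ultimately show ?thesis using 1 by linarith
qed

section \<open>Subtracting the two viscosity inequalities\<close>

text \<open>The largest ratio of radius to |a| that \<open>powr_norm_strict_concave\<close>
  admits.\<close>

definition ball_ratio :: "real \<Rightarrow> real" where
  "ball_ratio \<theta> = min (concavity_gap \<theta> / 4) (1/4)"

text \<open>On the ball around a/2 the integrand gains a multiple of K |a|^\<theta>, and the ball
  has mass of order |a|^(-\<gamma>); the product is the left side. It bounds from below what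
  \<open>F\<close> and \<open>g\<close> must compensate.\<close>

lemma (in levy) viscosity_difference:
  fixes v g :: "real ^ 'n \<Rightarrow> real"
  assumes sol: "viscosity_solution lam F c g v" and lam: "0 < lam" and \<gamma>: "0 < \<gamma>"
    and v: "continuous_on UNIV v" "\<And>x. \<bar>v x\<bar> \<le> M"
    and \<theta>: "0 < \<theta>" "\<theta> < 1" and K: "0 < K" and \<eta>: "0 < \<eta>"
    and a: "a \<noteq> 0" "norm a \<le> 1" and vle: "v y \<le> v x"
    and X: "X \<in> Sym" and Y: "Y \<in> Sym"
    and jetX: "touched_above v x p1 X"
    and jetY: "touched_below v y p2 Y"
    and XY: "\<And>k. (X *v k) \<bullet> k \<le> (Y *v k) \<bullet> k + 4 * \<eta> * (norm k)\<^sup>2"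
    and near: "\<And>z. increment v x p1 z - increment v y p2 z \<le> 2 * \<eta> * (norm z)\<^sup>2"
    and far: "\<And>z. (v (x + z) - v x) - (v (y + z) - v y) \<le> \<eta>"
    and gain: "\<And>z. increment v x p1 z - increment v y p2 z
       \<le> K * (norm (a + z) powr \<theta> - norm a powr \<theta>) + K * (norm (a - z) powr \<theta> - norm a powr \<theta>) + 2 * \<eta> * (norm z)\<^sup>2"
  shows "concavity_gap \<theta> * (C2 * unit_ball_vol (real CARD('n)) * ball_ratio \<theta> ^ CARD('n)) * (K * norm a powr (\<theta> - \<gamma>))
     \<le> F y p2 Y - F x p1 X + (g x - g y) + 4 * \<eta> * C1"
proof -
  define \<kappa> where "\<kappa> = ball_ratio \<theta>"
  define G where "G = concavity_gap \<theta>"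
  have G: "0 < G" unfolding G_def by (rule concavity_gap_pos[OF \<theta>])
  have \<kappa>: "0 < \<kappa>" "\<kappa> \<le> G / 4" "\<kappa> \<le> 1/4" using G by (auto simp: \<kappa>_def G_def ball_ratio_def)
  define r where "r = norm a"
  have r: "0 < r" "r \<le> 1" using a by (auto simp: r_def)
  define S where "S = ball (a /\<^sub>R 2) (\<kappa> * r)"
  have Snorm: "r / 4 \<le> norm z" "norm z \<le> 1" if "z \<in> S" for z
  proof -
    have d: "norm (a /\<^sub>R 2 - z) < \<kappa> * r" using that by (simp add: S_def dist_norm)
    have "\<kappa> * r \<le> 1/4 * r" using \<kappa> r by (intro mult_right_mono) auto
    moreover have "norm (a /\<^sub>R 2) = r / 2" by (simp add: r_def)
    ultimately show "r / 4 \<le> norm z" "norm z \<le> 1"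
      using d norm_triangle_ineq2[of "a /\<^sub>R 2" z] norm_triangle_ineq3[of "a /\<^sub>R 2" z] r by linarith+
  qed
  obtain \<epsilon>1 where \<epsilon>1: "\<epsilon>1 > 0" "upper_approx v x p1 X \<epsilon>1 \<eta>"
    using upper_approxI[OF jetX \<eta>] by blast
  obtain \<epsilon>2 where \<epsilon>2: "\<epsilon>2 > 0" "lower_approx v y p2 Y \<epsilon>2 \<eta>"
    using lower_approxI[OF jetY \<eta>] by blast
  \<comment> \<open>The third bound puts \<open>S\<close>, on which |z| \<ge> r/4, outside the inner
    ball; there the jets replace \<open>v\<close> and would hide the gain.\<close>
  define \<epsilon> where "\<epsilon> = min (min \<epsilon>1 \<epsilon>2) (r / 4)"
  have \<epsilon>: "0 < \<epsilon>" "\<epsilon> \<le> \<epsilon>1" "\<epsilon> \<le> \<epsilon>2" "\<epsilon> \<le> r / 4" "\<epsilon> \<le> 1"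
    using \<epsilon>1(1) \<epsilon>2(1) r unfolding \<epsilon>_def by linarith+
  define X' where "X' = X + (2 * \<eta>) *\<^sub>R mat 1"
  define Y' where "Y' = Y - (2 * \<eta>) *\<^sub>R mat 1"
  have "(p1, X) \<in> superjet v x" by (rule superjetI[OF X jetX])
  then have sub: "lam * v x + F x p1 X - near_int c \<epsilon> X' - far_int c v \<epsilon> x p1 - g x \<le> 0"
    using sol \<epsilon>1 \<epsilon> \<eta> unfolding viscosity_solution_def viscosity_subsolution_def X'_def by blast
  have "(p2, Y) \<in> subjet v y" by (rule subjetI[OF Y jetY])
  then have sup: "lam * v y + F y p2 Y - near_int c \<epsilon> Y' - far_int c v \<epsilon> y p2 - g y \<ge> 0"
    using sol \<epsilon>2 \<epsilon> \<eta> unfolding viscosity_solution_def viscosity_supersolution_def Y'_def by blast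
  have "near_int c \<epsilon> X' + far_int c v \<epsilon> x p1 - near_int c \<epsilon> Y' - far_int c v \<epsilon> y p2
    \<le> 4 * \<eta> * C1 - (G * K * r powr \<theta>) * (LINT z:S|lebesgue. c z)"
  proof (rule nonlocal_difference_le[OF v \<epsilon>(1) \<epsilon>(5)])
    show "S \<in> sets lebesgue" by (simp add: S_def)
    show "\<epsilon> \<le> norm z" if "z \<in> S" for z using Snorm[OF that] \<epsilon>(4) by linarith
    show "0 \<le> 4 * \<eta>" using \<eta> by simp
    \<comment> \<open>A total of \<open>8 * \<eta>\<close>: half from \<open>XY\<close>, and
      \<open>2 * \<eta>\<close> from each identity shift in the notions of sub- and
      supersolution.\<close>
    show "(X' *v z) \<bullet> z \<le> (Y' *v z) \<bullet> z + 2 * (4 * \<eta>) * (norm z)\<^sup>2" for z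
    proof -
      have "(Y' *v z) \<bullet> z = (Y *v z) \<bullet> z - 2 * \<eta> * (norm z)\<^sup>2"
        using form_add_scaled_id[of Y "- (2 * \<eta>)" z] by (simp add: Y'_def)
      moreover have "(X' *v z) \<bullet> z = (X *v z) \<bullet> z + 2 * \<eta> * (norm z)\<^sup>2"
        unfolding X'_def by (rule form_add_scaled_id)
      ultimately show ?thesis using XY[of z] by (simp add: algebra_simps)
    qed
    \<comment> \<open>Three regions: strict concavity on \<open>S\<close>, cancellation of the test
      term in the rest of the unit ball, and near-maximality outside, where the compensator
      vanishes.\<close>
    show "(v (x + z) - v x - indicator {z. norm z \<le> 1} z * (z \<bullet> p1))
        - (v (y + z) - v y - indicator {z. norm z \<le> 1} z * (z \<bullet> p2))
        \<le> 4 * \<eta> * min ((norm z)\<^sup>2) 1 - (G * K * r powr \<theta>) * indicator S z" for z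
    proof (cases "norm z \<le> 1")
      case True
      then have m: "min ((norm z)\<^sup>2) 1 = (norm z)\<^sup>2" by (simp add: power_le_one)
      have n2: "2 * \<eta> * (norm z)\<^sup>2 \<le> 4 * \<eta> * (norm z)\<^sup>2" using \<eta> by (intro mult_right_mono) auto
      show ?thesis
      proof (cases "z \<in> S")
        case True
        then have "norm (z - a /\<^sub>R 2) \<le> \<kappa> * norm a"
          by (simp add: S_def r_def dist_norm norm_minus_commute)
        from powr_norm_strict_concave[OF a(1) \<theta> \<kappa>(1) _ \<kappa>(3) this] \<kappa>(2)
        have "norm (a + z) powr \<theta> - norm a powr \<theta> + (norm (a - z) powr \<theta> - norm a powr \<theta>) \<le> - G * r powr \<theta>"
          by (simp add: G_def r_def)
        then have "K * (norm (a + z) powr \<theta> - norm a powr \<theta> + (norm (a - z) powr \<theta> - norm a powr \<theta>)) \<le> K * (- G * r powr \<theta>)"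
          using K by (intro mult_left_mono) auto
        moreover have "K * (- G * r powr \<theta>) = - (G * K * r powr \<theta>)" by simp
        ultimately have "K * (norm (a + z) powr \<theta> - norm a powr \<theta>) + K * (norm (a - z) powr \<theta> - norm a powr \<theta>) \<le> - (G * K * r powr \<theta>)"
          by (simp only: distrib_left)
        then show ?thesis using gain[of z] n2 True \<open>norm z \<le> 1\<close> by (simp add: m)
      next
        case False
        then show ?thesis using near[of z] n2 \<open>norm z \<le> 1\<close> by (simp add: m)
      qed
    next
      case False
      then have "z \<notin> S" using Snorm(2)[of z] by auto
      moreover have "min ((norm z)\<^sup>2) 1 = 1" using False one_le_power[of "norm z" 2] by simp
      ultimately show ?thesis using far[of z] \<eta> False by simp
    qed
  qed
  moreover have "G * (C2 * unit_ball_vol (real CARD('n)) * \<kappa> ^ CARD('n)) * (K * r powr (\<theta> - \<gamma>))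
    \<le> (G * K * r powr \<theta>) * (LINT z:S|lebesgue. c z)"
  proof -
    have "(G * K * r powr \<theta>) * (C2 * unit_ball_vol (real CARD('n)) * \<kappa> ^ CARD('n) * r powr (- \<gamma>))
      \<le> (G * K * r powr \<theta>) * (LINT z:S|lebesgue. c z)"
      using ball_mass_lower[OF \<kappa>(1,3) _ a(2) \<gamma>] G K a(1) unfolding S_def r_def
      by (intro mult_left_mono) auto
    moreover have "r powr (\<theta> - \<gamma>) = r powr \<theta> * r powr (- \<gamma>)" by (simp add: powr_add[symmetric])
    ultimately show ?thesis by (simp add: mult_ac)
  qed
  moreover have "0 \<le> lam * v x - lam * v y" using lam vle by simp
  ultimately show ?thesis using sub sup unfolding G_def[symmetric] \<kappa>_def[symmetric] r_def[symmetric] by linarith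
qed

section \<open>The uniform estimate\<close>

lemma usc_lsc_continuous:
  assumes "usc u" "lsc u"
  shows "continuous_on UNIV u"
proof -
  have "(u \<longlongrightarrow> u x) (at x)" for x
  proof (rule order_tendstoI)
    fix a assume "a < u x"
    then show "\<forall>\<^sub>F y in at x. a < u y"
      using assms(2) eventually_at_topological unfolding lsc_def by blast
  next
    fix a assume "u x < a"
    then show "\<forall>\<^sub>F y in at x. u y < a"
      using assms(1) eventually_at_topological unfolding usc_def by blast
  qed
  then show ?thesis by (simp add: continuous_on_def)
qed

lemma closed_Sym: "closed (Sym :: (real ^ 'n ^ 'n) set)"
  unfolding Sym_def transpose_def
  by (intro closed_Collect_eq continuous_intros)

text \<open>Serves to replace two nearly equal gradients by a common one and to shift a matrix by a
  small multiple of the identity, at a fixed point \<open>x\<close>.\<close>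

lemma uniform_modulus_on_bounded:
  fixes F :: "real ^ 'n \<Rightarrow> real ^ 'n \<Rightarrow> real ^ 'n ^ 'n \<Rightarrow> real"
  assumes F: "continuous_on (UNIV \<times> UNIV \<times> Sym) (\<lambda>(x, p, X). F x p X)" and \<tau>: "0 < \<tau>"
  shows "\<exists>\<delta>>0. \<forall>x p p' X X'. norm x \<le> R \<and> norm p \<le> R \<and> norm p' \<le> R \<and> X \<in> Sym \<and> X' \<in> Sym \<and>
     norm X \<le> R \<and> norm X' \<le> R \<and> norm (p - p') < \<delta> \<and> norm (X - X') < \<delta> \<longrightarrow> \<bar>F x p X - F x p' X'\<bar> < \<tau>"
proof -
  define Q where "Q = cball (0 :: real ^ 'n) R \<times> cball (0 :: real ^ 'n) R \<times> (Sym \<inter> cball (0 :: real ^ 'n ^ 'n) R)"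
  have "compact Q"
    unfolding Q_def by (intro compact_Times compact_cball closed_Int_compact closed_Sym)
  moreover have "continuous_on Q (\<lambda>(x, p, X). F x p X)"
    by (rule continuous_on_subset[OF F]) (auto simp: Q_def)
  ultimately have "uniformly_continuous_on Q (\<lambda>(x, p, X). F x p X)" by (rule compact_uniformly_continuous[rotated])
  then obtain d where d: "d > 0" "\<And>z z'. z \<in> Q \<Longrightarrow> z' \<in> Q \<Longrightarrow> dist z' z < d \<Longrightarrow>
      dist ((\<lambda>(x, p, X). F x p X) z') ((\<lambda>(x, p, X). F x p X) z) < \<tau>"
    using \<tau> unfolding uniformly_continuous_on_def by metis
  have "\<bar>F x p X - F x p' X'\<bar> < \<tau>" if h: "norm x \<le> R" "norm p \<le> R" "norm p' \<le> R" "X \<in> Sym" "X' \<in> Sym"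
     "norm X \<le> R" "norm X' \<le> R" "norm (p - p') < d / 2" "norm (X - X') < d / 2" for x p p' X X'
  proof -
    have "norm ((x, p, X) - (x, p', X')) \<le> norm (p - p') + norm (X - X')"
      using norm_Pair_le[of 0 "(p - p', X - X')"] norm_Pair_le[of "p - p'" "X - X'"] by simp
    then have "dist (x, p, X) (x, p', X') < d" using h by (simp add: dist_norm)
    with d(2)[of "(x, p', X')" "(x, p, X)"] h show ?thesis
      by (simp add: Q_def dist_real_def)
  qed
  then show ?thesis using d(1) by (intro exI[of _ "d / 2"]) auto
qed

section \<open>Lower order terms and choice of radii\<close>

text \<open>With b = K r^\<theta> \<le> 2M the gradient has size at most b/r, and b^q = b^(q-1) b
  leaves \<open>K\<close> only to the first power. The prefactor is then independent of
  \<open>K\<close>, so the radius at which this term becomes negligible can be fixed before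
  \<open>K\<close>.\<close>

lemma gradient_term_le:
  fixes r s K \<theta> \<gamma> q M \<rho> :: real
  assumes r: "0 < r" and s: "0 \<le> s" "s \<le> 2 * r" and K: "0 < K" "K * r powr \<theta> \<le> 2 * M"
    and \<theta>: "0 < \<theta>" "\<theta> < 1" and q: "1 \<le> q" and \<rho>: "0 < \<rho>"
  shows "s powr \<rho> * (K * (\<theta> * r powr (\<theta> - 2)) * r) powr q
    \<le> 2 powr \<rho> * (2 * M) powr (q - 1) * r powr (\<rho> + \<gamma> - q) * (K * r powr (\<theta> - \<gamma>))"
proof -
  define b where "b = K * r powr \<theta>"
  have b: "0 < b" "b \<le> 2 * M" using r K by (auto simp: b_def)
  have "K * (\<theta> * r powr (\<theta> - 2)) * r = \<theta> * b * r powr (- 1)"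
  proof -
    have "r powr (\<theta> - 2) * r = r powr \<theta> * r powr (- 1)"
      using r powr_add[of r "\<theta> - 2" 1] powr_add[of r \<theta> "- 1"] by simp
    then show ?thesis by (simp add: b_def mult_ac)
  qed
  also have "\<dots> \<le> b * r powr (- 1)" using \<theta> b by (intro mult_right_mono) auto
  finally have "(K * (\<theta> * r powr (\<theta> - 2)) * r) powr q \<le> (b * r powr (- 1)) powr q"
    using r K \<theta> q by (intro powr_mono2) auto
  also have "\<dots> = b powr (q - 1) * b * r powr (- q)"
  proof -
    have "(b * r powr (- 1)) powr q = b powr q * (r powr (- 1)) powr q"
      by (rule powr_mult)
    moreover have "(r powr (- 1)) powr q = r powr (- q)" by (simp only: powr_powr) simp
    moreover have "b powr q = b powr (q - 1) * b" using b powr_add[of b "q - 1" 1] by simp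
    ultimately show ?thesis by (simp only:)
  qed
  also have "\<dots> \<le> (2 * M) powr (q - 1) * b * r powr (- q)"
    using b q by (intro mult_right_mono powr_mono2) auto
  finally have 1: "(K * (\<theta> * r powr (\<theta> - 2)) * r) powr q \<le> (2 * M) powr (q - 1) * b * r powr (- q)" .
  have "s powr \<rho> \<le> (2 * r) powr \<rho>" using s \<rho> by (intro powr_mono2) auto
  also have "\<dots> = 2 powr \<rho> * r powr \<rho>" using r by (simp add: powr_mult)
  finally have "s powr \<rho> * (K * (\<theta> * r powr (\<theta> - 2)) * r) powr q
     \<le> (2 powr \<rho> * r powr \<rho>) * ((2 * M) powr (q - 1) * b * r powr (- q))"
    using 1 by (intro mult_mono) auto
  also have "\<dots> = 2 powr \<rho> * (2 * M) powr (q - 1) * K * (r powr \<rho> * r powr \<theta> * r powr (- q))"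
    by (simp add: b_def mult_ac)
  also have "r powr \<rho> * r powr \<theta> * r powr (- q) = r powr (\<rho> + \<gamma> - q) * r powr (\<theta> - \<gamma>)"
    by (simp add: powr_add[symmetric] algebra_simps)
  finally show ?thesis by (simp add: mult_ac)
qed

lemma hessian_term_le:
  fixes r s K \<theta> \<gamma> \<rho> :: real
  assumes r: "0 < r" and s: "0 \<le> s" "s \<le> 2 * r" and K: "0 < K"
    and \<theta>: "0 < \<theta>" "\<theta> < 1" and \<rho>: "0 < \<rho>"
  shows "s powr \<rho> * (K * (\<theta> * r powr (\<theta> - 2))) \<le> 2 powr \<rho> * r powr (\<rho> + \<gamma> - 2) * (K * r powr (\<theta> - \<gamma>))"
proof -
  have "s powr \<rho> \<le> (2 * r) powr \<rho>" using s \<rho> by (intro powr_mono2) auto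
  also have "\<dots> = 2 powr \<rho> * r powr \<rho>" using r by (simp add: powr_mult)
  finally have "s powr \<rho> * (K * (\<theta> * r powr (\<theta> - 2))) \<le> (2 powr \<rho> * r powr \<rho>) * (K * (1 * r powr (\<theta> - 2)))"
    using K \<theta> by (intro mult_mono mult_left_mono mult_right_mono) auto
  also have "\<dots> = 2 powr \<rho> * K * (r powr \<rho> * r powr (\<theta> - 2))" by simp
  also have "r powr \<rho> * r powr (\<theta> - 2) = r powr (\<rho> + \<gamma> - 2) * r powr (\<theta> - \<gamma>)"
    by (simp add: powr_add[symmetric])
  finally show ?thesis by (simp add: mult_ac)
qed

lemma powr_small:
  fixes D m \<alpha> :: real
  assumes "0 < \<alpha>" "0 < m"
  shows "\<forall>\<^sub>F r in at_right 0. D * r powr \<alpha> \<le> m"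
proof -
  have "((\<lambda>r. D * r powr \<alpha>) \<longlongrightarrow> D * 0 powr \<alpha>) (at_right 0)"
    using assms(1) by (intro tendsto_intros) (auto simp: eventually_at_right_less intro: eventually_mono[OF eventually_at_right_less])
  then have "((\<lambda>r. D * r powr \<alpha>) \<longlongrightarrow> 0) (at_right 0)" by simp
  from order_tendstoD(2)[OF this assms(2)] show ?thesis by (rule eventually_mono) simp
qed

lemma rate_bound:
  fixes w :: "real \<Rightarrow> real"
  assumes "\<exists>l\<le>L. ((\<lambda>s. w s * s powr (- \<rho>)) \<longlongrightarrow> l) (at_right 0)"
  shows "\<forall>\<^sub>F s in at_right 0. w s \<le> (L + 1) * s powr \<rho>"
proof -
  obtain l where l: "l \<le> L" "((\<lambda>s. w s * s powr (- \<rho>)) \<longlongrightarrow> l) (at_right 0)" using assms by blast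
  have "\<forall>\<^sub>F s in at_right 0. w s * s powr (- \<rho>) < L + 1"
    by (rule order_tendstoD(2)[OF l(2)]) (use l(1) in simp)
  then show ?thesis using eventually_at_right_less[of 0]
  proof eventually_elim
    case (elim s)
    then have "w s * s powr (- \<rho>) * s powr \<rho> \<le> (L + 1) * s powr \<rho>" by (intro mult_right_mono) auto
    moreover have "s powr (- \<rho>) * s powr \<rho> = 1" using elim(2) by (simp add: powr_add[symmetric])
    ultimately show ?case by (simp add: mult.assoc)
  qed
qed

text \<open>The value of \<open>\<phi>\<close> bounds the difference of \<open>v\<close> at the
  attaining points from below, so by the choice of \<open>m\<close> these are at least
  \<open>m\<close> apart. Each lies within m/8 of its base point, whence all distances are
  comparable.\<close>

lemma (in doubling) supconv_arg_close:
  assumes uc: "\<forall>x y. norm (x - y) < m \<longrightarrow> \<bar>v x - v y\<bar> < \<sigma>" and m: "0 < m"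
    and em: "4 * M * e \<le> (m / 8)\<^sup>2" and \<phi>: "\<sigma> \<le> \<phi> x y" and \<sigma>: "0 < \<sigma>"
  shows "norm (x - Vc.\<xi> x) \<le> m / 8" "norm (y - Wc.\<xi> y) \<le> m / 8"
    "3 * m / 4 \<le> norm (x - y)" "norm (Vc.\<xi> x - Wc.\<xi> y) \<le> 2 * norm (x - y)" "0 < norm (Vc.\<xi> x - Wc.\<xi> y)"
    "v (Wc.\<xi> y) \<le> v (Vc.\<xi> x)"
proof -
  have 1: "norm (x - Vc.\<xi> x) \<le> m / 8" "norm (y - Wc.\<xi> y) \<le> m / 8"
    using power2_le_imp_le[OF order_trans[OF Vc.supconv_arg_near em]]
      power2_le_imp_le[OF order_trans[OF Wc.supconv_arg_near em]] m by simp_all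
  have vv: "\<sigma> \<le> v (Vc.\<xi> x) - v (Wc.\<xi> y)" using \<phi>_le_v[of x y] \<phi> by linarith
  have far: "m \<le> norm (Vc.\<xi> x - Wc.\<xi> y)"
  proof (rule ccontr)
    assume "\<not> m \<le> norm (Vc.\<xi> x - Wc.\<xi> y)"
    then have "\<bar>v (Vc.\<xi> x) - v (Wc.\<xi> y)\<bar> < \<sigma>" using uc by simp
    then show False using vv by linarith
  qed
  have "Vc.\<xi> x - Wc.\<xi> y = (x - y) - (x - Vc.\<xi> x) + (y - Wc.\<xi> y)" by simp
  then have "norm (Vc.\<xi> x - Wc.\<xi> y) \<le> norm ((x - y) - (x - Vc.\<xi> x)) + norm (y - Wc.\<xi> y)"
    using norm_triangle_ineq[of "(x - y) - (x - Vc.\<xi> x)" "y - Wc.\<xi> y"] by (simp only:)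
  then have "norm (Vc.\<xi> x - Wc.\<xi> y) \<le> norm (x - y) + norm (x - Vc.\<xi> x) + norm (y - Wc.\<xi> y)"
    using norm_triangle_ineq4[of "x - y" "x - Vc.\<xi> x"] by linarith
  then have 2: "norm (Vc.\<xi> x - Wc.\<xi> y) \<le> norm (x - y) + m / 4" using 1 by linarith
  show "norm (x - Vc.\<xi> x) \<le> m / 8" "norm (y - Wc.\<xi> y) \<le> m / 8"
    "3 * m / 4 \<le> norm (x - y)" "norm (Vc.\<xi> x - Wc.\<xi> y) \<le> 2 * norm (x - y)" "0 < norm (Vc.\<xi> x - Wc.\<xi> y)"
    "v (Wc.\<xi> y) \<le> v (Vc.\<xi> x)"
    using 1 2 far m vv \<sigma> by linarith+
qed

text \<open>The moduli are evaluated at the distance of the attaining points, up to twice |x - y|;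
  hence \<open>2 * r0\<close> in one clause and \<open>r0\<close> in the other.\<close>

lemma smallness_radius:
  fixes w \<eta> :: "real \<Rightarrow> real" and D1 D2 m \<alpha>1 \<alpha>2 lam1 n :: real
  assumes wr: "\<exists>l\<le>L. ((\<lambda>s. w s * s powr (- \<rho>1)) \<longlongrightarrow> l) (at_right 0)"
    and hr: "\<exists>l\<le>L. ((\<lambda>s. \<eta> s * s powr (- \<rho>2)) \<longlongrightarrow> l) (at_right 0)"
    and h0: "(\<eta> \<longlongrightarrow> 0) (at_right 0)" and pos: "0 < \<alpha>1" "0 < \<alpha>2" "0 < m" "0 < lam1" "0 < n"
  shows "\<exists>r0>0. r0 \<le> 1 \<and> (\<forall>s. 0 < s \<and> s \<le> 2 * r0 \<longrightarrow> w s \<le> (L + 1) * s powr \<rho>1 \<and>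
      \<eta> s \<le> (L + 1) * s powr \<rho>2 \<and> \<eta> s * n \<le> lam1) \<and>
    (\<forall>r. 0 < r \<and> r \<le> r0 \<longrightarrow> D1 * r powr \<alpha>1 \<le> m \<and> D2 * r powr \<alpha>2 \<le> m)"
proof -
  have "0 < lam1 / n" using pos by simp
  have "\<forall>\<^sub>F s in at_right 0. \<eta> s * n \<le> lam1"
    using order_tendstoD(2)[OF h0 \<open>0 < lam1 / n\<close>]
    by (rule eventually_mono) (use pos in \<open>simp add: pos_less_divide_eq\<close>)
  then have "\<forall>\<^sub>F s in at_right 0. w s \<le> (L + 1) * s powr \<rho>1 \<and> \<eta> s \<le> (L + 1) * s powr \<rho>2 \<and>
      \<eta> s * n \<le> lam1 \<and> D1 * s powr \<alpha>1 \<le> m \<and> D2 * s powr \<alpha>2 \<le> m"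
    by (intro eventually_conj rate_bound[OF wr] rate_bound[OF hr] powr_small pos)
  then obtain b where b: "b > 0" "\<And>s. 0 < s \<Longrightarrow> s < b \<Longrightarrow> w s \<le> (L + 1) * s powr \<rho>1 \<and> \<eta> s \<le> (L + 1) * s powr \<rho>2 \<and>
      \<eta> s * n \<le> lam1 \<and> D1 * s powr \<alpha>1 \<le> m \<and> D2 * s powr \<alpha>2 \<le> m"
    unfolding eventually_at_right_field by blast
  define r0 where "r0 = min 1 (b / 3)"
  have r0: "0 < r0" "r0 \<le> 1" "2 * r0 < b" "r0 < b" using b(1) by (auto simp: r0_def min_def)
  show ?thesis
  proof (intro exI[of _ r0] conjI allI impI; (elim conjE)?)
    fix s assume s: "0 < s" "s \<le> 2 * r0"
    then show "w s \<le> (L + 1) * s powr \<rho>1" "\<eta> s \<le> (L + 1) * s powr \<rho>2" "\<eta> s * n \<le> lam1"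
      using b(2)[of s] r0 by auto
  next
    fix s assume s: "0 < s" "s \<le> r0"
    then show "D1 * s powr \<alpha>1 \<le> m" "D2 * s powr \<alpha>2 \<le> m"
      using b(2)[of s] r0 by auto
  qed (use r0 in auto)
qed

section \<open>The contradiction at the maximum\<close>

lemma uniform_one_sided_holder:
  fixes F :: "real ^ 'n::{finite,wellorder} \<Rightarrow> real ^ 'n::_ \<Rightarrow> real ^ 'n::_ ^ 'n::_ \<Rightarrow> real"
    and c g :: "real ^ 'n::_ \<Rightarrow> real"
    and w \<eta> :: "real \<Rightarrow> real"
    and \<gamma> \<theta>0 M C1 C2 C3 lam1 q L \<rho>1 \<rho>2 \<theta> :: real
  assumes \<gamma>: "0 < \<gamma>"
    and \<theta>0: "\<theta>0 \<le> 1"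
    and M: "M > 1"
    and C12: "C1 > 0" "C2 > 0"
    and c: "levy_density \<gamma> C1 C2 C3 c"
    and g_holder: "\<And>x y. \<bar>g x - g y\<bar> \<le> M * norm (x - y) powr \<theta>0"
    and F_cont: "continuous_on (UNIV \<times> UNIV \<times> Sym) (\<lambda>(x, p, X). F x p X)"
    and lam1: "lam1 > 0"
    and F_partial_elliptic:
      "\<And>x p X Y. X \<in> Sym \<Longrightarrow> Y \<in> Sym \<Longrightarrow> sym_le (head_block k X) (head_block k Y) \<Longrightarrow>
         F x p X \<ge> F x p Y + lam1 * trace (head_block k Y - head_block k X)"
    and q: "q \<ge> 1"
    and w: "\<And>s. s \<ge> 0 \<Longrightarrow> w s \<ge> 0"
    and \<eta>: "\<And>s. s \<ge> 0 \<Longrightarrow> \<eta> s \<ge> 0" "(\<eta> \<longlongrightarrow> 0) (at_right 0)"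
    and F_modulus:
      "\<And>x y p X. X \<in> Sym \<Longrightarrow>
         \<bar>F x p X - F y p X\<bar> \<le> w (norm (x - y)) * norm (head_vec k p) powr q
           + \<eta> (norm (x - y)) * onorm ((*v) (head_block k X))"
    and L: "L > 0"
    and \<rho>: "\<rho>1 > 0" "\<rho>2 > 0"
    and w_rate: "\<exists>l\<le>L. ((\<lambda>s. w s * s powr (- \<rho>1)) \<longlongrightarrow> l) (at_right 0)"
    and \<eta>_rate: "\<exists>l\<le>L. ((\<lambda>s. \<eta> s * s powr (- \<rho>2)) \<longlongrightarrow> l) (at_right 0)"
    and exps: "\<rho>1 + \<gamma> > q" "\<rho>2 + \<gamma> > 2"
    and \<theta>: "0 < \<theta>" "\<theta> < \<theta>0"
  shows "\<exists>K>0. \<forall>lam>0. \<forall>v. Z_periodic v \<and> viscosity_solution lam F c g v \<and> (\<forall>x. \<bar>v x\<bar> \<le> M) \<longrightarrow>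
           (\<forall>x y. v x - v y \<le> K * norm (x - y) powr \<theta>)"
proof -
  have \<theta>': "0 < \<theta>" "\<theta> < 1" using \<theta> \<theta>0 by auto
  have \<theta>0': "0 \<le> \<theta>0" "\<theta> \<le> \<theta>0" using \<theta> by auto
  interpret levy \<gamma> C1 C2 C3 c by unfold_locales (use c C12 in auto)
  define n :: real where "n = (real CARD('n))\<^sup>2"
  have n: "1 \<le> n" unfolding n_def by (rule one_le_power) (simp add: Suc_leI)
  define m0 where "m0 = concavity_gap \<theta> * (C2 * unit_ball_vol (real CARD('n)) * ball_ratio \<theta> ^ CARD('n))"
  have m0: "0 < m0"
    using concavity_gap_pos[OF \<theta>'] C12(2) by (auto simp: m0_def ball_ratio_def intro!: mult_pos_pos)
  define D1 where "D1 = (L + 1) * (2 powr \<rho>1 * (2 * M) powr (q - 1))"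
  define D2 where "D2 = (L + 1) * 2 powr \<rho>2"
  have pos: "0 < \<rho>1 + \<gamma> - q" "0 < \<rho>2 + \<gamma> - 2" "0 < m0 / 4" "0 < lam1" "0 < n"
    using exps m0 lam1 n by auto
  obtain r0 where r0: "0 < r0" "r0 \<le> 1"
    and s: "\<And>s. 0 < s \<Longrightarrow> s \<le> 2 * r0 \<Longrightarrow> w s \<le> (L + 1) * s powr \<rho>1 \<and>
      \<eta> s \<le> (L + 1) * s powr \<rho>2 \<and> \<eta> s * n \<le> lam1"
    and D: "\<And>r. 0 < r \<Longrightarrow> r \<le> r0 \<Longrightarrow> D1 * r powr (\<rho>1 + \<gamma> - q) \<le> m0 / 4 \<and> D2 * r powr (\<rho>2 + \<gamma> - 2) \<le> m0 / 4"
    using smallness_radius[OF w_rate \<eta>_rate \<eta>(2) pos, of D1 D2] by blast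
  \<comment> \<open>The first summand forces r \<le> r0 at the maximum; the second makes
    \<open>m0 / 4 * K\<close> exceed the coefficient \<open>2 * M + 1\<close> of the datum and the
    error terms.\<close>
  define K where "K = 2 * M / r0 powr \<theta> + 4 * (2 * M + 1) / m0"
  have K1: "2 * M / r0 powr \<theta> < K" "4 * (2 * M + 1) / m0 < K" and K: "0 < K"
    using M m0 r0 by (auto simp: K_def intro: add_pos_pos)
  have rsmall: "r \<le> r0" if "0 < r" "K * r powr \<theta> \<le> 2 * M" for r
  proof (rule ccontr)
    assume "\<not> r \<le> r0"
    then have "r0 powr \<theta> \<le> r powr \<theta>" using r0 \<theta> by (intro powr_mono2) auto
    then have "K * r0 powr \<theta> \<le> 2 * M" using that(2) K mult_left_mono[of "r0 powr \<theta>" "r powr \<theta>" K] by linarith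
    moreover have "2 * M < K * r0 powr \<theta>" using K1(1) r0 by (simp add: pos_divide_less_eq)
    ultimately show False by linarith
  qed
  have main: "v x0 - v y0 \<le> K * norm (x0 - y0) powr \<theta>"
    if lam: "0 < lam" and per: "Z_periodic v" and sol: "viscosity_solution lam F c g v"
      and vM: "\<And>x. \<bar>v x\<bar> \<le> M" for lam v x0 y0
  proof (rule ccontr)
    assume "\<not> v x0 - v y0 \<le> K * norm (x0 - y0) powr \<theta>"
    then have \<sigma>0: "0 < v x0 - v y0 - K * norm (x0 - y0) powr \<theta>" by simp
    \<comment> \<open>Half of the excess, which is what the perturbed maximum is guaranteed to
      keep.\<close>
    define \<sigma> where "\<sigma> = (v x0 - v y0 - K * norm (x0 - y0) powr \<theta>) / 2"
    have \<sigma>: "0 < \<sigma>" using \<sigma>0 by (simp add: \<sigma>_def)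
    have cont: "continuous_on UNIV v"
      using sol usc_lsc_continuous
      unfolding viscosity_solution_def viscosity_subsolution_def viscosity_supersolution_def by blast
    obtain m where m: "0 < m" and uc: "\<forall>x y. norm (x - y) < m \<longrightarrow> \<bar>v x - v y\<bar> < \<sigma>"
      using periodic_uniformly_continuous[OF cont per \<sigma>] by blast
    \<comment> \<open>Chosen so that 4 M e = (m/8)^2, the squared distance allowed to the attaining
      points.\<close>
    define e where "e = m\<^sup>2 / (256 * M)"
    have e: "0 < e" "4 * M * e \<le> (m / 8)\<^sup>2" using m M by (auto simp: e_def power_divide)
    interpret doubling v M e K \<theta>
      by unfold_locales (use cont vM per e K \<theta>' in auto)
    have "2 * \<sigma> \<le> \<phi> x0 y0" using \<phi>_ge[of x0 y0] by (simp add: \<sigma>_def)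
    then have "0 < \<phi> x0 y0" using \<sigma> by linarith
    then obtain xh yh where xh: "xh \<in> cbox 0 1" and max: "\<And>x y. \<phi> x y \<le> \<phi> xh yh"
      using maximum_exists by blast
    have \<sigma>h: "2 * \<sigma> \<le> \<phi> xh yh" using max[of x0 y0] \<open>2 * \<sigma> \<le> \<phi> x0 y0\<close> by linarith
    note close = supconv_arg_close[OF uc m e(2) _ \<sigma>]
    have "3 * m / 4 \<le> norm (xh - yh)" by (rule close(3)) (use \<sigma>h \<sigma> in auto)
    then have ne: "xh \<noteq> yh" using m by auto
    define m' where "m' = 3 * m / 4"
    have m': "0 < m'" using m by (simp add: m'_def)
    define Am where "Am = K * (\<theta> * m' powr (\<theta> - 2))"
    have Am: "0 \<le> Am" using K \<theta> by (simp add: Am_def)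
    \<comment> \<open>With \<open>h\<close> \<le> 1 this dominates all form bounds:
      \<open>A + 2 * h\<close>, \<open>1 / e\<close> and \<open>1 / e + 4 * h\<close>.\<close>
    define Bx where "Bx = Am + 6 + 1 / e"
    define R where "R = cell_radius + m + 4 + Am + n * Bx"
    \<comment> \<open>Four such errors make m'^\<theta>0 \<le> r^\<theta>0, a quantity of the same
      order as the datum.\<close>
    define \<tau> where "\<tau> = m' powr \<theta>0 / 4"
    have \<tau>: "0 < \<tau>" using m' by (simp add: \<tau>_def)
    obtain \<delta> where \<delta>: "0 < \<delta>" and Fu: "\<And>x p p' X X'. norm x \<le> R \<Longrightarrow> norm p \<le> R \<Longrightarrow> norm p' \<le> R \<Longrightarrow>
       X \<in> Sym \<Longrightarrow> X' \<in> Sym \<Longrightarrow> norm X \<le> R \<Longrightarrow> norm X' \<le> R \<Longrightarrow> norm (p - p') < \<delta> \<Longrightarrow> norm (X - X') < \<delta> \<Longrightarrow>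
       \<bar>F x p X - F x p' X'\<bar> < \<tau>"
      using uniform_modulus_on_bounded[OF F_cont \<tau>, of R] by blast
    define I where "I = norm (mat 1 :: real ^ 'n::_ ^ 'n::_)"
    have I: "0 \<le> I" by (simp add: I_def)
    define h where "h = min (min 1 (2 * \<tau> / (4 * C1 + 2 * lam1))) (\<delta> / (2 * (1 + 4 * I)))"
    have h: "0 < h" "h \<le> 1" "4 * h * C1 + 2 * h * lam1 \<le> 2 * \<tau>" "h < \<delta>" "4 * h * I < \<delta>"
    proof -
      have I1: "0 < 1 + 4 * I" using I by linarith
      have C: "0 < 4 * C1 + 2 * lam1" using C12 lam1 by linarith
      show hp: "0 < h" using \<tau> C \<delta> I1 by (auto simp: h_def)
      show "h \<le> 1" unfolding h_def by linarith
      have "h \<le> 2 * \<tau> / (4 * C1 + 2 * lam1)" unfolding h_def by linarith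
      then show "4 * h * C1 + 2 * h * lam1 \<le> 2 * \<tau>" using C by (simp add: pos_le_divide_eq algebra_simps)
      have "h \<le> \<delta> / (2 * (1 + 4 * I))" unfolding h_def by linarith
      then have "h * (2 * (1 + 4 * I)) \<le> \<delta>" using I1 by (simp add: pos_le_divide_eq)
      then have "2 * h + 2 * (4 * h * I) \<le> \<delta>" by (simp add: algebra_simps)
      moreover have "0 \<le> 4 * h * I" using hp I by simp
      ultimately show "h < \<delta>" "4 * h * I < \<delta>" using hp by linarith+
    qed
    have \<phi>h: "0 < \<phi> xh yh" using \<sigma>h \<sigma> by linarith
    obtain x y p1 p2 X Y where xy: "x \<noteq> y" and nx: "norm (x - xh) < h" and \<phi>xy: "\<phi> xh yh / 2 \<le> \<phi> x y"
      and p1: "norm (p1 - slope x y *\<^sub>R (x - y)) < h"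
      and p2: "norm (p2 - slope x y *\<^sub>R (x - y)) < h"
      and X: "X \<in> Sym" and Y: "Y \<in> Sym"
      and jX: "touched_above v (Vc.\<xi> x) p1 X"
      and jY: "touched_below v (Wc.\<xi> y) p2 Y"
      and XB: "\<forall>k. (X *v k) \<bullet> k \<le> (slope x y + 2 * h) * (norm k)\<^sup>2"
      and YB: "\<forall>k. - ((Y *v k) \<bullet> k) \<le> (slope x y + 2 * h) * (norm k)\<^sup>2"
      and XY: "\<forall>k. (X *v k) \<bullet> k \<le> (Y *v k) \<bullet> k + 4 * h * (norm k)\<^sup>2"
      and Xl: "\<forall>k. - ((X *v k) \<bullet> k) \<le> 1 / e * (norm k)\<^sup>2"
      and Yl: "\<forall>k. (Y *v k) \<bullet> k \<le> 1 / e * (norm k)\<^sup>2"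
      and nl1: "\<forall>z. increment v (Vc.\<xi> x) p1 z - increment v (Wc.\<xi> y) p2 z \<le> 2 * h * (norm z)\<^sup>2"
      and nl2: "\<forall>z. (v (Vc.\<xi> x + z) - v (Vc.\<xi> x)) - (v (Wc.\<xi> y + z) - v (Wc.\<xi> y)) \<le> h"
      and nl3: "\<forall>z. increment v (Vc.\<xi> x) p1 z - increment v (Wc.\<xi> y) p2 z
         \<le> K * (norm (x - y + z) powr \<theta> - norm (x - y) powr \<theta>)
          + K * (norm (x - y - z) powr \<theta> - norm (x - y) powr \<theta>) + 2 * h * (norm z)\<^sup>2"
      using doubling_jets[OF max ne \<phi>h h(1)] by (elim exE conjE) (rule that, assumption+)
    note XB = XB[rule_format] and YB = YB[rule_format] and XY = XY[rule_format]
      and Xl = Xl[rule_format] and Yl = Yl[rule_format]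
    note nl = nl1[rule_format] nl2[rule_format] nl3[rule_format]
    define a where "a = x - y"
    define r where "r = norm a"
    have r: "0 < r" using xy by (simp add: r_def a_def)
    have \<sigma>xy: "\<sigma> \<le> \<phi> x y" using \<phi>xy \<sigma>h by linarith
    note cl = close[OF \<sigma>xy]
    define s' where "s' = norm (Vc.\<xi> x - Wc.\<xi> y)"
    have s': "0 < s'" "s' \<le> 2 * r" using cl by (auto simp: s'_def r_def a_def)
    have mr: "m' \<le> r" using cl(3) by (simp add: m'_def r_def a_def)
    have Kr: "K * r powr \<theta> \<le> 2 * M" using \<phi>_le[of x y] \<sigma>xy \<sigma> by (simp add: r_def a_def)
    have rr0: "r \<le> r0" using rsmall r Kr by blast
    then have r1: "r \<le> 1" using r0 by linarith
    define A where "A = K * (\<theta> * r powr (\<theta> - 2))"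
    have A: "0 \<le> A" "A \<le> Am"
    proof -
      show "0 \<le> A" using K \<theta> by (simp add: A_def)
      have "r powr (\<theta> - 2) \<le> m' powr (\<theta> - 2)" using mr m' \<theta>' by (intro powr_mono2') auto
      then show "A \<le> Am" using K \<theta> by (simp add: A_def Am_def)
    qed
    define P where "P = A *\<^sub>R a"
    have nP: "norm P = A * r" using A by (simp add: P_def r_def)
    have nP1: "norm P \<le> Am" unfolding nP using A r r1 mult_mono[of A Am r 1] by simp
    have pP: "norm (p1 - P) < h" "norm (p2 - P) < h"
      using p1 p2 by (auto simp: P_def A_def r_def a_def)
    \<comment> \<open>The shift restores the exact order X \<le> Y1 that ellipticity needs; the jets
      give it only up to \<open>4 * h\<close>.\<close>
    define Y1 where "Y1 = Y + (4 * h) *\<^sub>R mat 1"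
    have Y1: "Y1 \<in> Sym" unfolding Y1_def by (rule Sym_add_scaled_id[OF Y])
    have Y1f: "(Y1 *v u) \<bullet> u = (Y *v u) \<bullet> u + 4 * h * (norm u)\<^sup>2" for u
      unfolding Y1_def by (rule form_add_scaled_id)
    have XB': "(X *v u) \<bullet> u \<le> (A + 2 * h) * (norm u)\<^sup>2" and YB': "- ((Y *v u) \<bullet> u) \<le> (A + 2 * h) * (norm u)\<^sup>2" for u
      using XB[of u] YB[of u] by (auto simp: A_def r_def a_def)
    have form: "norm Z \<le> n * Bx" if Z: "Z \<in> Sym"
      and up: "\<And>u. (Z *v u) \<bullet> u \<le> Bx * (norm u)\<^sup>2" and lo: "\<And>u. - ((Z *v u) \<bullet> u) \<le> Bx * (norm u)\<^sup>2"
      for Z :: "real ^ 'n::_ ^ 'n::_"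
    proof -
      have "\<bar>(Z *v u) \<bullet> u\<bar> \<le> Bx * (norm u)\<^sup>2" for u using up[of u] lo[of u] by (simp add: abs_le_iff)
      from matrix_norm_le_of_form_bound[OF Z this] show ?thesis by (simp add: n_def power2_eq_square)
    qed
    have e1: "0 < 1 / e" using e(1) by simp
    have b1: "t * (norm u)\<^sup>2 \<le> Bx * (norm u)\<^sup>2" if "t \<le> Bx" for t and u :: "real ^ 'n::_"
      using that by (rule mult_right_mono) simp
    have Bs: "A + 2 * h \<le> Bx" "1 / e \<le> Bx" "1 / e + 4 * h \<le> Bx"
      using A h(1,2) e1 unfolding Bx_def by linarith+
    have nX: "norm X \<le> n * Bx"
      by (rule form[OF X]) (use XB' Xl b1[OF Bs(1)] b1[OF Bs(2)] in \<open>blast intro: order_trans\<close>)+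
    have nY: "norm Y \<le> n * Bx"
      by (rule form[OF Y]) (use YB' Yl b1[OF Bs(1)] b1[OF Bs(2)] in \<open>blast intro: order_trans\<close>)+
    have nY1: "norm Y1 \<le> n * Bx"
    proof (rule form[OF Y1])
      fix u
      have "(Y1 *v u) \<bullet> u \<le> (1 / e + 4 * h) * (norm u)\<^sup>2" using Yl[of u] by (simp add: Y1f distrib_right)
      then show "(Y1 *v u) \<bullet> u \<le> Bx * (norm u)\<^sup>2" using b1[OF Bs(3), of u] by linarith
      have "0 \<le> 4 * h * (norm u)\<^sup>2" using h(1) by simp
      then have "- ((Y1 *v u) \<bullet> u) \<le> (A + 2 * h) * (norm u)\<^sup>2" using YB'[of u] by (simp add: Y1f)
      then show "- ((Y1 *v u) \<bullet> u) \<le> Bx * (norm u)\<^sup>2" using b1[OF Bs(1), of u] by linarith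
    qed
    have "0 \<le> Bx" using Bs(2) e1 by linarith
    then have nB: "0 \<le> n * Bx" using n by simp
    have R: "cell_radius + m + 4 \<le> R" "Am + 1 \<le> R" "n * Bx \<le> R"
      using cell_radius(1) m Am nB unfolding R_def by linarith+
    have nxi: "norm (Vc.\<xi> x) \<le> cell_radius + m + 1"
    proof -
      have "Vc.\<xi> x = xh + (x - xh) - (x - Vc.\<xi> x)" by simp
      then have "norm (Vc.\<xi> x) \<le> norm (xh + (x - xh)) + norm (x - Vc.\<xi> x)"
        using norm_triangle_ineq4[of "xh + (x - xh)" "x - Vc.\<xi> x"] by (simp only:)
      then show ?thesis
        using norm_triangle_ineq[of xh "x - xh"] cell_radius(2)[OF xh] nx h(2) cl(1) m by linarith
    qed
    have nzeta: "norm (Wc.\<xi> y) \<le> cell_radius + m + 3"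
    proof -
      have "norm (Wc.\<xi> y) \<le> norm (Vc.\<xi> x) + s'"
        using norm_triangle_ineq4[of "Vc.\<xi> x" "Vc.\<xi> x - Wc.\<xi> y"] by (simp add: s'_def)
      then show ?thesis using nxi s'(2) r1 by linarith
    qed
    have np: "norm p1 \<le> R" "norm p2 \<le> R" "norm P \<le> R"
      using norm_triangle_sub[of p1 P] norm_triangle_sub[of p2 P] pP nP1 h(2) R(2) by linarith+
    \<comment> \<open>The gradients at the two points differ by tilts; both are exchanged for the
      gradient \<open>P\<close> of the test term.\<close>
    have F1: "\<bar>F (Vc.\<xi> x) p1 X - F (Vc.\<xi> x) P X\<bar> < \<tau>"
      by (rule Fu) (use nxi R np X nX pP(1) h(4) \<delta> in auto)
    have F2: "\<bar>F (Wc.\<xi> y) p2 Y - F (Wc.\<xi> y) P Y1\<bar> < \<tau>"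
    proof (rule Fu)
      have "norm (Y - Y1) = 4 * h * I" using h(1) by (simp add: Y1_def I_def)
      then show "norm (Y - Y1) < \<delta>" using h(5) by simp
    qed (use nzeta R np Y Y1 nY nY1 pP(2) h(4) in auto)
    have s2: "s' \<le> 2 * r0" using s'(2) rr0 by linarith
    note sm = s[OF s'(1) s2]
    have \<eta>s: "0 \<le> \<eta> s'" "0 \<le> w s'" using \<eta>(1) w s'(1) by auto
    have F3: "F (Wc.\<xi> y) P Y1 - F (Vc.\<xi> x) P X \<le> w s' * norm P powr q + \<eta> s' * (A + 2 * h)"
      unfolding s'_def
    proof (rule elliptic_difference_le[where F = F and k = k and w = w and \<eta> = \<eta> and q = q and ?lam1.0 = lam1
          and X = X and Y = Y1 and B = "A + 2 * h"])
      show "F x p X \<ge> F x p Y + lam1 * trace (head_block k Y - head_block k X)"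
        if "X \<in> Sym" "Y \<in> Sym" "sym_le (head_block k X) (head_block k Y)" for x p X Y
        using that by (rule F_partial_elliptic)
      show "\<bar>F x p X - F y p X\<bar> \<le> w (norm (x - y)) * norm (head_vec k p) powr q
           + \<eta> (norm (x - y)) * onorm ((*v) (head_block k X))" if "X \<in> Sym" for x y p X
        using that by (rule F_modulus)
      show "(X *v u) \<bullet> u \<le> (Y1 *v u) \<bullet> u" for u using XY[of u] by (simp add: Y1f)
      show "- ((Y1 *v u) \<bullet> u) \<le> (A + 2 * h) * (norm u)\<^sup>2" for u
      proof -
        have "0 \<le> 4 * h * (norm u)\<^sup>2" using h(1) by simp
        then show ?thesis using YB'[of u] by (simp add: Y1f)
      qed
    qed (use X Y1 XB' A h(1) q \<eta>s sm in \<open>auto simp: s'_def n_def\<close>)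
    have "m0 * (K * r powr (\<theta> - \<gamma>)) \<le> F (Wc.\<xi> y) p2 Y - F (Vc.\<xi> x) p1 X + (g (Vc.\<xi> x) - g (Wc.\<xi> y)) + 4 * h * C1"
      unfolding m0_def r_def
      by (rule viscosity_difference[OF sol lam \<gamma> cont vM \<theta>' K h(1) _ _ cl(6) X Y jX jY XY nl[folded a_def]])
         (use r r1 in \<open>auto simp: r_def\<close>)
    also have "\<dots> \<le> (w s' * norm P powr q + \<eta> s' * (A + 2 * h)) + 2 * \<tau> + M * s' powr \<theta>0 + 4 * h * C1"
      using F1 F2 F3 g_holder[of "Vc.\<xi> x" "Wc.\<xi> y"] unfolding s'_def by linarith
    finally have 1: "m0 * (K * r powr (\<theta> - \<gamma>))
      \<le> w s' * norm P powr q + \<eta> s' * (A + 2 * h) + 2 * \<tau> + M * s' powr \<theta>0 + 4 * h * C1" .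
    define Q where "Q = K * r powr (\<theta> - \<gamma>)"
    have Q: "0 < Q" using K r by (simp add: Q_def)
    have L1: "0 \<le> L + 1" using L by simp
    have T1: "w s' * norm P powr q \<le> m0 / 4 * Q"
    proof -
      have "w s' * norm P powr q \<le> (L + 1) * s' powr \<rho>1 * (A * r) powr q"
        unfolding nP using sm by (intro mult_right_mono) auto
      also have "\<dots> = (L + 1) * (s' powr \<rho>1 * (K * (\<theta> * r powr (\<theta> - 2)) * r) powr q)"
        by (simp add: A_def mult.assoc)
      also have "\<dots> \<le> (L + 1) * (2 powr \<rho>1 * (2 * M) powr (q - 1) * r powr (\<rho>1 + \<gamma> - q) * (K * r powr (\<theta> - \<gamma>)))"
        using s' r K Kr \<theta>' q \<rho> by (intro mult_left_mono[OF _ L1] gradient_term_le) auto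
      also have "\<dots> = D1 * r powr (\<rho>1 + \<gamma> - q) * Q" by (simp add: D1_def Q_def mult_ac)
      also have "\<dots> \<le> m0 / 4 * Q" using D[OF r rr0] Q by (intro mult_right_mono) auto
      finally show ?thesis .
    qed
    have T2: "\<eta> s' * A \<le> m0 / 4 * Q"
    proof -
      have "\<eta> s' * A \<le> (L + 1) * s' powr \<rho>2 * A"
        using sm A by (intro mult_right_mono) auto
      also have "\<dots> = (L + 1) * (s' powr \<rho>2 * (K * (\<theta> * r powr (\<theta> - 2))))"
        by (simp add: A_def mult.assoc)
      also have "\<dots> \<le> (L + 1) * (2 powr \<rho>2 * r powr (\<rho>2 + \<gamma> - 2) * (K * r powr (\<theta> - \<gamma>)))"
        using s' r K \<theta>' \<rho> by (intro mult_left_mono[OF _ L1] hessian_term_le) auto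
      also have "\<dots> = D2 * r powr (\<rho>2 + \<gamma> - 2) * Q" by (simp add: D2_def Q_def mult_ac)
      also have "\<dots> \<le> m0 / 4 * Q" using D[OF r rr0] Q by (intro mult_right_mono) auto
      finally show ?thesis .
    qed
    have T3: "\<eta> s' * (2 * h) + 2 * \<tau> + 4 * h * C1 \<le> r powr \<theta>0"
    proof -
      have "\<eta> s' * 1 \<le> \<eta> s' * n" using n \<eta>s by (intro mult_left_mono) auto
      then have "\<eta> s' \<le> lam1" using sm by linarith
      then have "\<eta> s' * (2 * h) \<le> lam1 * (2 * h)" using h(1) by (intro mult_right_mono) auto
      moreover have "lam1 * (2 * h) = 2 * h * lam1" by simp
      ultimately have "\<eta> s' * (2 * h) + 2 * \<tau> + 4 * h * C1 \<le> 4 * \<tau>" using h(3) by linarith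
      also have "\<dots> = m' powr \<theta>0" by (simp add: \<tau>_def)
      also have "\<dots> \<le> r powr \<theta>0" using mr m' \<theta>0' by (intro powr_mono2) auto
      finally show ?thesis .
    qed
    have T4: "M * s' powr \<theta>0 \<le> 2 * M * r powr \<theta>0"
    proof -
      have "s' powr \<theta>0 \<le> (2 * r) powr \<theta>0" using s' \<theta>0' by (intro powr_mono2) auto
      also have "\<dots> = 2 powr \<theta>0 * r powr \<theta>0" using r by (simp add: powr_mult)
      also have "\<dots> \<le> 2 powr 1 * r powr \<theta>0" using \<theta>0 by (intro mult_right_mono powr_mono) auto
      finally show ?thesis using M by simp
    qed
    \<comment> \<open>Here r \<le> 1 and \<theta> - \<gamma> \<le> \<theta>0 bring the datum to the
      order of the concavity gain.\<close>
    have "r powr \<theta>0 \<le> r powr (\<theta> - \<gamma>)" using r r1 \<theta>0' \<gamma> by (intro powr_mono') auto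
    then have "(2 * M + 1) * r powr \<theta>0 \<le> (2 * M + 1) * r powr (\<theta> - \<gamma>)" using M by (intro mult_left_mono) auto
    moreover have "\<dots> < m0 / 4 * Q"
    proof -
      have "2 * M + 1 < m0 / 4 * K" using K1(2) m0 by (simp add: pos_divide_less_eq mult_ac)
      then have "(2 * M + 1) * r powr (\<theta> - \<gamma>) < (m0 / 4 * K) * r powr (\<theta> - \<gamma>)"
        using r by (intro mult_strict_right_mono) auto
      then show ?thesis by (simp add: Q_def mult_ac)
    qed
    moreover have "\<eta> s' * (A + 2 * h) = \<eta> s' * A + \<eta> s' * (2 * h)" by (rule distrib_left)
    moreover have "(2 * M + 1) * r powr \<theta>0 = 2 * M * r powr \<theta>0 + r powr \<theta>0" by (simp add: distrib_right)
    \<comment> \<open>Gradient term, Hessian term and datum with errors take at most a quarter of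
      the gain each, so a quarter is left over.\<close>
    ultimately have "m0 * Q < 3 * (m0 / 4 * Q)"
      using 1[folded Q_def] T1 T2 T3 T4 by linarith
    then show False using m0 Q by simp
  qed
  show ?thesis using K main by blast
qed

theorem theorem4p2:
  fixes F :: "real ^ 'n::{finite,wellorder} \<Rightarrow> real ^ 'n::_ \<Rightarrow> real ^ 'n::_ ^ 'n::_ \<Rightarrow> real"
    and c g :: "real ^ 'n::_ \<Rightarrow> real"
    and w \<eta> :: "real \<Rightarrow> real"
    and \<gamma> \<theta>0 M C1 C2 C3 lam1 q L \<rho>1 \<rho>2 \<theta> :: real
    and k :: nat
  assumes N: "CARD('n) \<ge> 2"
    and \<gamma>: "0 < \<gamma>" "\<gamma> < 2"
    and \<theta>0: "0 \<le> \<theta>0" "\<theta>0 \<le> 1"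
    and M: "M > 1"
    and C123: "C1 > 0" "C2 > 0" "C3 > 0"
    and c: "levy_density \<gamma> C1 C2 C3 c"
    and g_periodic: "Z_periodic g"
    and g_holder: "\<And>x y. \<bar>g x - g y\<bar> \<le> M * norm (x - y) powr \<theta>0"
    and F_cont: "continuous_on (UNIV \<times> UNIV \<times> Sym) (\<lambda>(x, p, X). F x p X)"
    and F_elliptic:
      "\<And>x p X Y. X \<in> Sym \<Longrightarrow> Y \<in> Sym \<Longrightarrow> sym_le X Y \<Longrightarrow> F x p X \<ge> F x p Y"
    and F_periodic: "\<And>p X. X \<in> Sym \<Longrightarrow> Z_periodic (\<lambda>x. F x p X)"
    and k: "0 < k" "k \<le> CARD('n)"
    and lam1: "lam1 > 0"
    and F_partial_elliptic:
      "\<And>x p X Y. X \<in> Sym \<Longrightarrow> Y \<in> Sym \<Longrightarrow> sym_le (head_block k X) (head_block k Y) \<Longrightarrow>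
         F x p X \<ge> F x p Y + lam1 * trace (head_block k Y - head_block k X)"
    and q: "q \<ge> 1"
    and w: "\<And>s. s \<ge> 0 \<Longrightarrow> w s \<ge> 0" "(w \<longlongrightarrow> 0) (at_right 0)"
    and \<eta>: "\<And>s. s \<ge> 0 \<Longrightarrow> \<eta> s \<ge> 0" "(\<eta> \<longlongrightarrow> 0) (at_right 0)"
    and F_modulus:
      "\<And>x y p X. X \<in> Sym \<Longrightarrow>
         \<bar>F x p X - F y p X\<bar> \<le> w (norm (x - y)) * norm (head_vec k p) powr q
           + \<eta> (norm (x - y)) * onorm ((*v) (head_block k X))"
    and L: "L > 0"
    and \<rho>: "\<rho>1 > 0" "\<rho>2 > 0"
    and w_rate: "\<exists>l\<le>L. ((\<lambda>s. w s * s powr (- \<rho>1)) \<longlongrightarrow> l) (at_right 0)"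
    and \<eta>_rate: "\<exists>l\<le>L. ((\<lambda>s. \<eta> s * s powr (- \<rho>2)) \<longlongrightarrow> l) (at_right 0)"
    and exps: "\<rho>1 + \<gamma> > q" "\<rho>2 + \<gamma> > 2"
    and \<theta>: "0 < \<theta>" "\<theta> < \<theta>0"
  shows "(\<forall>lam>0. \<exists>C>0. \<forall>v. Z_periodic v \<and> viscosity_solution lam F c g v \<and>
             bdd_above (range (\<lambda>x. \<bar>v x\<bar>)) \<and> (SUP x. \<bar>v x\<bar>) < M \<longrightarrow>
             holder_bound C lam \<theta> v) \<and>
         (\<exists>C>0. \<forall>lam v. 0 < lam \<and> lam < 1 \<and> Z_periodic v \<and> viscosity_solution lam F c g v \<and>
             bdd_above (range (\<lambda>x. \<bar>v x\<bar>)) \<and> (SUP x. \<bar>v x\<bar>) < M \<longrightarrow>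
             holder_bound C lam \<theta> v)"
proof -
  have "\<exists>K>0. \<forall>lam>0. \<forall>v. Z_periodic v \<and> viscosity_solution lam F c g v \<and> (\<forall>x. \<bar>v x\<bar> \<le> M) \<longrightarrow>
           (\<forall>x y. v x - v y \<le> K * norm (x - y) powr \<theta>)"
    by (rule uniform_one_sided_holder[where F = F and c = c and g = g and w = w and \<eta> = \<eta> and k = k
          and \<gamma> = \<gamma> and ?\<theta>0.0 = \<theta>0 and M = M and ?C1.0 = C1 and ?C2.0 = C2 and ?C3.0 = C3
          and ?lam1.0 = lam1 and q = q and L = L and ?\<rho>1.0 = \<rho>1 and ?\<rho>2.0 = \<rho>2 and \<theta> = \<theta>,
          OF \<gamma>(1) \<theta>0(2) M C123(1,2) c g_holder F_cont lam1])
       (use F_partial_elliptic q w(1) \<eta> F_modulus L \<rho> w_rate \<eta>_rate exps \<theta> in auto)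
  then obtain K where K: "0 < K" and osc: "\<And>lam v x y. 0 < lam \<Longrightarrow> Z_periodic v \<Longrightarrow>
      viscosity_solution lam F c g v \<Longrightarrow> (\<forall>x. \<bar>v x\<bar> \<le> M) \<Longrightarrow> v x - v y \<le> K * norm (x - y) powr \<theta>"
    by blast
  have holder: "holder_bound C lam \<theta> v"
    if "0 < lam" "K \<le> C / lam" "Z_periodic v" "viscosity_solution lam F c g v"
      "bdd_above (range (\<lambda>x. \<bar>v x\<bar>))" "(SUP x. \<bar>v x\<bar>) < M" for C lam v
  proof -
    have "\<bar>v x\<bar> \<le> M" for x
      using cSUP_upper[OF UNIV_I that(5), of x] that(6) by linarith
    then have le: "v x - v y \<le> K * norm (x - y) powr \<theta>" for x y
      using osc that(1,3,4) by blast
    have "\<bar>v x - v y\<bar> \<le> C / lam * norm (x - y) powr \<theta>" for x y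
    proof -
      have "\<bar>v x - v y\<bar> \<le> K * norm (x - y) powr \<theta>"
        using le[of x y] le[of y x] by (simp add: norm_minus_commute)
      also have "\<dots> \<le> C / lam * norm (x - y) powr \<theta>"
        using that(2) by (intro mult_right_mono) auto
      finally show ?thesis .
    qed
    then show ?thesis by (simp add: holder_bound_def)
  qed
  show ?thesis
  proof (intro conjI allI impI)
    fix lam :: real assume "0 < lam"
    then show "\<exists>C>0. \<forall>v. Z_periodic v \<and> viscosity_solution lam F c g v \<and>
             bdd_above (range (\<lambda>x. \<bar>v x\<bar>)) \<and> (SUP x. \<bar>v x\<bar>) < M \<longrightarrow> holder_bound C lam \<theta> v"
      using K holder[of lam "K * lam"] by (intro exI[of _ "K * lam"]) auto
  next
    have "K \<le> K / lam" if "0 < lam" "lam < 1" for lam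
      using that K by (simp add: pos_le_divide_eq)
    then show "\<exists>C>0. \<forall>lam v. 0 < lam \<and> lam < 1 \<and> Z_periodic v \<and> viscosity_solution lam F c g v \<and>
             bdd_above (range (\<lambda>x. \<bar>v x\<bar>)) \<and> (SUP x. \<bar>v x\<bar>) < M \<longrightarrow> holder_bound C lam \<theta> v"
      using K holder[of _ K] by (intro exI[of _ K]) auto
  qed
qed

end
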